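(* Let $(\Omega,\sigma)$, $\sigma=(\sigma_1,\dots,\sigma_n)$, be a multivariable dynamical system on a locally compact space $\Omega$ and assume that the set $$\Omega_0=\{v\in\Omega : \sigma_u(v)=\sigma_w(v)\ \text{for some } u,w\in\mathbb{F}_n^+ \text{ with } |u|\neq|w|\}$$ has empty interior. Then every approximately local derivation on the tensor algebra $\mathcal{T}^+(\Omega,\sigma)$ is a derivation.
   Context: A multivariable dynamical system $(\Omega,\sigma)$ is a $\sigma$-compact locally compact Hausdorff space $\Omega$ together with finitely many proper continuous self maps $\sigma=(\sigma_1,\dots,\sigma_n)$. $\mathbb{F}_n^+$ is the free semigroup of finite words in $\{1,\dots,n\}$, $|u|$ is the length of a word $u$, and $\sigma_u=\sigma_{i_k}\circ\sigma_{i_{k-1}}\circ\dots\circ\sigma_{i_1}$ for $u=i_ki_{k-1}\cdots i_1$. A $C^*$-correspondence $X$ over a $C^*$-algebra $A$ is a right Hilbert $A$-module with a left action of $A$ by adjointable operators (given by a $*$-homomorphism $A\to\mathcal{L}(X)$). A Toeplitz representation of $X$ is a pair $(\pi,t)$ of a $*$-homomorphism $\pi$ of $A$ and a linear map $t$ of $X$ into a $C^*$-algebra with $\pi(a)t(\xi)=t(a\xi)$ and $t(\xi)^*t(\eta)=\pi(\langle\xi,\eta\rangle)$; the tensor algebra $\mathcal{T}_X^+$ is the norm-closed algebra generated by the images of $A$ and $X$ under the universal Toeplitz representation. $\mathcal{T}^+(\Omega,\sigma)$ is the tensor algebra of the topological graph with vertex space $\Omega$, edge space $\{1,\dots,n\}\times\Omega$,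 $s(i,x)=x$, $r(i,x)=\sigma_i(x)$; that is, $\mathcal{T}^+(\Omega,\sigma)=\mathcal{T}_X^+$ for $X=C_0(\{1,\dots,n\}\times\Omega)$ over $C_0(\Omega)$ with $(fFg)(i,x)=f(\sigma_i(x))F(i,x)g(x)$ and $\langle F,G\rangle(x)=\sum_{i=1}^n\overline{F(i,x)}G(i,x)$. All linear maps are bounded. A derivation of a Banach algebra $\mathcal{A}$ is a bounded linear map $\delta:\mathcal{A}\to\mathcal{A}$ with $\delta(AB)=\delta(A)B+A\delta(B)$. A bounded linear map $\delta:\mathcal{A}\to\mathcal{A}$ is an approximately local derivation if for every $A\in\mathcal{A}$ there is a sequence of derivations $\delta_{A,k}$ of $\mathcal{A}$ with $\delta(A)=\lim_k\delta_{A,k}(A)$. *)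

theory Defs
  imports "HOL-Analysis.Analysis"
begin

section \<open>Normed spaces, Banach algebras and C*-algebras on carrier sets\<close>

text \<open>Structures are records over a carrier set rather than type classes, because the universal
  property of a Toeplitz representation quantifies over all C*-algebras.\<close>

record 'a cspace =
  vec :: "'a set"
  vzero :: 'a
  vadd :: "'a \<Rightarrow> 'a \<Rightarrow> 'a"
  vscale :: "complex \<Rightarrow> 'a \<Rightarrow> 'a"
  vnorm :: "'a \<Rightarrow> real"

record 'a calg = "'a cspace" +
  amult :: "'a \<Rightarrow> 'a \<Rightarrow> 'a"

record 'a staralg = "'a calg" +
  astar :: "'a \<Rightarrow> 'a"

definition vminus :: "('a, 'm) cspace_scheme \<Rightarrow> 'a \<Rightarrow> 'a \<Rightarrow> 'a" where
  "vminus V x y = vadd V x (vscale V (-1) y)"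

definition vconverges :: "('a, 'm) cspace_scheme \<Rightarrow> (nat \<Rightarrow> 'a) \<Rightarrow> 'a \<Rightarrow> bool" where
  "vconverges V s l \<longleftrightarrow> (\<lambda>k. vnorm V (vminus V (s k) l)) \<longlonglongrightarrow> 0"

definition vCauchy :: "('a, 'm) cspace_scheme \<Rightarrow> (nat \<Rightarrow> 'a) \<Rightarrow> bool" where
  "vCauchy V s \<longleftrightarrow> (\<forall>e>0. \<exists>N. \<forall>j\<ge>N. \<forall>k\<ge>N. vnorm V (vminus V (s j) (s k)) < e)"

locale complex_banach_space =
  fixes V :: "('a, 'm) cspace_scheme"
  assumes zero_mem: "vzero V \<in> vec V"
    and add_mem: "\<lbrakk>x \<in> vec V; y \<in> vec V\<rbrakk> \<Longrightarrow> vadd V x y \<in> vec V"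
    and scale_mem: "x \<in> vec V \<Longrightarrow> vscale V c x \<in> vec V"
    and add_assoc: "\<lbrakk>x \<in> vec V; y \<in> vec V; z \<in> vec V\<rbrakk>
      \<Longrightarrow> vadd V (vadd V x y) z = vadd V x (vadd V y z)"
    and add_commute: "\<lbrakk>x \<in> vec V; y \<in> vec V\<rbrakk> \<Longrightarrow> vadd V x y = vadd V y x"
    and add_zero: "x \<in> vec V \<Longrightarrow> vadd V x (vzero V) = x"
    and diff_self: "x \<in> vec V \<Longrightarrow> vminus V x x = vzero V"
    and scale_add_right: "\<lbrakk>x \<in> vec V; y \<in> vec V\<rbrakk>
      \<Longrightarrow> vscale V c (vadd V x y) = vadd V (vscale V c x) (vscale V c y)"
    and scale_add_left: "x \<in> vec V \<Longrightarrow> vscale V (c + d) x = vadd V (vscale V c x) (vscale V d x)"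
    and scale_scale: "x \<in> vec V \<Longrightarrow> vscale V c (vscale V d x) = vscale V (c * d) x"
    and scale_one: "x \<in> vec V \<Longrightarrow> vscale V 1 x = x"
    and norm_eq_zero: "x \<in> vec V \<Longrightarrow> vnorm V x = 0 \<longleftrightarrow> x = vzero V"
    and norm_triangle: "\<lbrakk>x \<in> vec V; y \<in> vec V\<rbrakk> \<Longrightarrow> vnorm V (vadd V x y) \<le> vnorm V x + vnorm V y"
    and norm_scale: "x \<in> vec V \<Longrightarrow> vnorm V (vscale V c x) = cmod c * vnorm V x"
    and complete: "\<lbrakk>range s \<subseteq> vec V; vCauchy V s\<rbrakk> \<Longrightarrow> \<exists>l\<in>vec V. vconverges V s l"

locale complex_banach_algebra = complex_banach_space A for A :: "('a, 'm) calg_scheme" +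
  assumes mult_mem: "\<lbrakk>x \<in> vec A; y \<in> vec A\<rbrakk> \<Longrightarrow> amult A x y \<in> vec A"
    and mult_assoc: "\<lbrakk>x \<in> vec A; y \<in> vec A; z \<in> vec A\<rbrakk>
      \<Longrightarrow> amult A (amult A x y) z = amult A x (amult A y z)"
    and mult_add_left: "\<lbrakk>x \<in> vec A; y \<in> vec A; z \<in> vec A\<rbrakk>
      \<Longrightarrow> amult A (vadd A x y) z = vadd A (amult A x z) (amult A y z)"
    and mult_add_right: "\<lbrakk>x \<in> vec A; y \<in> vec A; z \<in> vec A\<rbrakk>
      \<Longrightarrow> amult A x (vadd A y z) = vadd A (amult A x y) (amult A x z)"
    and mult_scale_left: "\<lbrakk>x \<in> vec A; y \<in> vec A\<rbrakk>
      \<Longrightarrow> amult A (vscale A c x) y = vscale A c (amult A x y)"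
    and mult_scale_right: "\<lbrakk>x \<in> vec A; y \<in> vec A\<rbrakk>
      \<Longrightarrow> amult A x (vscale A c y) = vscale A c (amult A x y)"
    and norm_mult: "\<lbrakk>x \<in> vec A; y \<in> vec A\<rbrakk> \<Longrightarrow> vnorm A (amult A x y) \<le> vnorm A x * vnorm A y"

locale cstar_algebra = complex_banach_algebra A for A :: "('a, 'm) staralg_scheme" +
  assumes star_mem: "x \<in> vec A \<Longrightarrow> astar A x \<in> vec A"
    and star_star: "x \<in> vec A \<Longrightarrow> astar A (astar A x) = x"
    and star_add: "\<lbrakk>x \<in> vec A; y \<in> vec A\<rbrakk> \<Longrightarrow> astar A (vadd A x y) = vadd A (astar A x) (astar A y)"
    and star_scale: "x \<in> vec A \<Longrightarrow> astar A (vscale A c x) = vscale A (cnj c) (astar A x)"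
    and star_mult: "\<lbrakk>x \<in> vec A; y \<in> vec A\<rbrakk>
      \<Longrightarrow> astar A (amult A x y) = amult A (astar A y) (astar A x)"
    and cstar_identity: "x \<in> vec A \<Longrightarrow> vnorm A (amult A (astar A x) x) = (vnorm A x)\<^sup>2"

definition bounded_linear_map ::
    "('a, 'm) cspace_scheme \<Rightarrow> ('b, 'k) cspace_scheme \<Rightarrow> ('a \<Rightarrow> 'b) \<Rightarrow> bool" where
  "bounded_linear_map V W f \<longleftrightarrow>
     f ` vec V \<subseteq> vec W \<and>
     (\<forall>x\<in>vec V. \<forall>y\<in>vec V. f (vadd V x y) = vadd W (f x) (f y)) \<and>
     (\<forall>c. \<forall>x\<in>vec V. f (vscale V c x) = vscale W c (f x)) \<and>
     (\<exists>K. \<forall>x\<in>vec V. vnorm W (f x) \<le> K * vnorm V x)"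

definition star_hom :: "('a, 'm) staralg_scheme \<Rightarrow> ('b, 'k) staralg_scheme \<Rightarrow> ('a \<Rightarrow> 'b) \<Rightarrow> bool" where
  "star_hom A B f \<longleftrightarrow>
     bounded_linear_map A B f \<and>
     (\<forall>x\<in>vec A. \<forall>y\<in>vec A. f (amult A x y) = amult B (f x) (f y)) \<and>
     (\<forall>x\<in>vec A. f (astar A x) = astar B (f x))"

definition closed_subalgebra :: "('a, 'm) calg_scheme \<Rightarrow> 'a set \<Rightarrow> bool" where
  "closed_subalgebra A D \<longleftrightarrow>
     D \<subseteq> vec A \<and> vzero A \<in> D \<and>
     (\<forall>x\<in>D. \<forall>y\<in>D. vadd A x y \<in> D \<and> amult A x y \<in> D) \<and>
     (\<forall>c. \<forall>x\<in>D. vscale A c x \<in> D) \<and>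
     (\<forall>s l. range s \<subseteq> D \<and> l \<in> vec A \<and> vconverges A s l \<longrightarrow> l \<in> D)"

definition closed_algebra_generated ::
    "('a, 'm) calg_scheme \<Rightarrow> 'a set \<Rightarrow> ('a, 'm) calg_scheme" where
  "closed_algebra_generated A S = A\<lparr>vec := \<Inter>{D. closed_subalgebra A D \<and> S \<subseteq> D}\<rparr>"

definition cstar_algebra_generated ::
    "('a, 'm) staralg_scheme \<Rightarrow> 'a set \<Rightarrow> ('a, 'm) staralg_scheme" where
  "cstar_algebra_generated A S =
     A\<lparr>vec := \<Inter>{D. closed_subalgebra A D \<and> astar A ` D \<subseteq> D \<and> S \<subseteq> D}\<rparr>"


section \<open>Derivations\<close>

definition derivation :: "('a, 'm) calg_scheme \<Rightarrow> ('a \<Rightarrow> 'a) \<Rightarrow> bool" where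
  "derivation A \<delta> \<longleftrightarrow>
     bounded_linear_map A A \<delta> \<and>
     (\<forall>x\<in>vec A. \<forall>y\<in>vec A. \<delta> (amult A x y) = vadd A (amult A (\<delta> x) y) (amult A x (\<delta> y)))"

definition approximately_local_derivation :: "('a, 'm) calg_scheme \<Rightarrow> ('a \<Rightarrow> 'a) \<Rightarrow> bool" where
  "approximately_local_derivation A \<delta> \<longleftrightarrow>
     bounded_linear_map A A \<delta> \<and>
     (\<forall>x\<in>vec A. \<exists>D :: nat \<Rightarrow> 'a \<Rightarrow> 'a.
        (\<forall>k. derivation A (D k)) \<and> vconverges A (\<lambda>k. D k x) (\<delta> x))"


section \<open>C*-correspondences and their tensor algebras\<close>

record ('a, 'x) correspondence = "'x cspace" +
  lact :: "'a \<Rightarrow> 'x \<Rightarrow> 'x"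
  ract :: "'x \<Rightarrow> 'a \<Rightarrow> 'x"
  ainner :: "'x \<Rightarrow> 'x \<Rightarrow> 'a"

text \<open>Positivity of \<open>\<langle>x, x\<rangle>\<close> is expressed as being of the form \<open>b\<^sup>* b\<close>. The last assumption says that
  left multiplication by \<open>a\<close> is adjointable with adjoint left multiplication by \<open>a\<^sup>*\<close>, so that the
  left action is a *-homomorphism into the adjointable operators.\<close>

locale cstar_correspondence = A: cstar_algebra A + X: complex_banach_space X
  for A :: "('a, 'm) staralg_scheme" and X :: "('a, 'x, 'k) correspondence_scheme" +
  assumes ract_mem: "\<lbrakk>x \<in> vec X; a \<in> vec A\<rbrakk> \<Longrightarrow> ract X x a \<in> vec X"
    and ract_mult: "\<lbrakk>x \<in> vec X; a \<in> vec A; b \<in> vec A\<rbrakk>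
      \<Longrightarrow> ract X x (amult A a b) = ract X (ract X x a) b"
    and ract_add_left: "\<lbrakk>x \<in> vec X; y \<in> vec X; a \<in> vec A\<rbrakk>
      \<Longrightarrow> ract X (vadd X x y) a = vadd X (ract X x a) (ract X y a)"
    and ract_add_right: "\<lbrakk>x \<in> vec X; a \<in> vec A; b \<in> vec A\<rbrakk>
      \<Longrightarrow> ract X x (vadd A a b) = vadd X (ract X x a) (ract X x b)"
    and ract_scale_left: "\<lbrakk>x \<in> vec X; a \<in> vec A\<rbrakk> \<Longrightarrow> ract X (vscale X c x) a = vscale X c (ract X x a)"
    and ract_scale_right: "\<lbrakk>x \<in> vec X; a \<in> vec A\<rbrakk> \<Longrightarrow> ract X x (vscale A c a) = vscale X c (ract X x a)"
    and inner_mem: "\<lbrakk>x \<in> vec X; y \<in> vec X\<rbrakk> \<Longrightarrow> ainner X x y \<in> vec A"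
    and inner_add: "\<lbrakk>x \<in> vec X; y \<in> vec X; z \<in> vec X\<rbrakk>
      \<Longrightarrow> ainner X x (vadd X y z) = vadd A (ainner X x y) (ainner X x z)"
    and inner_scale: "\<lbrakk>x \<in> vec X; y \<in> vec X\<rbrakk> \<Longrightarrow> ainner X x (vscale X c y) = vscale A c (ainner X x y)"
    and inner_ract: "\<lbrakk>x \<in> vec X; y \<in> vec X; a \<in> vec A\<rbrakk>
      \<Longrightarrow> ainner X x (ract X y a) = amult A (ainner X x y) a"
    and inner_star: "\<lbrakk>x \<in> vec X; y \<in> vec X\<rbrakk> \<Longrightarrow> astar A (ainner X x y) = ainner X y x"
    and inner_pos: "x \<in> vec X \<Longrightarrow> \<exists>b\<in>vec A. ainner X x x = amult A (astar A b) b"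
    and norm_inner: "x \<in> vec X \<Longrightarrow> vnorm X x = sqrt (vnorm A (ainner X x x))"
    and lact_mem: "\<lbrakk>a \<in> vec A; x \<in> vec X\<rbrakk> \<Longrightarrow> lact X a x \<in> vec X"
    and lact_mult: "\<lbrakk>a \<in> vec A; b \<in> vec A; x \<in> vec X\<rbrakk>
      \<Longrightarrow> lact X (amult A a b) x = lact X a (lact X b x)"
    and lact_add_left: "\<lbrakk>a \<in> vec A; b \<in> vec A; x \<in> vec X\<rbrakk>
      \<Longrightarrow> lact X (vadd A a b) x = vadd X (lact X a x) (lact X b x)"
    and lact_scale_left: "\<lbrakk>a \<in> vec A; x \<in> vec X\<rbrakk> \<Longrightarrow> lact X (vscale A c a) x = vscale X c (lact X a x)"
    and lact_adjoint: "\<lbrakk>a \<in> vec A; x \<in> vec X; y \<in> vec X\<rbrakk>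
      \<Longrightarrow> ainner X (lact X a x) y = ainner X x (lact X (astar A a) y)"

definition toeplitz_representation ::
    "('a, 'm) staralg_scheme \<Rightarrow> ('a, 'x, 'k) correspondence_scheme \<Rightarrow> ('b, 'l) staralg_scheme
      \<Rightarrow> ('a \<Rightarrow> 'b) \<Rightarrow> ('x \<Rightarrow> 'b) \<Rightarrow> bool" where
  "toeplitz_representation A X B \<pi> t \<longleftrightarrow>
     cstar_correspondence A X \<and> cstar_algebra B \<and> star_hom A B \<pi> \<and> bounded_linear_map X B t \<and>
     (\<forall>a\<in>vec A. \<forall>x\<in>vec X. amult B (\<pi> a) (t x) = t (lact X a x)) \<and>
     (\<forall>x\<in>vec X. \<forall>y\<in>vec X. amult B (astar B (t x)) (t y) = \<pi> (ainner X x y))"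

text \<open>In HOL one cannot quantify over all types inside a definition, so the universal property is
  tested on C*-algebras with carrier in the type \<open>nat \<Rightarrow> 'a + 'x\<close>. This is no restriction: a
  C*-algebra generated by the image of a Toeplitz representation of \<open>X\<close> consists of limits of
  sequences in a set of cardinality at most \<open>max (\<aleph>\<^sub>0) \<bar>'a + 'x\<bar>\<close>, hence has at most
  \<open>\<bar>nat \<Rightarrow> 'a + 'x\<bar>\<close> elements and is isomorphic to one with carrier in that type.\<close>

definition universal_toeplitz_representation ::
    "('a, 'm) staralg_scheme \<Rightarrow> ('a, 'x, 'k) correspondence_scheme \<Rightarrow> ('b, 'l) staralg_scheme
      \<Rightarrow> ('a \<Rightarrow> 'b) \<Rightarrow> ('x \<Rightarrow> 'b) \<Rightarrow> bool" where
  "universal_toeplitz_representation A X B \<pi> t \<longleftrightarrow>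
     toeplitz_representation A X B \<pi> t \<and>
     (\<forall>(C :: (nat \<Rightarrow> 'a + 'x) staralg) \<pi>' t'. toeplitz_representation A X C \<pi>' t' \<longrightarrow>
        (\<exists>\<phi>. star_hom (cstar_algebra_generated B (\<pi> ` vec A \<union> t ` vec X)) C \<phi> \<and>
             (\<forall>a\<in>vec A. \<phi> (\<pi> a) = \<pi>' a) \<and> (\<forall>x\<in>vec X. \<phi> (t x) = t' x)))"

text \<open>When \<open>(\<pi>, t)\<close> is a universal Toeplitz representation of \<open>X\<close>, the following is the tensor
  algebra of \<open>X\<close>. Its carrier is in general not closed under \<open>astar\<close>; only its structure as a
  Banach algebra is meaningful.\<close>

definition tensor_algebra ::
    "('a, 'm) staralg_scheme \<Rightarrow> ('a, 'x, 'k) correspondence_scheme \<Rightarrow> ('b, 'l) staralg_scheme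
      \<Rightarrow> ('a \<Rightarrow> 'b) \<Rightarrow> ('x \<Rightarrow> 'b) \<Rightarrow> ('b, 'l) staralg_scheme" where
  "tensor_algebra A X B \<pi> t = closed_algebra_generated B (\<pi> ` vec A \<union> t ` vec X)"


section \<open>Multivariable dynamical systems\<close>

text \<open>Functions on a space are extended by \<open>0\<close> outside its point set, so that equality of elements
  of \<open>C0\<close> is equality of HOL functions.\<close>

definition C0_functions :: "'a topology \<Rightarrow> ('a \<Rightarrow> complex) set" where
  "C0_functions T = {f. continuous_map T euclidean f \<and>
     (\<forall>e>0. compactin T {x \<in> topspace T. e \<le> cmod (f x)}) \<and>
     (\<forall>x. x \<notin> topspace T \<longrightarrow> f x = 0)}"

definition C0 :: "'a topology \<Rightarrow> ('a \<Rightarrow> complex) staralg" where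
  "C0 T = \<lparr>vec = C0_functions T,
     vzero = (\<lambda>x. 0),
     vadd = (\<lambda>f g x. f x + g x),
     vscale = (\<lambda>c f x. c * f x),
     vnorm = (\<lambda>f. SUP x. cmod (f x)),
     amult = (\<lambda>f g x. f x * g x),
     astar = (\<lambda>f x. cnj (f x))\<rparr>"

text \<open>For continuous maps between locally compact Hausdorff spaces, \<^const>\<open>proper_map\<close> (closed with
  compact fibres) means that preimages of compact sets are compact.\<close>

definition multivariable_dynamical_system :: "'v topology \<Rightarrow> nat \<Rightarrow> (nat \<Rightarrow> 'v \<Rightarrow> 'v) \<Rightarrow> bool" where
  "multivariable_dynamical_system \<Omega> n \<sigma> \<longleftrightarrow>
     Hausdorff_space \<Omega> \<and> locally_compact_space \<Omega> \<and>
     (\<exists>K :: nat \<Rightarrow> 'v set. (\<forall>m. compactin \<Omega> (K m)) \<and> (\<Union>m. K m) = topspace \<Omega>) \<and>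
     (\<forall>i\<in>{1..n}. continuous_map \<Omega> \<Omega> (\<sigma> i) \<and> proper_map \<Omega> \<Omega> (\<sigma> i))"

text \<open>The list \<open>[i\<^sub>k, \<dots>, i\<^sub>1]\<close> stands for the word \<open>u = i\<^sub>k \<cdots> i\<^sub>1\<close>, so
  the head of the list is applied last. The empty word is included; excluding it would not change
  \<open>Omega0\<close>, since \<open>\<sigma>\<^sub>u(v) = v\<close> implies \<open>\<sigma>\<^sub>i(\<sigma>\<^sub>u(v)) = \<sigma>\<^sub>i(v)\<close>.\<close>

definition word_map :: "(nat \<Rightarrow> 'v \<Rightarrow> 'v) \<Rightarrow> nat list \<Rightarrow> 'v \<Rightarrow> 'v" where
  "word_map \<sigma> u = foldr (\<lambda>i g. \<sigma> i \<circ> g) u id"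

definition Omega0 :: "'v topology \<Rightarrow> nat \<Rightarrow> (nat \<Rightarrow> 'v \<Rightarrow> 'v) \<Rightarrow> 'v set" where
  "Omega0 \<Omega> n \<sigma> = {v \<in> topspace \<Omega>. \<exists>u\<in>lists {1..n}. \<exists>w\<in>lists {1..n}.
     length u \<noteq> length w \<and> word_map \<sigma> u v = word_map \<sigma> w v}"

definition dynamical_correspondence ::
    "'v topology \<Rightarrow> nat \<Rightarrow> (nat \<Rightarrow> 'v \<Rightarrow> 'v) \<Rightarrow> ('v \<Rightarrow> complex, nat \<times> 'v \<Rightarrow> complex) correspondence" where
  "dynamical_correspondence \<Omega> n \<sigma> =
     (let ip = (\<lambda>F G x. \<Sum>i=1..n. cnj (F (i, x)) * G (i, x)) in
      \<lparr>vec = C0_functions (prod_topology (discrete_topology {1..n}) \<Omega>),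
       vzero = (\<lambda>e. 0),
       vadd = (\<lambda>F G e. F e + G e),
       vscale = (\<lambda>c F e. c * F e),
       vnorm = (\<lambda>F. sqrt (vnorm (C0 \<Omega>) (ip F F))),
       lact = (\<lambda>f F (i, x). f (\<sigma> i x) * F (i, x)),
       ract = (\<lambda>F g (i, x). F (i, x) * g x),
       ainner = ip\<rparr>)"

end

(*
  Every a in the tensor algebra has coefficient functions a_w on Omega, read off from the orbit
  representations on l2 of the free semigroup; they separate points because of the gauge action (Fejer means).
  Fix v outside Omega0 and N. Then sigma_w(x) = sigma_u(x) forces |w| = |u| for x in the orbit of v, and a
  localisation argument shows that every derivation, hence every approximately local one, leaves invariant the
  ideal J of elements whose coefficients a_w(sigma_u(v)) vanish for |u| + |w| <= N. The quotient by J is the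
  truncated path algebra of a finite acyclic graph. It is spanned by idempotents (for a path p with source x, both
  e_x and e_x + p are idempotent), and on such an algebra a local derivation is a derivation. So the Leibniz
  defect of delta has vanishing coefficients outside Omega0, hence everywhere by continuity.
*)
theory Submission
  imports Defs
begin

section \<open>Banach spaces and closures on carrier sets\<close>

text \<open>An element of the tensor algebra is only a norm limit of polynomials; it need not be the
  norm sum of its homogeneous parts. In a single degree k the coefficients control the norm up to
  the factor \<open>sqrt (n ^ k)\<close>: the adjoint of q times q lies in the image of
  \<open>\<pi>\<close>, and its value at a point is the square sum of the coefficients there. High
  degrees escape this estimate and have to be cut off: by Fejer means when coefficients are to
  separate elements, and by the Leibniz rule when a derivation D is localised, since D lowers
  degrees by at most one. So only degrees up to |u| + 1 must be made small to control the
  coefficient of D a at u. The ideal has to record the whole orbit of v and not v alone, because the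
  coefficient of a product at v reads its left factor at later points of the orbit. The universal
  property speaks of algebras on one fixed type of sequences. Matrices put operators on words into
  that type, but the gauge action has the universal C*-algebra itself as target, which must
  therefore be coded by sequences. Noncompact \<Omega> leaves the tensor algebra without identity;
  the finite quotients have one, and the descended map kills it.\<close>

context complex_banach_space
begin

lemma norm_zero: "vnorm V (vzero V) = 0"
  using norm_eq_zero[OF zero_mem] by simp

lemma scale_zero_left: "x \<in> vec V \<Longrightarrow> vscale V 0 x = vzero V"
  using norm_eq_zero[OF scale_mem[of x 0]] norm_scale[of x 0] by simp

lemma scale_zero_right: "vscale V c (vzero V) = vzero V"
  using norm_eq_zero[OF scale_mem[OF zero_mem, of c]] norm_scale[OF zero_mem, of c] norm_zero by simp

lemma minus_mem: "\<lbrakk>x \<in> vec V; y \<in> vec V\<rbrakk> \<Longrightarrow> vminus V x y \<in> vec V"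
  unfolding vminus_def by (intro add_mem scale_mem)

lemma add_left_commute: "\<lbrakk>x \<in> vec V; y \<in> vec V; z \<in> vec V\<rbrakk>
   \<Longrightarrow> vadd V x (vadd V y z) = vadd V y (vadd V x z)"
  by (metis add_assoc add_commute)

lemmas add_ac = add_assoc add_commute add_left_commute

lemma zero_add: "x \<in> vec V \<Longrightarrow> vadd V (vzero V) x = x"
  by (metis add_commute add_zero zero_mem)

lemma norm_nonneg: assumes "x \<in> vec V" shows "0 \<le> vnorm V x"
proof -
  have "0 = vnorm V (vadd V x (vscale V (-1) x))"
    using diff_self[OF assms] norm_zero unfolding vminus_def by simp
  also have "\<dots> \<le> vnorm V x + vnorm V (vscale V (-1) x)"
    by (intro norm_triangle assms scale_mem)
  also have "\<dots> = 2 * vnorm V x" using norm_scale[OF assms] by simp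
  finally show ?thesis by simp
qed

lemma minus_add_cancel: "\<lbrakk>x \<in> vec V; y \<in> vec V\<rbrakk> \<Longrightarrow> vadd V (vminus V x y) y = x"
  unfolding vminus_def
  by (metis add_assoc add_commute add_zero diff_self scale_mem vminus_def)

lemma add_minus_cancel: "\<lbrakk>x \<in> vec V; y \<in> vec V\<rbrakk> \<Longrightarrow> vminus V (vadd V x y) y = x"
  unfolding vminus_def
  by (metis add_assoc add_zero diff_self scale_mem vminus_def)

lemma minus_scale: "\<lbrakk>x \<in> vec V; y \<in> vec V\<rbrakk>
    \<Longrightarrow> vminus V (vscale V c x) (vscale V c y) = vscale V c (vminus V x y)"
  unfolding vminus_def by (simp add: scale_add_right scale_mem scale_scale mult.commute)

lemma minus_add: "\<lbrakk>x \<in> vec V; y \<in> vec V; x' \<in> vec V; y' \<in> vec V\<rbrakk>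
    \<Longrightarrow> vminus V (vadd V x y) (vadd V x' y') = vadd V (vminus V x x') (vminus V y y')"
  unfolding vminus_def by (simp add: scale_add_right scale_mem add_mem add_ac)

lemma minus_swap: "\<lbrakk>x \<in> vec V; y \<in> vec V\<rbrakk> \<Longrightarrow> vminus V y x = vscale V (-1) (vminus V x y)"
  unfolding vminus_def by (simp add: scale_add_right scale_mem scale_scale scale_one add_commute)

lemma norm_minus_commute: "\<lbrakk>x \<in> vec V; y \<in> vec V\<rbrakk> \<Longrightarrow> vnorm V (vminus V x y) = vnorm V (vminus V y x)"
  by (simp add: minus_swap[of x y] norm_scale minus_mem)

lemma minus_split: "\<lbrakk>x \<in> vec V; y \<in> vec V; z \<in> vec V\<rbrakk>
    \<Longrightarrow> vminus V x z = vadd V (vminus V x y) (vminus V y z)"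
  by (metis minus_add_cancel add_assoc minus_mem vminus_def scale_mem)

lemma norm_minus_triangle: "\<lbrakk>x \<in> vec V; y \<in> vec V; z \<in> vec V\<rbrakk>
    \<Longrightarrow> vnorm V (vminus V x z) \<le> vnorm V (vminus V x y) + vnorm V (vminus V y z)"
  using norm_triangle[of "vminus V x y" "vminus V y z"] minus_split[of x y z] minus_mem by simp

lemma minus_eq_zero: "\<lbrakk>x \<in> vec V; y \<in> vec V; vminus V x y = vzero V\<rbrakk> \<Longrightarrow> x = y"
  by (metis minus_add_cancel zero_add)

lemma norm_minus_eq_zero: "\<lbrakk>x \<in> vec V; y \<in> vec V; vnorm V (vminus V x y) = 0\<rbrakk> \<Longrightarrow> x = y"
  using minus_eq_zero norm_eq_zero minus_mem by blast

lemma norm_le_norm_minus: "\<lbrakk>x \<in> vec V; y \<in> vec V\<rbrakk> \<Longrightarrow> vnorm V x \<le> vnorm V (vminus V x y) + vnorm V y"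
  by (metis minus_add_cancel minus_mem norm_triangle)

lemma limit_unique:
  assumes "range s \<subseteq> vec V" "x \<in> vec V" "y \<in> vec V" "vconverges V s x" "vconverges V s y"
  shows "x = y"
proof (rule norm_minus_eq_zero)
  have s: "s k \<in> vec V" for k using assms(1) by auto
  have "(\<lambda>k. vnorm V (vminus V (s k) x) + vnorm V (vminus V (s k) y)) \<longlonglongrightarrow> 0 + 0"
    using assms(4,5) unfolding vconverges_def by (intro tendsto_add)
  moreover have "vnorm V (vminus V x y) \<le> vnorm V (vminus V (s k) x) + vnorm V (vminus V (s k) y)" for k
    using norm_minus_triangle[OF assms(2) s assms(3), of k] norm_minus_commute[OF assms(2) s, of k] by simp
  ultimately have "vnorm V (vminus V x y) \<le> 0"
    using LIMSEQ_le_const by (metis (no_types, lifting) add.right_neutral)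
  then show "vnorm V (vminus V x y) = 0" using norm_nonneg minus_mem assms by (meson antisym)
qed (use assms in auto)

text \<open>Addition is a record field and not a class operation, so finite sums are defined by
  recursion.\<close>

primrec vsum :: "(nat \<Rightarrow> 'a) \<Rightarrow> nat \<Rightarrow> 'a" where
  "vsum p 0 = vzero V"
| "vsum p (Suc m) = vadd V (vsum p m) (p m)"

lemma vsum_mem: "(\<And>k. p k \<in> vec V) \<Longrightarrow> vsum p m \<in> vec V"
  by (induction m) (auto intro: zero_mem add_mem)

lemma norm_vsum: "(\<And>k. p k \<in> vec V) \<Longrightarrow> vnorm V (vsum p m) \<le> (\<Sum>k<m. vnorm V (p k))"
proof (induction m)
  case (Suc m)
  then show ?case using norm_triangle[OF vsum_mem[of p m], of "p m"] by fastforce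
qed (simp add: norm_zero)

lemma vsum_add: "(\<And>k. p k \<in> vec V) \<Longrightarrow> (\<And>k. q k \<in> vec V)
    \<Longrightarrow> vsum (\<lambda>k. vadd V (p k) (q k)) m = vadd V (vsum p m) (vsum q m)"
  by (induction m) (auto simp: add_zero zero_mem add_ac vsum_mem add_mem)

lemma vsum_scale: "(\<And>k. p k \<in> vec V)
    \<Longrightarrow> vsum (\<lambda>k. vscale V c (p k)) m = vscale V c (vsum p m)"
  by (induction m) (auto simp: scale_zero_right scale_add_right vsum_mem)

end

lemma vminus_update [simp]: "vminus (A\<lparr>vec := D\<rparr>) = vminus A"
  by (intro ext) (simp add: vminus_def)

lemma vconverges_update [simp]: "vconverges (A\<lparr>vec := D\<rparr>) = vconverges A"
  by (intro ext) (simp add: vconverges_def)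

lemma vCauchy_update [simp]: "vCauchy (A\<lparr>vec := D\<rparr>) = vCauchy A"
  by (intro ext) (simp add: vCauchy_def)

definition vclosure :: "('a, 'm) cspace_scheme \<Rightarrow> 'a set \<Rightarrow> 'a set" where
  "vclosure A Q = {x \<in> vec A. \<forall>e>0. \<exists>q\<in>Q. vnorm A (vminus A q x) < e}"

lemma vclosureD: "x \<in> vclosure A Q \<Longrightarrow> e > 0 \<Longrightarrow> \<exists>q\<in>Q. vnorm A (vminus A q x) < e"
  unfolding vclosure_def by blast

context complex_banach_space
begin

lemma vconvergesI:
  assumes "range s \<subseteq> vec V" "l \<in> vec V" "f \<longlonglongrightarrow> 0" "\<And>k. vnorm V (vminus V (s k) l) \<le> f k"
  shows "vconverges V s l"
proof -
  have "0 \<le> vnorm V (vminus V (s k) l)" for k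
    using assms(1,2) by (intro norm_nonneg minus_mem) auto
  then show ?thesis unfolding vconverges_def using assms(3,4)
    by (intro tendsto_sandwich[OF _ _ tendsto_const assms(3)]) auto
qed

lemma vclosure_sequence:
  assumes "x \<in> vclosure V Q" "Q \<subseteq> vec V"
  obtains s where "range s \<subseteq> Q" "vconverges V s x"
proof -
  have x: "x \<in> vec V" using assms(1) by (simp add: vclosure_def)
  have "\<forall>k. \<exists>q\<in>Q. vnorm V (vminus V q x) < inverse (real (Suc k))"
    using vclosureD[OF assms(1)] by simp
  then obtain s where s: "\<And>k. s k \<in> Q \<and> vnorm V (vminus V (s k) x) < inverse (real (Suc k))" by metis
  have "vconverges V s x"
    using s assms(2) x by (intro vconvergesI[OF _ x LIMSEQ_inverse_real_of_nat]) (auto intro: less_imp_le)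
  then show ?thesis using that s by blast
qed

lemma vclosure_closed:
  assumes "Q \<subseteq> vec V" "range s \<subseteq> vclosure V Q" "l \<in> vec V" "vconverges V s l"
  shows "l \<in> vclosure V Q"
  unfolding vclosure_def
proof (intro CollectI conjI allI impI assms(3))
  fix e :: real assume e: "e > 0"
  have "eventually (\<lambda>k. vnorm V (vminus V (s k) l) < e/2) sequentially"
    using assms(4) e unfolding vconverges_def by (intro order_tendstoD(2)) auto
  then obtain k where k: "vnorm V (vminus V (s k) l) < e/2"
    by (auto simp: eventually_sequentially)
  have sk: "s k \<in> vclosure V Q" "s k \<in> vec V" using assms(2) by (auto simp: vclosure_def)
  obtain q where q: "q \<in> Q" "vnorm V (vminus V q (s k)) < e/2"
    using vclosureD[OF sk(1), of "e/2"] e by auto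
  have "vnorm V (vminus V q l) \<le> vnorm V (vminus V q (s k)) + vnorm V (vminus V (s k) l)"
    using norm_minus_triangle[of q "s k" l] q assms sk by auto
  then show "\<exists>q\<in>Q. vnorm V (vminus V q l) < e" using q k by (intro bexI[of _ q]) auto
qed

lemma vclosure_superset: assumes "Q \<subseteq> vec V" shows "Q \<subseteq> vclosure V Q"
proof
  fix x assume x: "x \<in> Q"
  then have "vnorm V (vminus V x x) = 0" using diff_self norm_zero assms by auto
  then have "\<forall>e>0. \<exists>q\<in>Q. vnorm V (vminus V q x) < e" using x by metis
  then show "x \<in> vclosure V Q" using x assms unfolding vclosure_def by blast
qed

lemma vclosure_add:
  assumes "Q \<subseteq> vec V" "\<And>x y. x \<in> Q \<Longrightarrow> y \<in> Q \<Longrightarrow> vadd V x y \<in> Q"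
    and "x \<in> vclosure V Q" "y \<in> vclosure V Q"
  shows "vadd V x y \<in> vclosure V Q"
  unfolding vclosure_def
proof (intro CollectI conjI allI impI)
  have xy: "x \<in> vec V" "y \<in> vec V" using assms by (auto simp: vclosure_def)
  then show "vadd V x y \<in> vec V" by (rule add_mem)
  fix e :: real assume e: "e > 0"
  obtain p where p: "p \<in> Q" "vnorm V (vminus V p x) < e/2" using vclosureD[OF assms(3), of "e/2"] e by auto
  obtain q where q: "q \<in> Q" "vnorm V (vminus V q y) < e/2" using vclosureD[OF assms(4), of "e/2"] e by auto
  have "p \<in> vec V" "q \<in> vec V" using p q assms by auto
  then have "vnorm V (vminus V (vadd V p q) (vadd V x y)) \<le> vnorm V (vminus V p x) + vnorm V (vminus V q y)"
    using minus_add[of p q x y] norm_triangle[of "vminus V p x" "vminus V q y"] minus_mem xy by simp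
  then show "\<exists>r\<in>Q. vnorm V (vminus V r (vadd V x y)) < e"
    using p q assms(2) by (intro bexI[of _ "vadd V p q"]) auto
qed

lemma vclosure_scale:
  assumes "Q \<subseteq> vec V" "\<And>c x. x \<in> Q \<Longrightarrow> vscale V c x \<in> Q" and "x \<in> vclosure V Q"
  shows "vscale V c x \<in> vclosure V Q"
  unfolding vclosure_def
proof (intro CollectI conjI allI impI)
  have x: "x \<in> vec V" using assms by (auto simp: vclosure_def)
  then show "vscale V c x \<in> vec V" by (rule scale_mem)
  fix e :: real assume e: "e > 0"
  have e': "e / (cmod c + 1) > 0" using e by (simp add: add_nonneg_pos)
  obtain p where p: "p \<in> Q" "vnorm V (vminus V p x) < e / (cmod c + 1)"
    using vclosureD[OF assms(3) e'] by auto
  have pV: "p \<in> vec V" using p assms by auto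
  have "vnorm V (vminus V (vscale V c p) (vscale V c x)) = cmod c * vnorm V (vminus V p x)"
    using minus_scale[OF pV x] norm_scale minus_mem[OF pV x] by simp
  also have "\<dots> \<le> cmod c * (e / (cmod c + 1))" using p by (intro mult_left_mono) auto
  also have "\<dots> < e" using e by (simp add: field_simps add_pos_nonneg)
  finally show "\<exists>r\<in>Q. vnorm V (vminus V r (vscale V c x)) < e"
    using p assms(2) by blast
qed

lemma closed_subspace_banach:
  assumes "D \<subseteq> vec V" "vzero V \<in> D" "\<And>x y. x \<in> D \<Longrightarrow> y \<in> D \<Longrightarrow> vadd V x y \<in> D"
    "\<And>c x. x \<in> D \<Longrightarrow> vscale V c x \<in> D"
    "\<And>s l. range s \<subseteq> D \<Longrightarrow> l \<in> vec V \<Longrightarrow> vconverges V s l \<Longrightarrow> l \<in> D"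
  shows "complex_banach_space (V\<lparr>vec := D\<rparr>)"
proof unfold_locales
  fix s assume s: "range s \<subseteq> vec (V\<lparr>vec := D\<rparr>)" "vCauchy (V\<lparr>vec := D\<rparr>) s"
  then have "range s \<subseteq> vec V" "vCauchy V s" using assms(1) by auto
  then obtain l where "l \<in> vec V" "vconverges V s l" using complete by blast
  then show "\<exists>l\<in>vec (V\<lparr>vec := D\<rparr>). vconverges (V\<lparr>vec := D\<rparr>) s l" using assms(5) s by auto
qed (use assms in \<open>auto simp: add_ac add_zero diff_self scale_add_right scale_add_left
    scale_scale scale_one norm_eq_zero norm_triangle norm_scale subset_iff\<close>)

end

context complex_banach_algebra
begin

lemma mult_zero_left: "x \<in> vec A \<Longrightarrow> amult A (vzero A) x = vzero A"
  using mult_scale_left[OF zero_mem, of x 0] by (simp add: scale_zero_left zero_mem mult_mem)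

lemma mult_zero_right: "x \<in> vec A \<Longrightarrow> amult A x (vzero A) = vzero A"
  using mult_scale_right[OF _ zero_mem, of x 0] by (simp add: scale_zero_left zero_mem mult_mem)

lemma mult_minus_left: "\<lbrakk>x \<in> vec A; y \<in> vec A; z \<in> vec A\<rbrakk>
    \<Longrightarrow> amult A (vminus A x y) z = vminus A (amult A x z) (amult A y z)"
  unfolding vminus_def by (simp add: mult_add_left mult_scale_left scale_mem mult_mem)

lemma mult_minus_right: "\<lbrakk>x \<in> vec A; y \<in> vec A; z \<in> vec A\<rbrakk>
    \<Longrightarrow> amult A z (vminus A x y) = vminus A (amult A z x) (amult A z y)"
  unfolding vminus_def by (simp add: mult_add_right mult_scale_right scale_mem mult_mem)

lemma vconverges_mult_left:
  assumes "range s \<subseteq> vec A" "l \<in> vec A" "x \<in> vec A" "vconverges A s l"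
  shows "vconverges A (\<lambda>k. amult A x (s k)) (amult A x l)"
proof (rule vconvergesI)
  have s: "s k \<in> vec A" for k using assms(1) by auto
  show "(\<lambda>k. vnorm A x * vnorm A (vminus A (s k) l)) \<longlonglongrightarrow> 0"
    using tendsto_mult_left[of "\<lambda>k. vnorm A (vminus A (s k) l)" 0 _ "vnorm A x"] assms(4)
    unfolding vconverges_def by simp
  show "vnorm A (vminus A (amult A x (s k)) (amult A x l)) \<le> vnorm A x * vnorm A (vminus A (s k) l)" for k
    using norm_mult[OF assms(3) minus_mem[OF s assms(2)]] by (simp add: mult_minus_right s assms)
  show "range (\<lambda>k. amult A x (s k)) \<subseteq> vec A" "amult A x l \<in> vec A"
    using s assms by (auto intro: mult_mem)
qed

lemma vconverges_mult_right:
  assumes "range s \<subseteq> vec A" "l \<in> vec A" "x \<in> vec A" "vconverges A s l"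
  shows "vconverges A (\<lambda>k. amult A (s k) x) (amult A l x)"
proof (rule vconvergesI)
  have s: "s k \<in> vec A" for k using assms(1) by auto
  show "(\<lambda>k. vnorm A (vminus A (s k) l) * vnorm A x) \<longlonglongrightarrow> 0"
    using tendsto_mult_right[of "\<lambda>k. vnorm A (vminus A (s k) l)" 0 _ "vnorm A x"] assms(4)
    unfolding vconverges_def by simp
  show "vnorm A (vminus A (amult A (s k) x) (amult A l x)) \<le> vnorm A (vminus A (s k) l) * vnorm A x" for k
    using norm_mult[OF minus_mem[OF s assms(2)] assms(3)] by (simp add: mult_minus_left s assms)
  show "range (\<lambda>k. amult A (s k) x) \<subseteq> vec A" "amult A l x \<in> vec A"
    using s assms by (auto intro: mult_mem)
qed

text \<open>The limit is taken in one factor at a time: first products of x with members of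
  \<open>Q\<close>, then the second factor tends to y.\<close>

lemma vclosure_mult:
  assumes "Q \<subseteq> vec A" "\<And>x y. x \<in> Q \<Longrightarrow> y \<in> Q \<Longrightarrow> amult A x y \<in> Q"
    and x: "x \<in> vclosure A Q" and y: "y \<in> vclosure A Q"
  shows "amult A x y \<in> vclosure A Q"
proof -
  have xy: "x \<in> vec A" "y \<in> vec A" using assms by (auto simp: vclosure_def)
  obtain s where s: "range s \<subseteq> Q" "vconverges A s y" using vclosure_sequence y assms(1) by blast
  have "amult A x q \<in> vclosure A Q" if q: "q \<in> Q" for q
  proof -
    obtain r where r: "range r \<subseteq> Q" "vconverges A r x" using vclosure_sequence x assms(1) by blast
    have "range (\<lambda>k. amult A (r k) q) \<subseteq> vclosure A Q"
      using r q assms(2) vclosure_superset[OF assms(1)] by auto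
    moreover have "vconverges A (\<lambda>k. amult A (r k) q) (amult A x q)"
      using r q assms(1) xy by (intro vconverges_mult_right) auto
    ultimately show ?thesis using vclosure_closed[OF assms(1)] mult_mem xy q assms(1) by blast
  qed
  then have "range (\<lambda>k. amult A x (s k)) \<subseteq> vclosure A Q" using s by auto
  moreover have "vconverges A (\<lambda>k. amult A x (s k)) (amult A x y)"
    using s assms(1) xy by (intro vconverges_mult_left) auto
  ultimately show ?thesis using vclosure_closed[OF assms(1)] mult_mem xy by blast
qed

lemma closed_subalgebra_vclosure:
  assumes "Q \<subseteq> vec A" "vzero A \<in> Q" "\<And>x y. x \<in> Q \<Longrightarrow> y \<in> Q \<Longrightarrow> vadd A x y \<in> Q"
    "\<And>x y. x \<in> Q \<Longrightarrow> y \<in> Q \<Longrightarrow> amult A x y \<in> Q" "\<And>c x. x \<in> Q \<Longrightarrow> vscale A c x \<in> Q"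
  shows "closed_subalgebra A (vclosure A Q)"
  unfolding closed_subalgebra_def
proof (intro conjI ballI allI impI)
  show "vclosure A Q \<subseteq> vec A" by (auto simp: vclosure_def)
  show "vzero A \<in> vclosure A Q" using assms(2) vclosure_superset[OF assms(1)] by blast
qed (use vclosure_closed[OF assms(1)] vclosure_add[OF assms(1,3)] vclosure_mult[OF assms(1,4)]
    vclosure_scale[OF assms(1,5)] in blast)+

lemma closed_subalgebraD: "\<lbrakk>closed_subalgebra A D; x \<in> D\<rbrakk> \<Longrightarrow> x \<in> vec A"
  unfolding closed_subalgebra_def by blast

lemma closed_subalgebra_banach:
  assumes "closed_subalgebra A D"
  shows "complex_banach_algebra (A\<lparr>vec := D\<rparr>)"
proof -
  interpret D: complex_banach_space "A\<lparr>vec := D\<rparr>"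
    using assms unfolding closed_subalgebra_def by (intro closed_subspace_banach) auto
  show ?thesis
  proof unfold_locales
    show "amult (A\<lparr>vec := D\<rparr>) x y \<in> vec (A\<lparr>vec := D\<rparr>)"
      if "x \<in> vec (A\<lparr>vec := D\<rparr>)" "y \<in> vec (A\<lparr>vec := D\<rparr>)" for x y
      using assms that by (simp add: closed_subalgebra_def)
  qed (simp_all add: closed_subalgebraD[OF assms] mult_assoc mult_add_left
        mult_add_right mult_scale_left mult_scale_right norm_mult)
qed

lemma closed_subalgebra_Inter:
  assumes "\<And>D. D \<in> \<D> \<Longrightarrow> closed_subalgebra A D" "D0 \<in> \<D>"
  shows "closed_subalgebra A (\<Inter>\<D>)"
proof -
  have D: "D \<subseteq> vec A" "vzero A \<in> D" "\<And>x y. x\<in>D \<Longrightarrow> y\<in>D \<Longrightarrow> vadd A x y \<in> D"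
    "\<And>x y. x\<in>D \<Longrightarrow> y\<in>D \<Longrightarrow> amult A x y \<in> D" "\<And>c x. x\<in>D \<Longrightarrow> vscale A c x \<in> D" if "D \<in> \<D>" for D
    using assms(1)[OF that] unfolding closed_subalgebra_def by blast+
  have lim: "l \<in> D" if "D \<in> \<D>" "range s \<subseteq> \<Inter>\<D>" "l \<in> vec A" "vconverges A s l" for D s l
  proof -
    have "range s \<subseteq> D" using that(1,2) by blast
    then show ?thesis using assms(1)[OF that(1)] that(3,4) unfolding closed_subalgebra_def by blast
  qed
  have "\<Inter>\<D> \<subseteq> vec A" using D(1) assms(2) by blast
  moreover have "vzero A \<in> \<Inter>\<D>" using D(2) by blast
  moreover have "vadd A x y \<in> \<Inter>\<D>" "amult A x y \<in> \<Inter>\<D>" if "x \<in> \<Inter>\<D>" "y \<in> \<Inter>\<D>" for x y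
    using that D(3,4) by simp_all
  moreover have "vscale A c x \<in> \<Inter>\<D>" if "x \<in> \<Inter>\<D>" for x c
    using that D(5) by simp
  moreover have "\<forall>s l. range s \<subseteq> \<Inter>\<D> \<and> l \<in> vec A \<and> vconverges A s l \<longrightarrow> l \<in> \<Inter>\<D>"
    using lim by (intro allI impI InterI) (elim conjE)
  ultimately show ?thesis unfolding closed_subalgebra_def by (intro conjI ballI allI) auto
qed

lemma closed_subalgebra_vec: "closed_subalgebra A (vec A)"
  unfolding closed_subalgebra_def by (auto intro: zero_mem add_mem mult_mem scale_mem)

end

context cstar_algebra
begin

lemma star_zero: "astar A (vzero A) = vzero A"
  using star_scale[OF zero_mem, of 0] by (simp add: scale_zero_left star_mem zero_mem)

lemma norm_star_le: assumes "x \<in> vec A" shows "vnorm A x \<le> vnorm A (astar A x)"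
proof (cases "vnorm A x = 0")
  case False
  then have pos: "vnorm A x > 0" using norm_nonneg[OF assms] by simp
  have "(vnorm A x)\<^sup>2 \<le> vnorm A (astar A x) * vnorm A x"
    using norm_mult[OF star_mem[OF assms] assms] cstar_identity[OF assms] by simp
  then show ?thesis using pos by (simp add: power2_eq_square)
qed (use norm_nonneg star_mem assms in auto)

lemma norm_star: "x \<in> vec A \<Longrightarrow> vnorm A (astar A x) = vnorm A x"
  using norm_star_le[of x] norm_star_le[of "astar A x"] star_mem[of x] star_star[of x] by simp

lemma star_minus: "\<lbrakk>x \<in> vec A; y \<in> vec A\<rbrakk> \<Longrightarrow> astar A (vminus A x y) = vminus A (astar A x) (astar A y)"
  unfolding vminus_def by (simp add: star_add star_scale scale_mem)

lemma vclosure_star: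
  assumes "Q \<subseteq> vec A" "\<And>x. x \<in> Q \<Longrightarrow> astar A x \<in> Q" "x \<in> vclosure A Q"
  shows "astar A x \<in> vclosure A Q"
  unfolding vclosure_def
proof (intro CollectI conjI allI impI)
  have x: "x \<in> vec A" using assms by (auto simp: vclosure_def)
  then show "astar A x \<in> vec A" by (rule star_mem)
  fix e :: real assume e: "e > 0"
  obtain p where p: "p \<in> Q" "vnorm A (vminus A p x) < e" using vclosureD[OF assms(3) e] by auto
  have "vnorm A (vminus A (astar A p) (astar A x)) = vnorm A (vminus A p x)"
    using p x assms(1) star_minus[of p x] norm_star[of "vminus A p x"] minus_mem by auto
  then show "\<exists>q\<in>Q. vnorm A (vminus A q (astar A x)) < e" using p assms(2)[of p] by metis
qed

lemma closed_star_subalgebra_cstar: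
  assumes "closed_subalgebra A D" "astar A ` D \<subseteq> D"
  shows "cstar_algebra (A\<lparr>vec := D\<rparr>)"
proof -
  interpret D: complex_banach_algebra "A\<lparr>vec := D\<rparr>"
    using assms by (intro closed_subalgebra_banach)
  show ?thesis
    by unfold_locales (use assms(2) in \<open>simp_all add: image_subset_iff closed_subalgebraD[OF assms(1)]
        star_star star_add star_scale star_mult cstar_identity\<close>)
qed

end

section \<open>Homomorphisms and copies of C*-algebras\<close>

lemma bounded_linear_mapD:
  assumes "bounded_linear_map V W f"
  shows "x \<in> vec V \<Longrightarrow> f x \<in> vec W"
    and "\<lbrakk>x \<in> vec V; y \<in> vec V\<rbrakk> \<Longrightarrow> f (vadd V x y) = vadd W (f x) (f y)"
    and "x \<in> vec V \<Longrightarrow> f (vscale V c x) = vscale W c (f x)"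
  using assms unfolding bounded_linear_map_def by blast+

lemma bounded_linear_map_minus:
  assumes "bounded_linear_map V W f" "complex_banach_space V" "x \<in> vec V" "y \<in> vec V"
  shows "f (vminus V x y) = vminus W (f x) (f y)"
  unfolding vminus_def
  using bounded_linear_mapD(2)[OF assms(1,3) complex_banach_space.scale_mem[OF assms(2,4), of "-1"]]
    bounded_linear_mapD(3)[OF assms(1,4), of "-1"] by simp

lemma bounded_linear_map_zero:
  assumes "bounded_linear_map V W f" "complex_banach_space V" "complex_banach_space W"
  shows "f (vzero V) = vzero W"
proof -
  have z: "vzero V \<in> vec V" using assms(2) by (rule complex_banach_space.zero_mem)
  have "f (vscale V 0 (vzero V)) = vscale W 0 (f (vzero V))" by (rule bounded_linear_mapD(3)[OF assms(1) z])
  then show ?thesis using complex_banach_space.scale_zero_left[OF assms(2) z]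
      complex_banach_space.scale_zero_left[OF assms(3) bounded_linear_mapD(1)[OF assms(1) z]] by simp
qed

lemma star_homD:
  assumes "star_hom A B f"
  shows "bounded_linear_map A B f"
    and "\<lbrakk>x \<in> vec A; y \<in> vec A\<rbrakk> \<Longrightarrow> f (amult A x y) = amult B (f x) (f y)"
    and "x \<in> vec A \<Longrightarrow> f (astar A x) = astar B (f x)"
  using assms unfolding star_hom_def by blast+

text \<open>A bound \<open>\<parallel>f h\<parallel> \<le> K \<parallel>h\<parallel>\<close> improves to \<open>K = 1\<close>: apply it to the powers \<open>h ^ (2 ^ m)\<close> of a self-adjoint
  \<open>h\<close>, for which the C*-identity gives \<open>\<parallel>h ^ (2 ^ m)\<parallel> = \<parallel>h\<parallel> ^ (2 ^ m)\<close>.\<close>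

lemma star_hom_contractive:
  assumes "cstar_algebra A" "cstar_algebra B" and hom: "star_hom A B f" and x: "x \<in> vec A"
  shows "vnorm B (f x) \<le> vnorm A x"
proof -
  interpret A: cstar_algebra A by fact
  interpret B: cstar_algebra B by fact
  note f = bounded_linear_mapD[OF star_homD(1)[OF hom]] star_homD(2,3)[OF hom]
  obtain K where K: "\<And>x. x \<in> vec A \<Longrightarrow> vnorm B (f x) \<le> K * vnorm A x"
    using star_homD(1)[OF hom] unfolding bounded_linear_map_def by blast
  define h where "h = amult A (astar A x) x"
  have h: "h \<in> vec A" "astar A h = h"
    using x by (simp_all add: h_def A.mult_mem A.star_mem A.star_mult A.star_star)
  define s where "s m = ((\<lambda>y. amult A y y) ^^ m) h" for m
  have s: "s m \<in> vec A \<and> astar A (s m) = s m \<and> vnorm A (s m) = vnorm A h ^ (2 ^ m)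
    \<and> vnorm B (f (s m)) = vnorm B (f h) ^ (2 ^ m)" for m
  proof (induction m)
    case 0
    then show ?case using h by (simp add: s_def)
  next
    case (Suc m)
    have S: "s (Suc m) = amult A (s m) (s m)" by (simp add: s_def)
    have 1: "vnorm A (s (Suc m)) = (vnorm A (s m))\<^sup>2"
      using A.cstar_identity[of "s m"] Suc by (simp add: S)
    have "f (s (Suc m)) = amult B (astar B (f (s m))) (f (s m))"
      using Suc f(4)[of "s m" "s m"] f(5)[of "s m"] by (simp add: S)
    then have 2: "vnorm B (f (s (Suc m))) = (vnorm B (f (s m)))\<^sup>2"
      using B.cstar_identity[of "f (s m)"] Suc f(1) by simp
    show ?case using 1 2 Suc
      by (auto simp: S A.mult_mem A.star_mult power_mult[symmetric] mult.commute)
  qed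
  define a where "a = vnorm B (f h)"
  define b where "b = vnorm A h"
  have pow: "a ^ (2 ^ m) \<le> K * b ^ (2 ^ m)" for m
    using K[of "s m"] s[of m] by (simp add: a_def b_def)
  have a0: "a \<ge> 0" and b0: "b \<ge> 0"
    using h f(1) by (auto simp: a_def b_def A.norm_nonneg B.norm_nonneg)
  have "a \<le> b"
  proof (rule ccontr)
    assume "\<not> a \<le> b"
    then have ab: "b < a" by simp
    show False
    proof (cases "b = 0")
      case True
      then show False using pow[of 0] ab by simp
    next
      case False
      then have bpos: "b > 0" using b0 by simp
      then have r: "a / b > 1" using ab by simp
      obtain N where N: "K < (a / b) ^ N" using real_arch_pow[OF r] by blast
      \<comment> \<open>The comparison of a and b is known for exponents \<open>2 ^ m\<close> only;
        such an exponent is at least N, where the ratio has already passed K.\<close>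
      have "N \<le> 2 ^ N" by (simp add: less_imp_le)
      then have "(a / b) ^ N \<le> (a / b) ^ (2 ^ N)" using r by (intro power_increasing) auto
      also have "\<dots> \<le> K" using pow[of N] bpos by (simp add: power_divide divide_le_eq)
      finally show False using N by simp
    qed
  qed
  moreover have "a = (vnorm B (f x))\<^sup>2"
    using B.cstar_identity[OF f(1)[OF x]] f(4)[of "astar A x" x] f(5)[OF x] x A.star_mem
    by (simp add: a_def h_def)
  moreover have "b = (vnorm A x)\<^sup>2" using A.cstar_identity[OF x] by (simp add: b_def h_def)
  ultimately show ?thesis using A.norm_nonneg[OF x] by (metis power2_le_imp_le)
qed

text \<open>Transport of structure along an injection \<iota>. The universal property can be applied
  to a target algebra only after moving its carrier into the prescribed type of sequences.\<close>

definition copy_algebra :: "('a \<Rightarrow> 'c) \<Rightarrow> ('a, 'm) staralg_scheme \<Rightarrow> 'c staralg" where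
  "copy_algebra \<iota> A = (let j = inv_into (vec A) \<iota> in
     \<lparr>vec = \<iota> ` vec A,
      vzero = \<iota> (vzero A),
      vadd = (\<lambda>x y. \<iota> (vadd A (j x) (j y))),
      vscale = (\<lambda>c x. \<iota> (vscale A c (j x))),
      vnorm = (\<lambda>x. vnorm A (j x)),
      amult = (\<lambda>x y. \<iota> (amult A (j x) (j y))),
      astar = (\<lambda>x. \<iota> (astar A (j x)))\<rparr>)"

locale copied_algebra = cstar_algebra A for A :: "('a, 'm) staralg_scheme" +
  fixes \<iota> :: "'a \<Rightarrow> 'c"
  assumes inj: "inj_on \<iota> (vec A)"
begin

abbreviation "C \<equiv> copy_algebra \<iota> A"

lemma copy_simps:
  "vec C = \<iota> ` vec A" "vzero C = \<iota> (vzero A)"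
  "\<lbrakk>x \<in> vec A; y \<in> vec A\<rbrakk> \<Longrightarrow> vadd C (\<iota> x) (\<iota> y) = \<iota> (vadd A x y)"
  "\<lbrakk>x \<in> vec A; y \<in> vec A\<rbrakk> \<Longrightarrow> amult C (\<iota> x) (\<iota> y) = \<iota> (amult A x y)"
  "x \<in> vec A \<Longrightarrow> vscale C c (\<iota> x) = \<iota> (vscale A c x)"
  "x \<in> vec A \<Longrightarrow> astar C (\<iota> x) = \<iota> (astar A x)"
  "x \<in> vec A \<Longrightarrow> vnorm C (\<iota> x) = vnorm A x"
  using inj by (auto simp: copy_algebra_def Let_def)

lemma copy_minus: "\<lbrakk>x \<in> vec A; y \<in> vec A\<rbrakk> \<Longrightarrow> vminus C (\<iota> x) (\<iota> y) = \<iota> (vminus A x y)"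
  unfolding vminus_def by (simp add: copy_simps scale_mem)

lemma copy_eq_iff: "\<lbrakk>x \<in> vec A; y \<in> vec A\<rbrakk> \<Longrightarrow> \<iota> x = \<iota> y \<longleftrightarrow> x = y"
  using inj by (auto dest: inj_onD)

lemmas copy_rules = copy_simps copy_minus copy_eq_iff zero_mem add_mem scale_mem minus_mem mult_mem star_mem

lemma copy_cstar: "cstar_algebra C"
proof unfold_locales
  fix s assume s: "range s \<subseteq> vec C" "vCauchy C s"
  have "\<forall>k. \<exists>r. r \<in> vec A \<and> s k = \<iota> r" using s(1) by (auto simp: copy_simps(1))
  then obtain r where r: "\<And>k. r k \<in> vec A" "\<And>k. s k = \<iota> (r k)" by metis
  have "vCauchy A r" using s(2) unfolding vCauchy_def by (simp add: r copy_rules)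
  then obtain l where l: "l \<in> vec A" "vconverges A r l" using complete[of r] r by auto
  then have "vconverges C s (\<iota> l)" unfolding vconverges_def by (simp add: r copy_rules)
  then show "\<exists>l\<in>vec C. vconverges C s l" using l by (auto simp: copy_simps(1))
next
  fix x assume "x \<in> vec C"
  then show "vnorm C (amult C (astar C x) x) = (vnorm C x)\<^sup>2"
    by (auto simp: copy_simps(1) copy_rules cstar_identity)
qed (auto simp: copy_simps(1) copy_rules add_ac add_zero diff_self scale_add_right scale_add_left
    scale_scale scale_one norm_eq_zero norm_triangle norm_scale mult_assoc mult_add_left
    mult_add_right mult_scale_left mult_scale_right norm_mult star_star star_add star_scale star_mult)

lemma copy_toeplitz:
  assumes "toeplitz_representation A' X A \<pi> t"
  shows "toeplitz_representation A' X C (\<iota> \<circ> \<pi>) (\<iota> \<circ> t)"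
proof -
  have P: "star_hom A' A \<pi>" and T: "bounded_linear_map X A t" and cc: "cstar_correspondence A' X"
    and r: "\<forall>a\<in>vec A'. \<forall>x\<in>vec X. amult A (\<pi> a) (t x) = t (lact X a x)"
      "\<forall>x\<in>vec X. \<forall>y\<in>vec X. amult A (astar A (t x)) (t y) = \<pi> (ainner X x y)"
    using assms unfolding toeplitz_representation_def by blast+
  note p = bounded_linear_mapD[OF star_homD(1)[OF P]] and t = bounded_linear_mapD[OF T]
  have "bounded_linear_map A' C (\<iota> \<circ> \<pi>)"
    using star_homD(1)[OF P] unfolding bounded_linear_map_def by (auto simp: copy_rules image_subset_iff)
  then have "star_hom A' C (\<iota> \<circ> \<pi>)"
    using P p(1) unfolding star_hom_def by (auto simp: copy_rules)
  moreover have "bounded_linear_map X C (\<iota> \<circ> t)"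
    using T unfolding bounded_linear_map_def by (auto simp: copy_rules image_subset_iff)
  ultimately show ?thesis
    unfolding toeplitz_representation_def using cc copy_cstar r p(1) t(1)
    by (auto simp: copy_rules)
qed

end

section \<open>Square-summable families\<close>

typedef 'i ell2 = "{f :: 'i \<Rightarrow> complex. (\<lambda>i. (cmod (f i))\<^sup>2) summable_on UNIV}"
  morphisms coord Abs_ell2
  by (intro exI[of _ "\<lambda>_. 0"]) simp

setup_lifting type_definition_ell2

abbreviation l2norm :: "('i \<Rightarrow> complex) \<Rightarrow> 'i set \<Rightarrow> real" where
  "l2norm f F \<equiv> L2_set (\<lambda>i. cmod (f i)) F"

text \<open>Membership becomes a uniform bound on finite partial norms, so the inequalities for
  \<open>L2_set\<close> carry over to infinite families.\<close>

lemma square_summable_iff: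
  "(\<lambda>i. (cmod (f i))\<^sup>2) summable_on UNIV \<longleftrightarrow> (\<exists>C. \<forall>F. finite F \<longrightarrow> l2norm f F \<le> C)"
proof
  assume s: "(\<lambda>i. (cmod (f i))\<^sup>2) summable_on UNIV"
  have "l2norm f F \<le> sqrt (infsum (\<lambda>i. (cmod (f i))\<^sup>2) UNIV)" if "finite F" for F
    unfolding L2_set_def using finite_sum_le_infsum[OF s that] by simp
  then show "\<exists>C. \<forall>F. finite F \<longrightarrow> l2norm f F \<le> C" by blast
next
  assume "\<exists>C. \<forall>F. finite F \<longrightarrow> l2norm f F \<le> C"
  then obtain C where C: "\<And>F. finite F \<Longrightarrow> l2norm f F \<le> C" by blast
  have "(\<Sum>i\<in>F. (cmod (f i))\<^sup>2) \<le> C\<^sup>2" if "finite F" for F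
    using C[OF that] unfolding L2_set_def by (rule sqrt_le_D)
  then show "(\<lambda>i. (cmod (f i))\<^sup>2) summable_on UNIV"
    by (intro nonneg_bdd_above_summable_on bdd_aboveI[of _ "C\<^sup>2"]) auto
qed

lemma l2norm_add: "l2norm (\<lambda>i. f i + g i) F \<le> l2norm f F + l2norm g F"
  by (rule order_trans[OF L2_set_mono[OF norm_triangle_ineq] L2_set_triangle_ineq]) simp

lemma coord_summable: "(\<lambda>i. (cmod (coord x i))\<^sup>2) summable_on UNIV"
  using coord[of x] by simp

lemma coord_Abs: "\<lbrakk>\<And>F. finite F \<Longrightarrow> l2norm f F \<le> C\<rbrakk> \<Longrightarrow> coord (Abs_ell2 f) = f"
  by (subst Abs_ell2_inverse) (auto simp: square_summable_iff)

lemma ell2_eqI: "(\<And>i. coord x i = coord y i) \<Longrightarrow> x = y"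
  by (metis ext coord_inject)

text \<open>Only the real structure enters the type class, which is enough for the type of bounded
  operators; complex scalars reappear as the operators \<open>scaleC_op\<close>.\<close>

instantiation ell2 :: (type) real_normed_vector
begin

definition "norm_ell2 x = sqrt (infsum (\<lambda>i. (cmod (coord x i))\<^sup>2) UNIV)"
lift_definition zero_ell2 :: "'a ell2" is "\<lambda>_. 0" by simp
lift_definition plus_ell2 :: "'a ell2 \<Rightarrow> 'a ell2 \<Rightarrow> 'a ell2" is "\<lambda>f g i. f i + g i"
  unfolding square_summable_iff
proof (elim exE)
  fix f g :: "'a \<Rightarrow> complex" and C D
  assume "\<forall>F. finite F \<longrightarrow> l2norm f F \<le> C" "\<forall>F. finite F \<longrightarrow> l2norm g F \<le> D"
  then have "l2norm (\<lambda>i. f i + g i) F \<le> C + D" if "finite F" for F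
    using that by (intro order_trans[OF l2norm_add] add_mono) auto
  then show "\<exists>C. \<forall>F. finite F \<longrightarrow> l2norm (\<lambda>i. f i + g i) F \<le> C" by blast
qed
lift_definition uminus_ell2 :: "'a ell2 \<Rightarrow> 'a ell2" is "\<lambda>f i. - f i" by simp
definition minus_ell2 :: "'a ell2 \<Rightarrow> 'a ell2 \<Rightarrow> 'a ell2" where "minus_ell2 x y = x + - y"
lift_definition scaleR_ell2 :: "real \<Rightarrow> 'a ell2 \<Rightarrow> 'a ell2" is "\<lambda>r f i. of_real r * f i"
  by (simp add: norm_mult power_mult_distrib summable_on_cmult_right)
definition "dist_ell2 x y = norm (x - y :: 'a ell2)"
definition sgn_ell2 :: "'a ell2 \<Rightarrow> 'a ell2" where "sgn_ell2 x = scaleR (inverse (norm x)) x"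
definition "(uniformity :: ('a ell2 \<times> 'a ell2) filter) = (INF e\<in>{0 <..}. principal {(x, y). dist x y < e})"
definition "open (U :: 'a ell2 set) = (\<forall>x\<in>U. eventually (\<lambda>(x', y). x' = x \<longrightarrow> y \<in> U) uniformity)"

lemma norm_ell2_le_iff: "norm x \<le> C \<longleftrightarrow> C \<ge> 0 \<and> (\<forall>F. finite F \<longrightarrow> l2norm (coord x) F \<le> C)"
proof
  assume n: "norm x \<le> C"
  have "0 \<le> norm x" unfolding norm_ell2_def by (simp add: infsum_nonneg)
  moreover have "l2norm (coord x) F \<le> norm x" if "finite F" for F
    unfolding L2_set_def norm_ell2_def using finite_sum_le_infsum[OF coord_summable that] by simp
  ultimately show "C \<ge> 0 \<and> (\<forall>F. finite F \<longrightarrow> l2norm (coord x) F \<le> C)" using n by force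
next
  assume C: "C \<ge> 0 \<and> (\<forall>F. finite F \<longrightarrow> l2norm (coord x) F \<le> C)"
  have "(\<Sum>i\<in>F. (cmod (coord x i))\<^sup>2) \<le> C\<^sup>2" if "finite F" for F
    using C that unfolding L2_set_def by (metis sqrt_le_D)
  then have "infsum (\<lambda>i. (cmod (coord x i))\<^sup>2) UNIV \<le> C\<^sup>2"
    by (intro infsum_le_finite_sums coord_summable) auto
  then show "norm x \<le> C" unfolding norm_ell2_def using C real_le_lsqrt by metis
qed

lemma l2norm_le_norm: "finite F \<Longrightarrow> l2norm (coord x) F \<le> norm x"
  using norm_ell2_le_iff by blast

lemma cmod_coord_le: "cmod (coord x i) \<le> norm x"
  using l2norm_le_norm[of "{i}" x] by simp

instance
proof
  fix x y z :: "'a ell2" and a b :: real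
  show "x + y + z = x + (y + z)" by (rule ell2_eqI) (simp add: plus_ell2.rep_eq)
  show "x + y = y + x" by (rule ell2_eqI) (simp add: plus_ell2.rep_eq)
  show "0 + x = x" by (rule ell2_eqI) (simp add: plus_ell2.rep_eq zero_ell2.rep_eq)
  show "- x + x = 0" by (rule ell2_eqI) (simp add: plus_ell2.rep_eq zero_ell2.rep_eq uminus_ell2.rep_eq)
  show "x - y = x + - y" by (rule minus_ell2_def)
  show "a *\<^sub>R (x + y) = a *\<^sub>R x + a *\<^sub>R y"
    by (rule ell2_eqI) (simp add: plus_ell2.rep_eq scaleR_ell2.rep_eq algebra_simps)
  show "(a + b) *\<^sub>R x = a *\<^sub>R x + b *\<^sub>R x"
    by (rule ell2_eqI) (simp add: plus_ell2.rep_eq scaleR_ell2.rep_eq algebra_simps)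
  show "a *\<^sub>R b *\<^sub>R x = (a * b) *\<^sub>R x" by (rule ell2_eqI) (simp add: scaleR_ell2.rep_eq)
  show "1 *\<^sub>R x = x" by (rule ell2_eqI) (simp add: scaleR_ell2.rep_eq)
  show "dist x y = norm (x - y)" by (rule dist_ell2_def)
  show "sgn x = scaleR (inverse (norm x)) x" by (rule sgn_ell2_def)
  show "norm x = 0 \<longleftrightarrow> x = 0"
  proof
    assume "norm x = 0"
    then have "cmod (coord x i) \<le> 0" for i using cmod_coord_le[of x i] by simp
    then show "x = 0" by (intro ell2_eqI) (simp add: zero_ell2.rep_eq)
  qed (simp add: norm_ell2_def zero_ell2.rep_eq)
  have l2: "l2norm (coord x) F + l2norm (coord y) F \<le> norm x + norm y" if "finite F" for F
    using l2norm_le_norm[OF that] by (meson add_mono)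
  have "0 \<le> norm x" "0 \<le> norm y" unfolding norm_ell2_def by (simp_all add: infsum_nonneg)
  then show "norm (x + y) \<le> norm x + norm y"
    unfolding norm_ell2_le_iff[of "x + y"] plus_ell2.rep_eq using order_trans[OF l2norm_add l2] by simp
  show "norm (a *\<^sub>R x) = \<bar>a\<bar> * norm x"
  proof -
    have "(cmod (complex_of_real a * coord x i))\<^sup>2 = a\<^sup>2 * (cmod (coord x i))\<^sup>2" for i
      by (simp add: norm_mult power_mult_distrib)
    then have "infsum (\<lambda>i. (cmod (coord (a *\<^sub>R x) i))\<^sup>2) UNIV = a\<^sup>2 * infsum (\<lambda>i. (cmod (coord x i))\<^sup>2) UNIV"
      unfolding scaleR_ell2.rep_eq by (simp only: infsum_cmult_right')
    then show ?thesis unfolding norm_ell2_def by (simp add: real_sqrt_mult)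
  qed
  show "(uniformity :: ('a ell2 \<times> 'a ell2) filter) = (INF e\<in>{0 <..}. principal {(x, y). dist x y < e})"
    by (rule uniformity_ell2_def)
  show "open U = (\<forall>x\<in>U. eventually (\<lambda>(x', y). x' = x \<longrightarrow> y \<in> U) uniformity)" for U :: "'a ell2 set"
    by (rule open_ell2_def)
qed

end

lemma coord_simps [simp]:
  "coord 0 i = 0" "coord (x + y) i = coord x i + coord y i" "coord (- x) i = - coord x i"
  "coord (x - y) i = coord x i - coord y i" "coord (r *\<^sub>R x) i = of_real r * coord x i"
  by (simp_all only: zero_ell2.rep_eq plus_ell2.rep_eq uminus_ell2.rep_eq minus_ell2_def scaleR_ell2.rep_eq)
    simp

instance ell2 :: (type) banach
proof
  fix X :: "nat \<Rightarrow> 'a ell2" assume C: "Cauchy X"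
  have "Cauchy (\<lambda>n. coord (X n) i)" for i
  proof (rule CauchyI)
    fix e :: real assume "e > 0"
    then obtain M where M: "\<And>m n. m \<ge> M \<Longrightarrow> n \<ge> M \<Longrightarrow> norm (X m - X n) < e" using CauchyD[OF C] by blast
    have "cmod (coord (X m) i - coord (X n) i) < e" if "m \<ge> M" "n \<ge> M" for m n
      using cmod_coord_le[of "X m - X n" i] M[OF that] by simp
    then show "\<exists>M. \<forall>m\<ge>M. \<forall>n\<ge>M. cmod (coord (X m) i - coord (X n) i) < e" by blast
  qed
  then have "\<forall>i. \<exists>l. (\<lambda>n. coord (X n) i) \<longlonglongrightarrow> l" using Cauchy_convergent convergent_def by blast
  then obtain f where f: "\<And>i. (\<lambda>n. coord (X n) i) \<longlonglongrightarrow> f i" by metis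
  \<comment> \<open>The Cauchy estimate passes to the coordinatewise limit in each finite partial
    norm, with an M that does not depend on F. This gives both membership of the limit and
    convergence in norm.\<close>
  have tail: "\<exists>M. \<forall>n\<ge>M. \<forall>F. finite F \<longrightarrow> l2norm (\<lambda>i. f i - coord (X n) i) F \<le> e" if e: "e > 0" for e :: real
  proof -
    obtain M where M: "\<And>m n. m \<ge> M \<Longrightarrow> n \<ge> M \<Longrightarrow> norm (X m - X n) < e" using CauchyD[OF C e] by blast
    have "l2norm (\<lambda>i. f i - coord (X n) i) F \<le> e" if "n \<ge> M" "finite F" for n F
    proof (rule LIMSEQ_le_const2)
      show "(\<lambda>m. l2norm (coord (X m - X n)) F) \<longlonglongrightarrow> l2norm (\<lambda>i. f i - coord (X n) i) F"
        unfolding L2_set_def by (auto intro!: tendsto_intros f)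
      have "l2norm (coord (X m - X n)) F \<le> e" if "m \<ge> M" for m
        using l2norm_le_norm[OF \<open>finite F\<close>, of "X m - X n"] M[OF that \<open>n \<ge> M\<close>] by linarith
      then show "\<exists>N. \<forall>m\<ge>N. l2norm (coord (X m - X n)) F \<le> e" by blast
    qed
    then show ?thesis by blast
  qed
  obtain M1 where M1: "\<And>F. finite F \<Longrightarrow> l2norm (\<lambda>i. f i - coord (X M1) i) F \<le> 1" using tail[of 1] by auto
  have "l2norm f F \<le> 1 + norm (X M1)" if "finite F" for F
    using l2norm_add[of "\<lambda>i. f i - coord (X M1) i" "coord (X M1)" F] M1[OF that] l2norm_le_norm[OF that, of "X M1"]
    by simp
  then have L: "coord (Abs_ell2 f) = f" by (rule coord_Abs)
  have "X \<longlonglongrightarrow> Abs_ell2 f"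
  proof (rule LIMSEQ_I)
    fix r :: real assume "r > 0"
    then obtain M where M: "\<And>n F. n \<ge> M \<Longrightarrow> finite F \<Longrightarrow> l2norm (\<lambda>i. f i - coord (X n) i) F \<le> r/2"
      using tail[of "r/2"] by auto
    have "norm (Abs_ell2 f - X n) \<le> r/2" if "n \<ge> M" for n
      unfolding norm_ell2_le_iff using M[OF that] \<open>r > 0\<close> by (simp add: L)
    then have "norm (X n - Abs_ell2 f) < r" if "n \<ge> M" for n
      using \<open>r > 0\<close> that norm_minus_commute[of "X n" "Abs_ell2 f"] by fastforce
    then show "\<exists>no. \<forall>n\<ge>no. norm (X n - Abs_ell2 f) < r" by blast
  qed
  then show "convergent X" unfolding convergent_def by blast
qed

definition cinner :: "'i ell2 \<Rightarrow> 'i ell2 \<Rightarrow> complex" where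
  "cinner x y = infsum (\<lambda>i. cnj (coord x i) * coord y i) UNIV"

lemma cinner_abs_summable: "(\<lambda>i. cmod (cnj (coord x i) * coord y i)) summable_on UNIV"
  and cinner_abs_infsum: "infsum (\<lambda>i. cmod (cnj (coord x i) * coord y i)) UNIV \<le> norm x * norm y"
proof -
  have b: "(\<Sum>i\<in>F. cmod (cnj (coord x i) * coord y i)) \<le> norm x * norm y" if "finite F" for F
  proof -
    have "(\<Sum>i\<in>F. cmod (cnj (coord x i) * coord y i)) \<le> l2norm (coord x) F * l2norm (coord y) F"
      using L2_set_mult_ineq[of "\<lambda>i. cmod (coord x i)" "\<lambda>i. cmod (coord y i)" F] by (simp add: norm_mult)
    also have "\<dots> \<le> norm x * norm y"
      using l2norm_le_norm[OF that] by (intro mult_mono) (auto simp: L2_set_nonneg)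
    finally show ?thesis .
  qed
  show s: "(\<lambda>i. cmod (cnj (coord x i) * coord y i)) summable_on UNIV"
  proof (rule nonneg_bdd_above_summable_on)
    show "bdd_above (sum (\<lambda>i. cmod (cnj (coord x i) * coord y i)) ` {F. F \<subseteq> UNIV \<and> finite F})"
      using b by (intro bdd_aboveI2[of _ _ "norm x * norm y"]) blast
  qed simp
  show "infsum (\<lambda>i. cmod (cnj (coord x i) * coord y i)) UNIV \<le> norm x * norm y"
    by (rule infsum_le_finite_sums[OF s]) (rule b)
qed

lemma cinner_summable: "(\<lambda>i. cnj (coord x i) * coord y i) summable_on UNIV"
  using cinner_abs_summable by (rule abs_summable_summable)

lemma cauchy_schwarz: "cmod (cinner x y) \<le> norm x * norm y"
  unfolding cinner_def by (rule order_trans[OF norm_infsum_bound[OF cinner_abs_summable] cinner_abs_infsum])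

lemma cinner_add: "cinner x (y + z) = cinner x y + cinner x z"
  "cinner (x + y) z = cinner x z + cinner y z"
proof -
  have "infsum (\<lambda>i. cnj (coord x i) * coord (y + z) i) UNIV
    = infsum (\<lambda>i. cnj (coord x i) * coord y i + cnj (coord x i) * coord z i) UNIV"
    by (simp only: coord_simps distrib_left)
  then show "cinner x (y + z) = cinner x y + cinner x z"
    unfolding cinner_def by (simp only: infsum_add[OF cinner_summable cinner_summable])
  have "infsum (\<lambda>i. cnj (coord (x + y) i) * coord z i) UNIV
    = infsum (\<lambda>i. cnj (coord x i) * coord z i + cnj (coord y i) * coord z i) UNIV"
    by (simp only: coord_simps distrib_right complex_cnj_add)
  then show "cinner (x + y) z = cinner x z + cinner y z"
    unfolding cinner_def by (simp only: infsum_add[OF cinner_summable cinner_summable])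
qed

lemma cinner_minus: "cinner x (- y) = - cinner x y" "cinner (- x) y = - cinner x y"
  unfolding cinner_def by (simp_all add: infsum_uminus)

lemma cinner_diff: "cinner x (y - z) = cinner x y - cinner x z"
  "cinner (x - y) z = cinner x z - cinner y z"
  by (simp_all only: diff_conv_add_uminus cinner_add cinner_minus)

lemma cinner_commute: "cinner y x = cnj (cinner x y)"
  unfolding cinner_def by (simp add: infsum_cnj[symmetric] mult.commute)

lemma cinner_self: "cinner x x = complex_of_real ((norm x)\<^sup>2)"
proof -
  have "cinner x x = infsum (\<lambda>i. complex_of_real ((cmod (coord x i))\<^sup>2)) UNIV"
    unfolding cinner_def by (intro infsum_cong) (metis complex_norm_square mult.commute)
  also have "\<dots> = complex_of_real (infsum (\<lambda>i. (cmod (coord x i))\<^sup>2) UNIV)"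
    by (intro infsumI has_sum_of_real has_sum_infsum coord_summable)
  finally show ?thesis by (simp add: norm_ell2_def infsum_nonneg)
qed

lift_definition unit_vec :: "'i \<Rightarrow> 'i ell2" is "\<lambda>i j. if j = i then 1 else 0"
proof -
  fix i :: 'i
  have "(\<lambda>j. (cmod (if j = i then 1 else 0))\<^sup>2) summable_on {i}" by simp
  then show "(\<lambda>j. (cmod (if j = i then 1 else 0))\<^sup>2) summable_on UNIV"
    by (subst summable_on_cong_neutral[of "{i}" UNIV _ "\<lambda>j. (cmod (if j = i then 1 else 0))\<^sup>2"]) auto
qed

lemma coord_unit_vec: "coord (unit_vec i) j = (if j = i then 1 else 0)"
  by (simp add: unit_vec.rep_eq)

lemma cinner_unit_vec: "cinner (unit_vec i) y = coord y i"
proof -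
  have "cinner (unit_vec i) y = infsum (\<lambda>j. cnj (coord (unit_vec i) j) * coord y j) {i}"
    unfolding cinner_def by (intro infsum_cong_neutral) (auto simp: coord_unit_vec)
  then show ?thesis by (simp add: coord_unit_vec)
qed

lemma norm_unit_vec: "norm (unit_vec i) = 1"
proof -
  have "complex_of_real ((norm (unit_vec i))\<^sup>2) = 1"
    using cinner_self[of "unit_vec i"] by (simp add: cinner_unit_vec coord_unit_vec)
  then have "(norm (unit_vec i))\<^sup>2 = 1" by (metis of_real_1 of_real_eq_iff)
  then show ?thesis using norm_ge_zero[of "unit_vec i"] by (simp add: power2_eq_1_iff)
qed

lemma cinner_ext: "(\<And>x. cinner x y = cinner x z) \<Longrightarrow> y = z"
  using cinner_unit_vec by (metis ell2_eqI)

section \<open>The C*-algebra of adjointable operators\<close>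

type_synonym 'i op = "'i ell2 \<Rightarrow>\<^sub>L 'i ell2"

definition adjoint_of :: "'i op \<Rightarrow> 'i op \<Rightarrow> bool" where
  "adjoint_of T S \<longleftrightarrow> (\<forall>x y. cinner (blinfun_apply T x) y = cinner x (blinfun_apply S y))"

lemma adjoint_ofD: "adjoint_of T S \<Longrightarrow> cinner (blinfun_apply T x) y = cinner x (blinfun_apply S y)"
  by (simp add: adjoint_of_def)

lemma adjoint_of_commute: "adjoint_of T S \<Longrightarrow> adjoint_of S T"
  unfolding adjoint_of_def by (metis cinner_commute)

lemma adjoint_of_unique: "adjoint_of T S \<Longrightarrow> adjoint_of T S' \<Longrightarrow> S = S'"
  unfolding adjoint_of_def by (metis blinfun_eqI cinner_ext)

lemma adjoint_of_zero: "adjoint_of 0 0"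
  unfolding adjoint_of_def cinner_def by simp

lemma adjoint_of_add: "adjoint_of T S \<Longrightarrow> adjoint_of T' S' \<Longrightarrow> adjoint_of (T + T') (S + S')"
  unfolding adjoint_of_def by (simp add: blinfun.add_left cinner_add)

lemma adjoint_of_compose: "adjoint_of T S \<Longrightarrow> adjoint_of T' S' \<Longrightarrow> adjoint_of (T o\<^sub>L T') (S' o\<^sub>L S)"
  unfolding adjoint_of_def by simp

lemma norm_sq_blinfun:
  assumes "adjoint_of T S"
  shows "(norm (blinfun_apply T x))\<^sup>2 \<le> norm (S o\<^sub>L T) * (norm x)\<^sup>2"
proof -
  have "(norm (blinfun_apply T x))\<^sup>2 = cmod (cinner (blinfun_apply T x) (blinfun_apply T x))"
    by (simp add: cinner_self norm_power)
  also have "\<dots> = cmod (cinner x (blinfun_apply (S o\<^sub>L T) x))"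
    by (simp add: adjoint_ofD[OF assms])
  also have "\<dots> \<le> norm x * norm (blinfun_apply (S o\<^sub>L T) x)" by (rule cauchy_schwarz)
  also have "\<dots> \<le> norm x * (norm (S o\<^sub>L T) * norm x)"
    by (intro mult_left_mono norm_blinfun) simp
  finally show ?thesis by (simp add: power2_eq_square mult_ac)
qed

text \<open>The substantial half of the C*-identity, from Cauchy-Schwarz; the other half is
  submultiplicativity together with \<open>norm_adjoint\<close>.\<close>

lemma norm_sq_le_compose:
  assumes "adjoint_of T S"
  shows "(norm T)\<^sup>2 \<le> norm (S o\<^sub>L T)"
proof -
  have "norm (blinfun_apply T x) \<le> sqrt (norm (S o\<^sub>L T)) * norm x" for x
    using real_sqrt_le_mono[OF norm_sq_blinfun[OF assms, of x]] by (simp add: real_sqrt_mult)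
  then have "norm T \<le> sqrt (norm (S o\<^sub>L T))" by (intro norm_blinfun_bound) auto
  then show ?thesis by (metis norm_ge_zero real_sqrt_pow2 power_mono)
qed

lemma norm_adjoint_le:
  assumes "adjoint_of T S"
  shows "norm T \<le> norm S"
proof (cases "norm T = 0")
  case False
  then have pos: "norm T > 0" by simp
  have "norm T * norm T \<le> norm S * norm T"
    using order_trans[OF norm_sq_le_compose[OF assms] norm_blinfun_compose[of S T]]
    by (simp add: power2_eq_square)
  then show ?thesis using pos by simp
qed simp

lemma norm_adjoint: "adjoint_of T S \<Longrightarrow> norm S = norm T"
  using norm_adjoint_le adjoint_of_commute by (metis antisym)

definition scaleC_op :: "complex \<Rightarrow> 'i op" where
  "scaleC_op c = Blinfun (\<lambda>x. Abs_ell2 (\<lambda>i. c * coord x i))"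

definition diag_op :: "('i \<Rightarrow> complex) \<Rightarrow> 'i op" where
  "diag_op f = Blinfun (\<lambda>x. Abs_ell2 (\<lambda>i. f i * coord x i))"

definition pull_op :: "('i \<Rightarrow> 'i) \<Rightarrow> 'i op" where
  "pull_op g = Blinfun (\<lambda>x. Abs_ell2 (\<lambda>i. coord x (g i)))"

text \<open>For injective g this is the isometry that takes \<open>unit_vec i\<close> to
  \<open>unit_vec (g i)\<close>; its adjoint is \<open>pull_op g\<close>.\<close>

definition push_op :: "('i \<Rightarrow> 'i) \<Rightarrow> 'i op" where
  "push_op g = Blinfun (\<lambda>x. Abs_ell2 (\<lambda>j. if j \<in> range g then coord x (inv g j) else 0))"

text \<open>Common scheme for diagonal, pullback and pushforward operators: a map on raw coordinate
  functions that is linear over the reals and bounded on finite partial norms gives a bounded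
  operator.\<close>

lemma Blinfun_coord:
  assumes add: "\<And>f g i. \<Phi> (\<lambda>j. f j + g j) i = \<Phi> f i + \<Phi> g i"
    and scale: "\<And>r f i. \<Phi> (\<lambda>j. of_real r * f j) i = of_real r * \<Phi> f i"
    and bound: "\<And>x F. finite F \<Longrightarrow> l2norm (\<Phi> (coord x)) F \<le> norm x * K" and K: "K \<ge> 0"
  shows "coord (blinfun_apply (Blinfun (\<lambda>x. Abs_ell2 (\<Phi> (coord x)))) x) = \<Phi> (coord x)"
    and "norm (Blinfun (\<lambda>x. Abs_ell2 (\<Phi> (coord x)))) \<le> K"
proof -
  have c: "coord (Abs_ell2 (\<Phi> (coord x))) = \<Phi> (coord x)" for x
    using bound by (rule coord_Abs)
  have n: "norm (Abs_ell2 (\<Phi> (coord x))) \<le> norm x * K" for x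
    unfolding norm_ell2_le_iff c using bound K by simp
  have "bounded_linear (\<lambda>x. Abs_ell2 (\<Phi> (coord x)))"
  proof (rule bounded_linear_intro[of _ K])
    fix x y :: "'a ell2" and r :: real
    have "coord (x + y) = (\<lambda>j. coord x j + coord y j)" "coord (r *\<^sub>R x) = (\<lambda>j. of_real r * coord x j)" by auto
    then show "Abs_ell2 (\<Phi> (coord (x + y))) = Abs_ell2 (\<Phi> (coord x)) + Abs_ell2 (\<Phi> (coord y))"
      "Abs_ell2 (\<Phi> (coord (r *\<^sub>R x))) = r *\<^sub>R Abs_ell2 (\<Phi> (coord x))"
      using c[of "x + y"] c[of "r *\<^sub>R x"] by (auto intro!: ell2_eqI simp: c add scale)
  qed (rule n)
  then have a: "blinfun_apply (Blinfun (\<lambda>x. Abs_ell2 (\<Phi> (coord x)))) = (\<lambda>x. Abs_ell2 (\<Phi> (coord x)))"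
    by (rule bounded_linear_Blinfun_apply)
  show "coord (blinfun_apply (Blinfun (\<lambda>x. Abs_ell2 (\<Phi> (coord x)))) x) = \<Phi> (coord x)"
    by (simp add: a c)
  show "norm (Blinfun (\<lambda>x. Abs_ell2 (\<Phi> (coord x)))) \<le> K"
    using n K by (intro norm_blinfun_bound) (simp_all add: a mult.commute)
qed

lemma diag_op:
  assumes "\<And>i. cmod (f i) \<le> K"
  shows "coord (blinfun_apply (diag_op f) x) i = f i * coord x i" and "norm (diag_op f) \<le> K"
proof -
  have K: "K \<ge> 0" using assms norm_ge_zero order_trans by blast
  have b: "l2norm (\<lambda>i. f i * coord x i) F \<le> norm x * K" if "finite F" for x F
  proof -
    have "l2norm (\<lambda>i. f i * coord x i) F \<le> L2_set (\<lambda>i. K * cmod (coord x i)) F"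
      using assms by (intro L2_set_mono) (auto simp: norm_mult intro: mult_right_mono)
    also have "\<dots> = K * l2norm (coord x) F" using K by (simp add: L2_set_right_distrib)
    also have "\<dots> \<le> K * norm x" using K l2norm_le_norm[OF that] by (intro mult_left_mono)
    finally show ?thesis by (simp add: mult.commute)
  qed
  note B = Blinfun_coord[of "\<lambda>x i. f i * x i" K, OF _ _ b K]
  show "coord (blinfun_apply (diag_op f) x) i = f i * coord x i"
    unfolding diag_op_def by (subst B(1)) (simp_all add: algebra_simps)
  show "norm (diag_op f) \<le> K"
    unfolding diag_op_def by (rule B(2)) (simp_all add: algebra_simps)
qed

lemma scaleC_op:
  shows "coord (blinfun_apply (scaleC_op c) x) i = c * coord x i" and "norm (scaleC_op c) \<le> cmod c"
  using diag_op[of "\<lambda>_. c" "cmod c"] unfolding diag_op_def scaleC_op_def by simp_all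

lemma pull_op:
  assumes "inj g"
  shows "coord (blinfun_apply (pull_op g) x) i = coord x (g i)" and "norm (pull_op g) \<le> 1"
proof -
  have b: "l2norm (\<lambda>i. coord x (g i)) F \<le> norm x * 1" if "finite F" for x F
  proof -
    have "l2norm (\<lambda>i. coord x (g i)) F = l2norm (coord x) (g ` F)"
      unfolding L2_set_def using inj_on_subset[OF assms, of F] by (subst sum.reindex) auto
    also have "\<dots> \<le> norm x" using that by (intro l2norm_le_norm) simp
    finally show ?thesis by simp
  qed
  note B = Blinfun_coord[of "\<lambda>x i. x (g i)" 1, OF _ _ b]
  show "coord (blinfun_apply (pull_op g) x) i = coord x (g i)"
    unfolding pull_op_def by (subst B(1)) simp_all
  show "norm (pull_op g) \<le> 1"
    unfolding pull_op_def by (rule B(2)) simp_all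
qed

lemma push_op:
  assumes "inj g"
  shows "coord (blinfun_apply (push_op g) x) j = (if j \<in> range g then coord x (inv g j) else 0)"
    and "norm (push_op g) \<le> 1"
proof -
  have b: "l2norm (\<lambda>j. if j \<in> range g then coord x (inv g j) else 0) F \<le> norm x * 1" if "finite F" for x F
  proof -
    have "(\<Sum>j\<in>F. (cmod (if j \<in> range g then coord x (inv g j) else 0))\<^sup>2)
      = (\<Sum>j\<in>F \<inter> range g. (cmod (coord x (inv g j)))\<^sup>2)"
      using that by (subst sum.inter_restrict) (auto intro!: sum.cong)
    also have "\<dots> = (\<Sum>i\<in>inv g ` (F \<inter> range g). (cmod (coord x i))\<^sup>2)"
      by (subst sum.reindex) (auto intro!: inj_onI simp: assms)
    finally have "l2norm (\<lambda>j. if j \<in> range g then coord x (inv g j) else 0) F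
      = l2norm (coord x) (inv g ` (F \<inter> range g))" unfolding L2_set_def by simp
    also have "\<dots> \<le> norm x" using that by (intro l2norm_le_norm) simp
    finally show ?thesis by simp
  qed
  note B = Blinfun_coord[of "\<lambda>x j. if j \<in> range g then x (inv g j) else 0" 1, OF _ _ b]
  show "coord (blinfun_apply (push_op g) x) j = (if j \<in> range g then coord x (inv g j) else 0)"
    unfolding push_op_def by (subst B(1)) simp_all
  show "norm (push_op g) \<le> 1"
    unfolding push_op_def by (rule B(2)) simp_all
qed

lemma adjoint_diag_op:
  assumes "\<And>i. cmod (f i) \<le> K"
  shows "adjoint_of (diag_op f) (diag_op (\<lambda>i. cnj (f i)))"
proof -
  have c: "\<And>i. cmod (cnj (f i)) \<le> K" using assms by simp
  show ?thesis unfolding adjoint_of_def cinner_def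
    by (simp add: diag_op(1)[OF assms] diag_op(1)[OF c] mult_ac)
qed

lemma adjoint_scaleC_op: "adjoint_of (scaleC_op c) (scaleC_op (cnj c))"
  unfolding adjoint_of_def cinner_def by (simp add: scaleC_op mult_ac)

lemma adjoint_push_op:
  assumes "inj g"
  shows "adjoint_of (push_op g) (pull_op g)"
  unfolding adjoint_of_def
proof (intro allI)
  fix x y :: "'a ell2"
  have "cinner (blinfun_apply (push_op g) x) y
    = infsum (\<lambda>j. cnj (coord x (inv g j)) * coord y j) (range g)"
    unfolding cinner_def by (intro infsum_cong_neutral) (auto simp: push_op[OF assms])
  also have "\<dots> = infsum (\<lambda>i. cnj (coord x i) * coord y (g i)) UNIV"
    by (subst infsum_reindex) (auto simp: o_def assms)
  also have "\<dots> = cinner x (blinfun_apply (pull_op g) y)"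
    unfolding cinner_def by (simp add: pull_op[OF assms])
  finally show "cinner (blinfun_apply (push_op g) x) y = cinner x (blinfun_apply (pull_op g) y)" .
qed

definition star_op :: "'i op \<Rightarrow> 'i op" where
  "star_op T = (SOME S. adjoint_of T S)"

lemma star_op_eq: "adjoint_of T S \<Longrightarrow> star_op T = S"
  unfolding star_op_def using adjoint_of_unique by (metis someI)

lemma op_ext: "(\<And>x i. coord (blinfun_apply S x) i = coord (blinfun_apply T x) i) \<Longrightarrow> S = T"
  by (intro blinfun_eqI ell2_eqI) auto

text \<open>Existence of an adjoint is made a condition. It supplies the involution and also forces
  complex linearity on operators that are a priori only real linear.\<close>

definition adjointable :: "'i op set" where
  "adjointable = {T. \<exists>S. adjoint_of T S}"

definition op_algebra :: "'i op staralg" where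
  "op_algebra = \<lparr>vec = adjointable, vzero = 0, vadd = (+), vscale = (\<lambda>c T. scaleC_op c o\<^sub>L T),
     vnorm = norm, amult = (o\<^sub>L), astar = star_op\<rparr>"

lemma op_algebra_simps [simp]:
  "vec op_algebra = adjointable" "vzero op_algebra = 0" "vadd op_algebra = (+)"
  "vscale op_algebra = (\<lambda>c T. scaleC_op c o\<^sub>L T)" "vnorm op_algebra = norm"
  "amult op_algebra = (o\<^sub>L)" "astar op_algebra = star_op"
  by (simp_all add: op_algebra_def)

lemma adjointable_star: "T \<in> adjointable \<Longrightarrow> adjoint_of T (star_op T)"
  unfolding adjointable_def using star_op_eq by fastforce

lemma adjointableI: "adjoint_of T S \<Longrightarrow> T \<in> adjointable"
  unfolding adjointable_def by blast

text \<open>Moved to the other side of the inner product, the operator no longer touches the scalar,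
  which can then be pulled out.\<close>

lemma scaleC_commute:
  assumes "T \<in> adjointable"
  shows "T o\<^sub>L scaleC_op c = scaleC_op c o\<^sub>L T"
proof -
  obtain S where S: "adjoint_of S T" using assms adjoint_of_commute unfolding adjointable_def by blast
  have *: "cinner (blinfun_apply (scaleC_op (cnj c)) y) x = c * cinner y x" for x y :: "'a ell2"
    unfolding cinner_def by (simp add: scaleC_op mult.assoc infsum_cmult_right')
  have **: "cinner y (blinfun_apply (scaleC_op c) x) = c * cinner y x" for x y :: "'a ell2"
    unfolding cinner_def by (simp add: scaleC_op mult.left_commute infsum_cmult_right')
  show ?thesis
  proof (rule blinfun_eqI, rule cinner_ext)
    fix x y :: "'a ell2"
    show "cinner y (blinfun_apply (T o\<^sub>L scaleC_op c) x) = cinner y (blinfun_apply (scaleC_op c o\<^sub>L T) x)"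
      by (simp add: ** adjoint_ofD[OF S, symmetric])
  qed
qed

lemma blinfun_compose_distrib:
  "(S + T) o\<^sub>L U = (S o\<^sub>L U) + (T o\<^sub>L U)" "U o\<^sub>L (S + T) = (U o\<^sub>L S) + (U o\<^sub>L T)"
  by (auto intro!: blinfun_eqI simp: blinfun.add_left blinfun.add_right)

lemma blinfun_compose_assoc: "(S o\<^sub>L T) o\<^sub>L U = S o\<^sub>L (T o\<^sub>L U)"
  by (rule blinfun_eqI) simp

lemma scaleC_op_simps:
  "scaleC_op (c + d) = scaleC_op c + scaleC_op d"
  "scaleC_op c o\<^sub>L scaleC_op d = scaleC_op (c * d)"
  "scaleC_op 1 o\<^sub>L T = T" "T + (scaleC_op (-1) o\<^sub>L S) = T - S"
  by (rule op_ext; simp add: scaleC_op blinfun.add_left blinfun.diff_left algebra_simps)+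

lemma norm_scaleC_op:
  fixes T :: "'a op"
  shows "norm (scaleC_op c o\<^sub>L T) = cmod c * norm T"
proof (rule antisym)
  have le: "norm (scaleC_op d o\<^sub>L S) \<le> cmod d * norm S" for d and S :: "'a op"
    by (rule order_trans[OF norm_blinfun_compose mult_right_mono[OF scaleC_op(2)]]) simp
  then show "norm (scaleC_op c o\<^sub>L T) \<le> cmod c * norm T" .
  show "cmod c * norm T \<le> norm (scaleC_op c o\<^sub>L T)"
  proof (cases "c = 0")
    case False
    have "scaleC_op (inverse c) o\<^sub>L (scaleC_op c o\<^sub>L T) = T"
      using False by (simp add: blinfun_compose_assoc[symmetric] scaleC_op_simps)
    then have "norm T \<le> norm (scaleC_op c o\<^sub>L T) / cmod c"
      using le[of "inverse c" "scaleC_op c o\<^sub>L T"] by (simp add: norm_inverse divide_inverse mult.commute)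
    then show ?thesis using False by (simp add: pos_le_divide_eq mult.commute)
  qed simp
qed

text \<open>Passing to adjoints is isometric, so the adjoints form a Cauchy sequence too, and
  continuity of the inner product makes the two limits adjoint to each other.\<close>

lemma adjointable_closed:
  assumes "\<And>n. X n \<in> adjointable" "Cauchy X"
  shows "\<exists>T\<in>adjointable. X \<longlonglongrightarrow> T"
proof -
  obtain T where T: "X \<longlonglongrightarrow> T" using assms(2) Cauchy_convergent convergent_def by blast
  have adj: "adjoint_of (X n) (star_op (X n))" for n using assms(1) adjointable_star by blast
  have "norm (star_op (X m) - star_op (X n)) = norm (X m - X n)" for m n
  proof (rule norm_adjoint)
    show "adjoint_of (X m - X n) (star_op (X m) - star_op (X n))"
      using adj[of m] adj[of n] unfolding adjoint_of_def by (simp add: blinfun.diff_left cinner_diff)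
  qed
  then have "Cauchy (\<lambda>n. star_op (X n))" using assms(2) unfolding Cauchy_iff by simp
  then obtain S where S: "(\<lambda>n. star_op (X n)) \<longlonglongrightarrow> S" using Cauchy_convergent convergent_def by blast
  have cont: "(\<lambda>n. cinner (u n) (v n)) \<longlonglongrightarrow> cinner a b"
    if u: "u \<longlonglongrightarrow> a" and v: "v \<longlonglongrightarrow> b" for u v and a b :: "'a ell2"
  proof (rule Lim_null_comparison[THEN LIM_zero_cancel])
    show "(\<lambda>n. norm (u n - a) * norm (v n) + norm a * norm (v n - b)) \<longlonglongrightarrow> 0"
      using tendsto_add[OF tendsto_mult[OF tendsto_norm_zero[OF LIM_zero[OF u]] tendsto_norm[OF v]]
        tendsto_mult[OF tendsto_const[of "norm a"] tendsto_norm_zero[OF LIM_zero[OF v]]]] by simp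
    have "cinner (u n) (v n) - cinner a b = cinner (u n - a) (v n) + cinner a (v n - b)" for n
      by (simp add: cinner_diff)
    then show "eventually (\<lambda>n. cmod (cinner (u n) (v n) - cinner a b)
        \<le> norm (u n - a) * norm (v n) + norm a * norm (v n - b)) sequentially"
      by (intro always_eventually allI) (metis norm_triangle_mono cauchy_schwarz)
  qed
  have "cinner (blinfun_apply T x) y = cinner x (blinfun_apply S y)" for x y
  proof (rule LIMSEQ_unique)
    show "(\<lambda>n. cinner (blinfun_apply (X n) x) y) \<longlonglongrightarrow> cinner (blinfun_apply T x) y"
      by (intro cont tendsto_const blinfun.tendsto T)
    show "(\<lambda>n. cinner (blinfun_apply (X n) x) y) \<longlonglongrightarrow> cinner x (blinfun_apply S y)"
      unfolding adjoint_ofD[OF adj] by (intro cont tendsto_const blinfun.tendsto S)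
  qed
  then have "T \<in> adjointable" unfolding adjointable_def adjoint_of_def by blast
  then show ?thesis using T by blast
qed

lemma vminus_op_algebra [simp]: "vminus op_algebra S T = S - T"
  by (simp add: vminus_def scaleC_op_simps)

lemma cstar_op_algebra: "cstar_algebra op_algebra"
proof unfold_locales
  note [simp] = blinfun_compose_assoc blinfun_compose_distrib
  note I = adjointableI and D = adjointable_star
  show "vzero op_algebra \<in> vec op_algebra" using adjoint_of_zero I by simp blast
  fix x y z :: "'a op" and c d :: complex
  show "vadd op_algebra x y \<in> vec op_algebra" if "x \<in> vec op_algebra" "y \<in> vec op_algebra"
    using that I[OF adjoint_of_add[OF D D]] by simp
  show "vscale op_algebra c x \<in> vec op_algebra" if "x \<in> vec op_algebra"
    using that I[OF adjoint_of_compose[OF adjoint_scaleC_op D]] by simp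
  show "amult op_algebra x y \<in> vec op_algebra" if "x \<in> vec op_algebra" "y \<in> vec op_algebra"
    using that I[OF adjoint_of_compose[OF D D]] by simp
  show "astar op_algebra x \<in> vec op_algebra" if "x \<in> vec op_algebra"
    using that I[OF adjoint_of_commute[OF D]] by simp
  show "astar op_algebra (astar op_algebra x) = x" if "x \<in> vec op_algebra"
    using that star_op_eq[OF adjoint_of_commute[OF D]] by simp
  show "astar op_algebra (vadd op_algebra x y) = vadd op_algebra (astar op_algebra x) (astar op_algebra y)"
    if "x \<in> vec op_algebra" "y \<in> vec op_algebra"
    using that star_op_eq[OF adjoint_of_add[OF D D]] by simp
  show "astar op_algebra (vscale op_algebra c x) = vscale op_algebra (cnj c) (astar op_algebra x)"
    if "x \<in> vec op_algebra"
    using star_op_eq[OF adjoint_of_compose[OF adjoint_scaleC_op[of c] D[of x]]] that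
      scaleC_commute[OF I[OF adjoint_of_commute[OF D[of x]]], of "cnj c"] by simp
  show "astar op_algebra (amult op_algebra x y) = amult op_algebra (astar op_algebra y) (astar op_algebra x)"
    if "x \<in> vec op_algebra" "y \<in> vec op_algebra"
    using that star_op_eq[OF adjoint_of_compose[OF D D]] by simp
  show "vnorm op_algebra (amult op_algebra (astar op_algebra x) x) = (vnorm op_algebra x)\<^sup>2"
    if "x \<in> vec op_algebra"
  proof (rule antisym)
    have "adjoint_of x (star_op x)" using that D by simp
    then show "(vnorm op_algebra x)\<^sup>2 \<le> vnorm op_algebra (amult op_algebra (astar op_algebra x) x)"
      "vnorm op_algebra (amult op_algebra (astar op_algebra x) x) \<le> (vnorm op_algebra x)\<^sup>2"
      using norm_sq_le_compose[of x "star_op x"] norm_blinfun_compose[of "star_op x" x]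
        norm_adjoint[of x "star_op x"] by (simp_all add: power2_eq_square)
  qed
  show "amult op_algebra x (vscale op_algebra c y) = vscale op_algebra c (amult op_algebra x y)"
    if "x \<in> vec op_algebra" "y \<in> vec op_algebra"
    using that scaleC_commute[of x c] by (simp add: blinfun_compose_assoc[symmetric] del: blinfun_compose_assoc)
  show "vscale op_algebra c (vscale op_algebra d x) = vscale op_algebra (c * d) x"
    by (simp add: blinfun_compose_assoc[symmetric] scaleC_op_simps del: blinfun_compose_assoc)
  show "\<exists>l\<in>vec op_algebra. vconverges op_algebra s l"
    if "range s \<subseteq> vec op_algebra" "vCauchy op_algebra s" for s :: "nat \<Rightarrow> 'a op"
  proof -
    have "Cauchy s" using that(2) unfolding vCauchy_def Cauchy_iff by simp
    moreover have "s k \<in> adjointable" for k using that(1) by auto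
    ultimately obtain T where T: "T \<in> adjointable" "s \<longlonglongrightarrow> T" using adjointable_closed[of s] by blast
    have "vconverges op_algebra s T" unfolding vconverges_def
      using tendsto_norm_zero[OF LIM_zero[OF T(2)]] by simp
    then show ?thesis using T(1) by auto
  qed
qed (simp_all add: scaleC_op_simps norm_scaleC_op blinfun_compose_distrib blinfun_compose_assoc
    norm_triangle_ineq norm_blinfun_compose)

text \<open>Coordinate i of the adjoint at x is the inner product of the image of
  \<open>unit_vec i\<close> with x, so the matrix fixes the adjoint and with it the operator. This
  allows operators to be coded by their matrices.\<close>

lemma adjointable_matrix_ext:
  assumes "S \<in> adjointable" "T \<in> adjointable"
    and "\<And>u w. coord (blinfun_apply S (unit_vec u)) w = coord (blinfun_apply T (unit_vec u)) w"
  shows "S = T"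
proof -
  have "star_op S = star_op T"
  proof (rule op_ext)
    fix x i
    show "coord (blinfun_apply (star_op S) x) i = coord (blinfun_apply (star_op T) x) i"
      using adjoint_ofD[OF adjointable_star[OF assms(1)], of "unit_vec i" x]
        adjoint_ofD[OF adjointable_star[OF assms(2)], of "unit_vec i" x] ell2_eqI[OF assms(3), of i]
      by (simp add: cinner_unit_vec)
  qed
  then show ?thesis
    using adjoint_of_unique adjoint_of_commute adjointable_star assms(1,2) by metis
qed

section \<open>Orbit representations\<close>

lemma word_map_Nil [simp]: "word_map \<sigma> [] v = v"
  by (simp add: word_map_def)

lemma word_map_Cons [simp]: "word_map \<sigma> (i # u) v = \<sigma> i (word_map \<sigma> u v)"
  by (simp add: word_map_def)

lemma word_map_append: "word_map \<sigma> (u @ w) v = word_map \<sigma> u (word_map \<sigma> w v)"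
  by (induction u) auto

section \<open>Functions vanishing at infinity and the module of edge functions\<close>

lemma C0_functions_bounded:
  assumes "f \<in> C0_functions T"
  shows "\<exists>K. \<forall>x. cmod (f x) \<le> K"
proof -
  have f: "continuous_map T euclidean f" "compactin T {x \<in> topspace T. 1 \<le> cmod (f x)}"
    "\<And>x. x \<notin> topspace T \<Longrightarrow> f x = 0"
    using assms unfolding C0_functions_def by simp_all
  have "compact (f ` {x \<in> topspace T. 1 \<le> cmod (f x)})"
    using image_compactin[OF f(2,1)] by (simp only: compactin_euclidean_iff)
  then have "bounded (f ` {x \<in> topspace T. 1 \<le> cmod (f x)})" by (rule compact_imp_bounded)
  then obtain K where K: "\<forall>y\<in>f ` {x \<in> topspace T. 1 \<le> cmod (f x)}. cmod y \<le> K"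
    unfolding bounded_iff by (rule exE)
  have "cmod (f x) \<le> max K 1" for x
  proof (cases "x \<in> topspace T \<and> 1 \<le> cmod (f x)")
    case True
    then have "cmod (f x) \<le> K" using K by blast
    then show ?thesis by simp
  next
    case False
    then have "cmod (f x) \<le> 1" using f(3)[of x] by (cases "x \<in> topspace T") auto
    then show ?thesis by simp
  qed
  then show ?thesis by (intro exI allI)
qed

lemma C0_bdd_above: "f \<in> C0_functions T \<Longrightarrow> bdd_above (range (\<lambda>x. cmod (f x)))"
  using C0_functions_bounded by (metis (no_types, lifting) bdd_aboveI2)

lemma C0_simps [simp]:
  "vec (C0 T) = C0_functions T" "vzero (C0 T) = (\<lambda>x. 0)" "vadd (C0 T) = (\<lambda>f g x. f x + g x)"
  "vscale (C0 T) = (\<lambda>c f x. c * f x)" "vnorm (C0 T) = (\<lambda>f. SUP x. cmod (f x))"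
  "amult (C0 T) = (\<lambda>f g x. f x * g x)" "astar (C0 T) = (\<lambda>f x. cnj (f x))"
  by (simp_all add: C0_def)

lemma cmod_le_C0_norm: "f \<in> C0_functions T \<Longrightarrow> cmod (f x) \<le> vnorm (C0 T) f"
  using cSUP_upper[OF UNIV_I C0_bdd_above, of f T x] by simp

lemma C0_norm_le: "(\<And>x. cmod (f x) \<le> K) \<Longrightarrow> vnorm (C0 T) f \<le> K"
  by (simp add: cSUP_least)

lemma dynamical_correspondence_simps [simp]:
  "vec (dynamical_correspondence \<Omega> n \<sigma>) = C0_functions (prod_topology (discrete_topology {1..n}) \<Omega>)"
  "vzero (dynamical_correspondence \<Omega> n \<sigma>) = (\<lambda>e. 0)"
  "vadd (dynamical_correspondence \<Omega> n \<sigma>) = (\<lambda>F G e. F e + G e)"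
  "vscale (dynamical_correspondence \<Omega> n \<sigma>) = (\<lambda>c F e. c * F e)"
  "vnorm (dynamical_correspondence \<Omega> n \<sigma>)
    = (\<lambda>F. sqrt (vnorm (C0 \<Omega>) (ainner (dynamical_correspondence \<Omega> n \<sigma>) F F)))"
  "lact (dynamical_correspondence \<Omega> n \<sigma>) = (\<lambda>f F (i, x). f (\<sigma> i x) * F (i, x))"
  "ract (dynamical_correspondence \<Omega> n \<sigma>) = (\<lambda>F g (i, x). F (i, x) * g x)"
  "ainner (dynamical_correspondence \<Omega> n \<sigma>) = (\<lambda>F G x. \<Sum>i=1..n. cnj (F (i, x)) * G (i, x))"
  by (simp_all add: dynamical_correspondence_def Let_def del: C0_simps)

lemma edge_function_zero:
  "F \<in> C0_functions (prod_topology (discrete_topology {1..n}) \<Omega>) \<Longrightarrow> i \<notin> {1..n} \<Longrightarrow> F (i, x) = 0"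
  unfolding C0_functions_def by auto

lemma coord_sum: "coord (\<Sum>i\<in>I. f i) j = (\<Sum>i\<in>I. coord (f i) j)"
  by (induction I rule: infinite_finite_induct) auto

lemma adjoint_of_sum:
  assumes "\<And>i. i \<in> I \<Longrightarrow> adjoint_of (f i) (g i)"
  shows "adjoint_of (\<Sum>i\<in>I. f i) (\<Sum>i\<in>I. g i)"
  using assms by (induction I rule: infinite_finite_induct) (auto intro: adjoint_of_zero adjoint_of_add)

text \<open>Fock-type representation over the orbit of v: the basis vector of a word u stands for
  the point reached by u, functions act diagonally by their value there, and \<open>orbit_t\<close>
  prepends letters. Words that reach the same point keep different basis vectors.\<close>

definition orbit_pi :: "(nat \<Rightarrow> 'v \<Rightarrow> 'v) \<Rightarrow> 'v \<Rightarrow> ('v \<Rightarrow> complex) \<Rightarrow> nat list op" where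
  "orbit_pi \<sigma> v f = diag_op (\<lambda>u. f (word_map \<sigma> u v))"

definition orbit_t :: "nat \<Rightarrow> (nat \<Rightarrow> 'v \<Rightarrow> 'v) \<Rightarrow> 'v \<Rightarrow> (nat \<times> 'v \<Rightarrow> complex) \<Rightarrow> nat list op" where
  "orbit_t n \<sigma> v F = (\<Sum>i=1..n. push_op (Cons i) o\<^sub>L diag_op (\<lambda>u. F (i, word_map \<sigma> u v)))"

lemma orbit_pi:
  assumes "f \<in> C0_functions \<Omega>"
  shows "coord (blinfun_apply (orbit_pi \<sigma> v f) x) w = f (word_map \<sigma> w v) * coord x w"
    and "norm (orbit_pi \<sigma> v f) \<le> vnorm (C0 \<Omega>) f"
    and "adjoint_of (orbit_pi \<sigma> v f) (orbit_pi \<sigma> v (\<lambda>x. cnj (f x)))"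
proof -
  have b: "cmod (f (word_map \<sigma> u v)) \<le> vnorm (C0 \<Omega>) f" for u by (rule cmod_le_C0_norm[OF assms])
  show "coord (blinfun_apply (orbit_pi \<sigma> v f) x) w = f (word_map \<sigma> w v) * coord x w"
    "norm (orbit_pi \<sigma> v f) \<le> vnorm (C0 \<Omega>) f"
    "adjoint_of (orbit_pi \<sigma> v f) (orbit_pi \<sigma> v (\<lambda>x. cnj (f x)))"
    unfolding orbit_pi_def
    using diag_op(1)[of "\<lambda>u. f (word_map \<sigma> u v)", OF b] diag_op(2)[of "\<lambda>u. f (word_map \<sigma> u v)", OF b]
      adjoint_diag_op[of "\<lambda>u. f (word_map \<sigma> u v)", OF b] by blast+
qed

lemma orbit_t:
  assumes F: "F \<in> C0_functions (prod_topology (discrete_topology {1..n}) \<Omega>)"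
  shows "coord (blinfun_apply (orbit_t n \<sigma> v F) x) w
      = (case w of [] \<Rightarrow> 0 | i # u \<Rightarrow> F (i, word_map \<sigma> u v) * coord x u)"
    and "(\<And>e. cmod (F e) \<le> K) \<Longrightarrow> norm (orbit_t n \<sigma> v F) \<le> real n * K"
    and "\<exists>S. adjoint_of (orbit_t n \<sigma> v F) S \<and>
      (\<forall>y u. coord (blinfun_apply S y) u = (\<Sum>i=1..n. cnj (F (i, word_map \<sigma> u v)) * coord y (i # u)))"
proof -
  obtain M where M: "\<And>e. cmod (F e) \<le> M" using C0_functions_bounded[OF F] by blast
  have inj: "inj (Cons i)" for i :: nat by simp
  have inv: "inv (Cons i) (i # u) = u" for i :: nat and u by (rule inv_f_f[OF inj])
  have d: "coord (blinfun_apply (diag_op (\<lambda>u. F (i, word_map \<sigma> u v))) x) u = F (i, word_map \<sigma> u v) * coord x u" for i x u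
    by (rule diag_op(1)) (rule M)
  have p: "coord (blinfun_apply (push_op (Cons i)) x) w
      = (case w of [] \<Rightarrow> 0 | j # u \<Rightarrow> if j = i then coord x u else 0)" for i :: nat and x w
    by (subst push_op(1)[OF inj]) (auto simp: inv split: list.split)
  show "coord (blinfun_apply (orbit_t n \<sigma> v F) x) w
      = (case w of [] \<Rightarrow> 0 | i # u \<Rightarrow> F (i, word_map \<sigma> u v) * coord x u)"
  proof (cases w)
    case (Cons j u)
    have "coord (blinfun_apply (orbit_t n \<sigma> v F) x) w
        = (\<Sum>i=1..n. if j = i then F (i, word_map \<sigma> u v) * coord x u else 0)"
      unfolding orbit_t_def by (simp add: blinfun.sum_left coord_sum p d Cons cong: if_cong)
    \<comment> \<open>If j is not among the letters \<open>1..n\<close>, the sum is empty of j, and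
      F vanishes at j as well.\<close>
    also have "\<dots> = F (j, word_map \<sigma> u v) * coord x u"
      using edge_function_zero[OF F, of j] by (auto simp: sum.delta')
    finally show ?thesis by (simp add: Cons)
  qed (simp add: orbit_t_def blinfun.sum_left coord_sum p)
  show "norm (orbit_t n \<sigma> v F) \<le> real n * K" if K: "\<And>e. cmod (F e) \<le> K"
  proof -
    have "norm (push_op (Cons i) o\<^sub>L diag_op (\<lambda>u. F (i, word_map \<sigma> u v))) \<le> 1 * K" for i
      by (rule order_trans[OF norm_blinfun_compose mult_mono[OF push_op(2)[OF inj] diag_op(2)]]) (auto intro: K)
    then have "norm (orbit_t n \<sigma> v F) \<le> (\<Sum>i=1..n. K)"
      unfolding orbit_t_def by (intro sum_norm_le) simp
    then show ?thesis by simp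
  qed
  show "\<exists>S. adjoint_of (orbit_t n \<sigma> v F) S \<and>
      (\<forall>y u. coord (blinfun_apply S y) u = (\<Sum>i=1..n. cnj (F (i, word_map \<sigma> u v)) * coord y (i # u)))"
  proof (intro exI conjI allI)
    show "adjoint_of (orbit_t n \<sigma> v F) (\<Sum>i=1..n. diag_op (\<lambda>u. cnj (F (i, word_map \<sigma> u v))) o\<^sub>L pull_op (Cons i))"
      unfolding orbit_t_def
      by (intro adjoint_of_sum adjoint_of_compose adjoint_push_op inj adjoint_diag_op) (rule M)
    fix y u
    have "cmod (cnj (F e)) \<le> M" for e using M by simp
    then show "coord (blinfun_apply (\<Sum>i=1..n. diag_op (\<lambda>u. cnj (F (i, word_map \<sigma> u v))) o\<^sub>L pull_op (Cons i)) y) u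
      = (\<Sum>i=1..n. cnj (F (i, word_map \<sigma> u v)) * coord y (i # u))"
      by (simp add: blinfun.sum_left coord_sum diag_op(1)[where K = M] pull_op(1)[OF inj])
  qed
qed

text \<open>One term of the sum that defines the inner product of F with itself at x is bounded by
  the whole sum.\<close>

lemma edge_norm:
  assumes cc: "cstar_correspondence (C0 \<Omega>) (dynamical_correspondence \<Omega> n \<sigma>)"
    and F: "F \<in> C0_functions (prod_topology (discrete_topology {1..n}) \<Omega>)"
  shows "cmod (F e) \<le> vnorm (dynamical_correspondence \<Omega> n \<sigma>) F"
proof -
  obtain i x where e: "e = (i, x)" by force
  let ?X = "dynamical_correspondence \<Omega> n \<sigma>"
  have mem: "ainner ?X F F \<in> C0_functions \<Omega>"
    using cstar_correspondence.inner_mem[OF cc, of F F] F by simp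
  have eq: "ainner ?X F F x = complex_of_real (\<Sum>j=1..n. (cmod (F (j, x)))\<^sup>2)"
    unfolding dynamical_correspondence_simps of_real_sum complex_norm_square by (simp add: mult.commute)
  have "(cmod (F (i, x)))\<^sup>2 \<le> (\<Sum>j=1..n. (cmod (F (j, x)))\<^sup>2)"
  proof (cases "i \<in> {1..n}")
    case True
    then show ?thesis by (intro member_le_sum) auto
  next
    case False
    then show ?thesis using edge_function_zero[OF F False] by (simp add: sum_nonneg)
  qed
  also have "\<dots> = cmod (ainner ?X F F x)"
    unfolding eq norm_of_real by (simp add: sum_nonneg)
  also have "\<dots> \<le> vnorm (C0 \<Omega>) (ainner ?X F F)" by (rule cmod_le_C0_norm[OF mem])
  finally show ?thesis unfolding e dynamical_correspondence_simps(5) by (rule real_le_rsqrt)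
qed

text \<open>The left action evaluates f at \<open>\<sigma> i x\<close>, the orbit point of the word
  lengthened by i; so prepending a letter is covariant. Lengthened words with distinct first letters
  are orthogonal, which gives the inner product relation.\<close>

lemma orbit_toeplitz:
  assumes cc: "cstar_correspondence (C0 \<Omega>) (dynamical_correspondence \<Omega> n \<sigma>)"
  shows "toeplitz_representation (C0 \<Omega>) (dynamical_correspondence \<Omega> n \<sigma>) op_algebra
    (orbit_pi \<sigma> v) (orbit_t n \<sigma> v)"
proof -
  let ?X = "dynamical_correspondence \<Omega> n \<sigma>"
  note opi = orbit_pi[where \<Omega> = \<Omega>] and ot = orbit_t[where \<Omega> = \<Omega>]
  interpret cstar_correspondence "C0 \<Omega>" ?X by fact
  have AV: "\<And>f g. f \<in> C0_functions \<Omega> \<Longrightarrow> g \<in> C0_functions \<Omega> \<Longrightarrow> (\<lambda>x. f x + g x) \<in> C0_functions \<Omega>"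
    "\<And>f c. f \<in> C0_functions \<Omega> \<Longrightarrow> (\<lambda>x. c * f x) \<in> C0_functions \<Omega>"
    "\<And>f g. f \<in> C0_functions \<Omega> \<Longrightarrow> g \<in> C0_functions \<Omega> \<Longrightarrow> (\<lambda>x. f x * g x) \<in> C0_functions \<Omega>"
    "\<And>f. f \<in> C0_functions \<Omega> \<Longrightarrow> (\<lambda>x. cnj (f x)) \<in> C0_functions \<Omega>"
    using A.add_mem A.scale_mem A.mult_mem A.star_mem by auto
  have 1: "bounded_linear_map (C0 \<Omega>) op_algebra (orbit_pi \<sigma> v)"
    unfolding bounded_linear_map_def
  proof (intro conjI ballI allI)
    show "orbit_pi \<sigma> v ` vec (C0 \<Omega>) \<subseteq> vec op_algebra"
      using opi(3) adjointableI by fastforce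
    show "\<exists>K. \<forall>x\<in>vec (C0 \<Omega>). vnorm op_algebra (orbit_pi \<sigma> v x) \<le> K * vnorm (C0 \<Omega>) x"
      unfolding op_algebra_simps C0_simps(1) by (intro exI[of _ 1] ballI) (simp only: mult_1 opi(2))
  qed (auto intro!: op_ext simp: opi(1) AV scaleC_op blinfun.add_left algebra_simps)
  then have 2: "star_hom (C0 \<Omega>) op_algebra (orbit_pi \<sigma> v)"
    unfolding star_hom_def
    by (auto intro!: op_ext simp: opi(1) AV star_op_eq[OF opi(3)])
  have XV: "\<And>F G. F \<in> vec ?X \<Longrightarrow> G \<in> vec ?X \<Longrightarrow> (\<lambda>x. F x + G x) \<in> vec ?X"
    "\<And>F c. F \<in> vec ?X \<Longrightarrow> (\<lambda>x. c * F x) \<in> vec ?X"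
    "\<And>f F. f \<in> C0_functions \<Omega> \<Longrightarrow> F \<in> vec ?X \<Longrightarrow> (\<lambda>(i, x). f (\<sigma> i x) * F (i, x)) \<in> vec ?X"
    using X.add_mem X.scale_mem lact_mem by auto
  have 3: "bounded_linear_map ?X op_algebra (orbit_t n \<sigma> v)"
    unfolding bounded_linear_map_def
  proof (intro conjI ballI allI)
    show "orbit_t n \<sigma> v ` vec ?X \<subseteq> vec op_algebra"
      using ot(3) adjointableI by fastforce
    \<comment> \<open>The crude factor n from the triangle inequality suffices, as any finite
      constant does here.\<close>
    show "\<exists>K. \<forall>x\<in>vec ?X. vnorm op_algebra (orbit_t n \<sigma> v x) \<le> K * vnorm ?X x"
      using ot(2) edge_norm[OF cc]
      by (intro exI[of _ "real n"]) (simp del: dynamical_correspondence_simps(5,8))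
  next
    fix F G assume "F \<in> vec ?X" "G \<in> vec ?X"
    then show "orbit_t n \<sigma> v (vadd ?X F G) = vadd op_algebra (orbit_t n \<sigma> v F) (orbit_t n \<sigma> v G)"
      using XV(1)[of F G]
      by (intro op_ext) (auto simp: ot(1) blinfun.add_left algebra_simps split: list.split)
  next
    fix F c assume "F \<in> vec ?X"
    then show "orbit_t n \<sigma> v (vscale ?X c F) = vscale op_algebra c (orbit_t n \<sigma> v F)"
      using XV(2)[of F c] by (intro op_ext) (auto simp: ot(1) scaleC_op split: list.split)
  qed
  have 4: "orbit_pi \<sigma> v f o\<^sub>L orbit_t n \<sigma> v F = orbit_t n \<sigma> v (lact ?X f F)"
    if "f \<in> C0_functions \<Omega>" "F \<in> vec ?X" for f F
    using that XV(3)[of f F] by (intro op_ext) (auto simp: ot(1) opi(1) split: list.split)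
  have 5: "star_op (orbit_t n \<sigma> v F) o\<^sub>L orbit_t n \<sigma> v G = orbit_pi \<sigma> v (ainner ?X F G)"
    if F: "F \<in> vec ?X" and G: "G \<in> vec ?X" for F G
  proof -
    obtain S where S: "adjoint_of (orbit_t n \<sigma> v F) S"
      "\<And>y u. coord (blinfun_apply S y) u = (\<Sum>i=1..n. cnj (F (i, word_map \<sigma> u v)) * coord y (i # u))"
      using ot(3)[of F n \<sigma> v] F by auto
    have I: "(\<lambda>x. \<Sum>i=1..n. cnj (F (i, x)) * G (i, x)) \<in> C0_functions \<Omega>" using inner_mem[OF F G] by simp
    show ?thesis
      using G by (intro op_ext) (simp add: star_op_eq[OF S(1)] S(2) ot(1) opi(1)[OF I, unfolded One_nat_def] sum_distrib_right mult.assoc)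
  qed
  show ?thesis unfolding toeplitz_representation_def
    using cc cstar_op_algebra 2 3 4 5 by simp
qed

section \<open>Fourier coefficients\<close>

declare C0_simps [simp del] dynamical_correspondence_simps [simp del]

text \<open>A homomorphism into the copy, followed by the inverse of \<iota>, is one into the
  original algebra.\<close>

lemma (in copied_algebra) star_hom_uncopy:
  assumes "star_hom D C \<psi>"
  shows "\<exists>\<phi>. star_hom D A \<phi> \<and> (\<forall>x\<in>vec D. \<phi> x \<in> vec A \<and> \<psi> x = \<iota> (\<phi> x))"
proof -
  define \<phi> where "\<phi> x = inv_into (vec A) \<iota> (\<psi> x)" for x
  note psi = bounded_linear_mapD[OF star_homD(1)[OF assms]] star_homD(2,3)[OF assms]
  have m: "\<phi> x \<in> vec A \<and> \<psi> x = \<iota> (\<phi> x)" if "x \<in> vec D" for x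
    using psi(1)[OF that] unfolding \<phi>_def copy_simps(1) by (metis f_inv_into_f inv_into_into)
  have eq: "\<phi> x = y" if "x \<in> vec D" "y \<in> vec A" "\<psi> x = \<iota> y" for x y
    using m that copy_eq_iff by metis
  have bl: "bounded_linear_map D A \<phi>"
    unfolding bounded_linear_map_def
  proof (intro conjI ballI allI)
    show "\<phi> ` vec D \<subseteq> vec A" using m by blast
    obtain K where "\<forall>x\<in>vec D. vnorm C (\<psi> x) \<le> K * vnorm D x"
      using star_homD(1)[OF assms] unfolding bounded_linear_map_def by blast
    then show "\<exists>K. \<forall>x\<in>vec D. vnorm A (\<phi> x) \<le> K * vnorm D x"
      using m copy_simps(7) by (intro exI[of _ K]) metis
    fix x y c assume x: "x \<in> vec D"
    show "\<phi> (vscale D c x) = vscale A c (\<phi> x)"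
      unfolding \<phi>_def[of "vscale D c x"] psi(3)[OF x]
      using m[OF x] inj by (simp add: copy_simps scale_mem)
    assume y: "y \<in> vec D"
    show "\<phi> (vadd D x y) = vadd A (\<phi> x) (\<phi> y)"
      unfolding \<phi>_def[of "vadd D x y"] psi(2)[OF x y]
      using m[OF x] m[OF y] inj by (simp add: copy_simps add_mem)
  qed
  have "star_hom D A \<phi>"
    unfolding star_hom_def
  proof (intro conjI ballI bl)
    fix x y assume x: "x \<in> vec D"
    show "\<phi> (astar D x) = astar A (\<phi> x)"
      unfolding \<phi>_def[of "astar D x"] psi(5)[OF x]
      using m[OF x] inj by (simp add: copy_simps star_mem)
    assume y: "y \<in> vec D"
    show "\<phi> (amult D x y) = amult A (\<phi> x) (\<phi> y)"
      unfolding \<phi>_def[of "amult D x y"] psi(4)[OF x y]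
      using m[OF x] m[OF y] inj by (simp add: copy_simps mult_mem)
  qed
  then show ?thesis using m by blast
qed

text \<open>Words are countable, so a matrix is a sequence of complex numbers; each entry is
  disguised as a constant function in order to fit the type in which the universal property is
  tested.\<close>

definition op_matrix :: "nat list op \<Rightarrow> nat \<Rightarrow> ('v \<Rightarrow> complex) + 'x" where
  "op_matrix T m = Inl (\<lambda>_. case from_nat m of (u, w) \<Rightarrow> coord (blinfun_apply T (unit_vec u)) w)"

lemma inj_on_op_matrix: "inj_on op_matrix adjointable"
proof (rule inj_onI)
  fix S T assume S: "S \<in> adjointable" and T: "T \<in> adjointable"
    and eq: "op_matrix S = (op_matrix T :: nat \<Rightarrow> ('v \<Rightarrow> complex) + 'x)"
  show "S = T"
  proof (rule adjointable_matrix_ext[OF S T])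
    fix u w :: "nat list"
    have "op_matrix S (to_nat (u, w)) = (op_matrix T (to_nat (u, w)) :: ('v \<Rightarrow> complex) + 'x)" using eq by simp
    then show "coord (blinfun_apply S (unit_vec u)) w = coord (blinfun_apply T (unit_vec u)) w"
      unfolding op_matrix_def by (auto dest: fun_cong)
  qed
qed

section \<open>The universal C*-algebra, the tensor algebra inside it, and Fourier
  coefficients\<close>

locale tensor_setup =
  fixes \<Omega> :: "'v topology" and n :: nat and \<sigma> :: "nat \<Rightarrow> 'v \<Rightarrow> 'v"
    and B :: "'b staralg" and \<pi> :: "('v \<Rightarrow> complex) \<Rightarrow> 'b" and t :: "(nat \<times> 'v \<Rightarrow> complex) \<Rightarrow> 'b"
  assumes mds: "multivariable_dynamical_system \<Omega> n \<sigma>"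
    and univ: "universal_toeplitz_representation (C0 \<Omega>) (dynamical_correspondence \<Omega> n \<sigma>) B \<pi> t"
begin

abbreviation A where "A \<equiv> C0 \<Omega>"
abbreviation X where "X \<equiv> dynamical_correspondence \<Omega> n \<sigma>"
text \<open>The homomorphisms given by the universal property live on this C*-algebra, not on all of
  \<open>B\<close>. Contractivity and adjoints are argued here, since \<open>TA\<close> need not be
  closed under the involution.\<close>

definition CB where "CB = cstar_algebra_generated B (\<pi> ` vec A \<union> t ` vec X)"
definition TA where "TA = tensor_algebra A X B \<pi> t"

lemma toep: "toeplitz_representation A X B \<pi> t"
  using univ unfolding universal_toeplitz_representation_def by (rule conjunct1)

sublocale corr: cstar_correspondence A X
  using toep unfolding toeplitz_representation_def by (elim conjE)

sublocale B: cstar_algebra B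
  using toep unfolding toeplitz_representation_def by (elim conjE)

lemma pi_hom: "star_hom A B \<pi>" and t_map: "bounded_linear_map X B t"
  using toep unfolding toeplitz_representation_def by blast+

lemma pi_t: "\<lbrakk>f \<in> vec A; F \<in> vec X\<rbrakk> \<Longrightarrow> amult B (\<pi> f) (t F) = t (lact X f F)"
  and t_star_t: "\<lbrakk>F \<in> vec X; G \<in> vec X\<rbrakk> \<Longrightarrow> amult B (astar B (t F)) (t G) = \<pi> (ainner X F G)"
  using toep unfolding toeplitz_representation_def by (elim conjE, blast)+

lemmas pi_mem = bounded_linear_mapD(1)[OF star_homD(1)[OF pi_hom]]
  and pi_add = bounded_linear_mapD(2)[OF star_homD(1)[OF pi_hom]]
  and pi_scale = bounded_linear_mapD(3)[OF star_homD(1)[OF pi_hom]]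
  and pi_mult = star_homD(2)[OF pi_hom]
  and pi_star = star_homD(3)[OF pi_hom]
  and t_mem = bounded_linear_mapD(1)[OF t_map]
  and t_add = bounded_linear_mapD(2)[OF t_map]
  and t_scale = bounded_linear_mapD(3)[OF t_map]

lemma gens: "\<pi> ` vec A \<union> t ` vec X \<subseteq> vec B"
  using pi_mem t_mem by blast

lemma CB_closed: "closed_subalgebra B (vec CB)"
  unfolding CB_def cstar_algebra_generated_def staralg.simps cspace.simps calg.simps
  using B.closed_subalgebra_Inter[of "{D. closed_subalgebra B D \<and> astar B ` D \<subseteq> D \<and> \<pi> ` vec A \<union> t ` vec X \<subseteq> D}" "vec B"]
    B.closed_subalgebra_vec gens B.star_mem by (auto)

lemma CB_star: "x \<in> vec CB \<Longrightarrow> astar B x \<in> vec CB"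
  unfolding CB_def cstar_algebra_generated_def by auto

lemma gens_CB: "\<pi> ` vec A \<union> t ` vec X \<subseteq> vec CB"
  unfolding CB_def cstar_algebra_generated_def by auto

lemma CB_least: "closed_subalgebra B D \<Longrightarrow> astar B ` D \<subseteq> D \<Longrightarrow> \<pi> ` vec A \<union> t ` vec X \<subseteq> D \<Longrightarrow> vec CB \<subseteq> D"
  unfolding CB_def cstar_algebra_generated_def by auto

lemma CB_simps [simp]:
  "vzero CB = vzero B" "vadd CB = vadd B" "vscale CB = vscale B" "vnorm CB = vnorm B"
  "amult CB = amult B" "astar CB = astar B" "vminus CB = vminus B" "vconverges CB = vconverges B"
  unfolding CB_def cstar_algebra_generated_def by simp_all

lemma TA_simps [simp]:
  "vzero TA = vzero B" "vadd TA = vadd B" "vscale TA = vscale B" "vnorm TA = vnorm B"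
  "amult TA = amult B" "vminus TA = vminus B" "vconverges TA = vconverges B"
  unfolding TA_def tensor_algebra_def closed_algebra_generated_def by simp_all

lemma TA_closed: "closed_subalgebra B (vec TA)"
  unfolding TA_def tensor_algebra_def closed_algebra_generated_def
  using B.closed_subalgebra_Inter[of "{D. closed_subalgebra B D \<and> \<pi> ` vec A \<union> t ` vec X \<subseteq> D}" "vec B"]
    B.closed_subalgebra_vec gens by (auto)

lemma gens_TA: "\<pi> ` vec A \<union> t ` vec X \<subseteq> vec TA"
  unfolding TA_def tensor_algebra_def closed_algebra_generated_def by auto

lemma TA_least: "closed_subalgebra B D \<Longrightarrow> \<pi> ` vec A \<union> t ` vec X \<subseteq> D \<Longrightarrow> vec TA \<subseteq> D"
  unfolding TA_def tensor_algebra_def closed_algebra_generated_def by auto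

lemma TA_CB: "vec TA \<subseteq> vec CB"
  by (rule TA_least[OF CB_closed gens_CB])

lemma CB_cstar: "cstar_algebra CB"
proof -
  have eq: "CB = B\<lparr>vec := vec CB\<rparr>" unfolding CB_def cstar_algebra_generated_def by simp
  show ?thesis
    using CB_star by (subst eq) (intro B.closed_star_subalgebra_cstar[OF CB_closed], blast)
qed

sublocale CB: cstar_algebra CB by (rule CB_cstar)

lemma TA_banach: "complex_banach_algebra TA"
proof -
  have eq: "TA = B\<lparr>vec := vec TA\<rparr>" unfolding TA_def tensor_algebra_def closed_algebra_generated_def by simp
  show ?thesis by (subst eq) (rule B.closed_subalgebra_banach[OF TA_closed])
qed

sublocale TA: complex_banach_algebra TA by (rule TA_banach)

text \<open>Copy the target into the type of sequences, use the universal property there, and return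
  along the inverse of the copy.\<close>

lemma factor:
  fixes \<kappa> :: "'c \<Rightarrow> nat \<Rightarrow> ('v \<Rightarrow> complex) + (nat \<times> 'v \<Rightarrow> complex)" and C :: "('c, 'm) staralg_scheme"
  assumes rep: "toeplitz_representation A X C \<pi>' t'" and inj: "inj_on \<kappa> (vec C)"
  shows "\<exists>\<phi>. star_hom CB C \<phi> \<and> (\<forall>f\<in>vec A. \<phi> (\<pi> f) = \<pi>' f) \<and> (\<forall>F\<in>vec X. \<phi> (t F) = t' F)"
proof -
  interpret C: cstar_algebra C using rep unfolding toeplitz_representation_def by (elim conjE)
  interpret copied_algebra C \<kappa> by unfold_locales (rule inj)
  obtain \<psi> where psi: "star_hom CB (copy_algebra \<kappa> C) \<psi>"
    "\<forall>f\<in>vec A. \<psi> (\<pi> f) = (\<kappa> \<circ> \<pi>') f" "\<forall>F\<in>vec X. \<psi> (t F) = (\<kappa> \<circ> t') F"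
    using univ copy_toeplitz[OF rep] unfolding CB_def universal_toeplitz_representation_def by metis
  obtain \<phi> where phi: "star_hom CB C \<phi>" "\<forall>x\<in>vec CB. \<phi> x \<in> vec C \<and> \<psi> x = \<kappa> (\<phi> x)"
    using star_hom_uncopy[OF psi(1)] by (elim exE conjE)
  have P: "star_hom A C \<pi>'" and T: "bounded_linear_map X C t'"
    using rep unfolding toeplitz_representation_def by blast+
  have "\<phi> (\<pi> f) = \<pi>' f" if f: "f \<in> vec A" for f
  proof -
    have "\<pi> f \<in> vec CB" using gens_CB f by blast
    from bspec[OF phi(2) this] have "\<phi> (\<pi> f) \<in> vec C" "\<kappa> (\<phi> (\<pi> f)) = \<kappa> (\<pi>' f)"
      using bspec[OF psi(2) f] by simp_all
    then show ?thesis using copy_eq_iff bounded_linear_mapD(1)[OF star_homD(1)[OF P] f] by simp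
  qed
  moreover have "\<phi> (t F) = t' F" if F: "F \<in> vec X" for F
  proof -
    have "t F \<in> vec CB" using gens_CB F by blast
    from bspec[OF phi(2) this] have "\<phi> (t F) \<in> vec C" "\<kappa> (\<phi> (t F)) = \<kappa> (t' F)"
      using bspec[OF psi(3) F] by simp_all
    then show ?thesis using copy_eq_iff bounded_linear_mapD(1)[OF T F] by simp
  qed
  ultimately show ?thesis using phi(1) by blast
qed

definition rho :: "'v \<Rightarrow> 'b \<Rightarrow> nat list op" where
  "rho v = (SOME \<phi>. star_hom CB op_algebra \<phi> \<and> (\<forall>f\<in>vec A. \<phi> (\<pi> f) = orbit_pi \<sigma> v f)
    \<and> (\<forall>F\<in>vec X. \<phi> (t F) = orbit_t n \<sigma> v F))"

lemma rho: "star_hom CB op_algebra (rho v)" "f \<in> vec A \<Longrightarrow> rho v (\<pi> f) = orbit_pi \<sigma> v f"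
  "F \<in> vec X \<Longrightarrow> rho v (t F) = orbit_t n \<sigma> v F"
proof -
  have "\<exists>\<phi>. star_hom CB op_algebra \<phi> \<and> (\<forall>f\<in>vec A. \<phi> (\<pi> f) = orbit_pi \<sigma> v f)
    \<and> (\<forall>F\<in>vec X. \<phi> (t F) = orbit_t n \<sigma> v F)"
    by (rule factor[OF orbit_toeplitz[OF corr.cstar_correspondence_axioms], of op_matrix]) (simp add: inj_on_op_matrix)
  from someI_ex[OF this] show "star_hom CB op_algebra (rho v)" "f \<in> vec A \<Longrightarrow> rho v (\<pi> f) = orbit_pi \<sigma> v f"
    "F \<in> vec X \<Longrightarrow> rho v (t F) = orbit_t n \<sigma> v F"
    unfolding rho_def by blast+
qed

lemma rho_simps:
  "x \<in> vec CB \<Longrightarrow> rho v x \<in> adjointable"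
  "\<lbrakk>x \<in> vec CB; y \<in> vec CB\<rbrakk> \<Longrightarrow> rho v (vadd B x y) = rho v x + rho v y"
  "x \<in> vec CB \<Longrightarrow> rho v (vscale B c x) = scaleC_op c o\<^sub>L rho v x"
  "\<lbrakk>x \<in> vec CB; y \<in> vec CB\<rbrakk> \<Longrightarrow> rho v (amult B x y) = rho v x o\<^sub>L rho v y"
  "x \<in> vec CB \<Longrightarrow> rho v (astar B x) = star_op (rho v x)"
  "x \<in> vec CB \<Longrightarrow> norm (rho v x) \<le> vnorm B x"
  using bounded_linear_mapD[OF star_homD(1)[OF rho(1)]] star_homD(2,3)[OF rho(1)]
    star_hom_contractive[OF CB_cstar cstar_op_algebra rho(1)] by simp_all

text \<open>Formally \<open>a = (\<Sum>w. S\<^sub>w a\<^sub>w)\<close> with \<open>f S\<^sub>w = S\<^sub>w (f \<circ> \<sigma>\<^sub>w)\<close>, and \<open>cf v w a\<close> is \<open>a\<^sub>w v\<close>.\<close>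

definition cf :: "'v \<Rightarrow> nat list \<Rightarrow> 'b \<Rightarrow> complex" where
  "cf v w a = coord (blinfun_apply (rho v a) (unit_vec [])) w"

lemma cf_add: "\<lbrakk>x \<in> vec CB; y \<in> vec CB\<rbrakk> \<Longrightarrow> cf v w (vadd B x y) = cf v w x + cf v w y"
  and cf_scale: "x \<in> vec CB \<Longrightarrow> cf v w (vscale B c x) = c * cf v w x"
  unfolding cf_def by (simp_all add: rho_simps blinfun.add_left scaleC_op)

lemma cf_minus: "\<lbrakk>x \<in> vec CB; y \<in> vec CB\<rbrakk> \<Longrightarrow> cf v w (vminus B x y) = cf v w x - cf v w y"
  unfolding vminus_def using CB.scale_mem[of y "-1"] by (simp add: cf_add cf_scale)

lemma cf_zero: "cf v w (vzero B) = 0"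
  using cf_scale[of "vzero B" v w 0] CB.zero_mem CB.scale_zero_left[of "vzero B"] by simp

lemma cf_le: assumes "a \<in> vec CB" shows "cmod (cf v w a) \<le> vnorm B a"
proof -
  have "cmod (cf v w a) \<le> norm (blinfun_apply (rho v a) (unit_vec []))" unfolding cf_def by (rule cmod_coord_le)
  also have "\<dots> \<le> norm (rho v a) * norm (unit_vec [] :: nat list ell2)" by (rule norm_blinfun)
  also have "\<dots> \<le> vnorm B a" using rho_simps(6)[OF assms] by (simp add: norm_unit_vec)
  finally show ?thesis .
qed

lemma cf_pi: "f \<in> vec A \<Longrightarrow> cf v w (\<pi> f) = (if w = [] then f v else 0)"
  unfolding cf_def by (simp add: rho(2) C0_simps orbit_pi[where \<Omega> = \<Omega>] C0_simps(1) coord_unit_vec)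

lemma cf_t: "F \<in> vec X \<Longrightarrow> cf v w (t F) = (case w of [i] \<Rightarrow> F (i, v) | _ \<Rightarrow> 0)"
  unfolding cf_def
  by (auto simp: rho(3) orbit_t[where \<Omega> = \<Omega>] dynamical_correspondence_simps(1) coord_unit_vec split: list.split)

lemma cf_pi_mult: "\<lbrakk>f \<in> vec A; b \<in> vec CB\<rbrakk> \<Longrightarrow> cf v w (amult B (\<pi> f) b) = f (word_map \<sigma> w v) * cf v w b"
  unfolding cf_def using gens_CB
  by (subst rho_simps(4)) (auto simp: rho(2) orbit_pi[where \<Omega> = \<Omega>] C0_simps(1))

lemma cf_t_mult: "\<lbrakk>F \<in> vec X; b \<in> vec CB\<rbrakk> \<Longrightarrow> cf v w (amult B (t F) b)
    = (case w of [] \<Rightarrow> 0 | i # u \<Rightarrow> F (i, word_map \<sigma> u v) * cf v u b)"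
  unfolding cf_def using gens_CB
  by (subst rho_simps(4)) (auto simp: rho(3) orbit_t[where \<Omega> = \<Omega>] dynamical_correspondence_simps(1) split: list.split)

section \<open>Homogeneous elements\<close>

lemma CB_B: "x \<in> vec CB \<Longrightarrow> x \<in> vec B"
  by (rule B.closed_subalgebraD[OF CB_closed])

lemma TA_CB': "x \<in> vec TA \<Longrightarrow> x \<in> vec CB"
  using TA_CB by blast

lemma TA_B: "x \<in> vec TA \<Longrightarrow> x \<in> vec B"
  by (rule CB_B[OF TA_CB'])

lemma pi_TA: "f \<in> vec A \<Longrightarrow> \<pi> f \<in> vec TA"
  and t_TA: "F \<in> vec X \<Longrightarrow> t F \<in> vec TA"
  using gens_TA by blast+

lemmas TA_mem = TA.zero_mem[unfolded TA_simps] TA.add_mem[unfolded TA_simps] TA.scale_mem[unfolded TA_simps]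
  TA.mult_mem[unfolded TA_simps] TA.minus_mem[unfolded TA_simps] pi_TA t_TA

lemmas CB_mem = CB.zero_mem[unfolded CB_simps] CB.add_mem[unfolded CB_simps] CB.scale_mem[unfolded CB_simps]
  CB.mult_mem[unfolded CB_simps] CB.minus_mem[unfolded CB_simps] CB_star

text \<open>The algebraic part of degree k in the gauge grading, without closure. One product rule
  is enough: a factor from A on the left is absorbed into F by the left action, one on the right is
  pushed down to the innermost factor.\<close>

inductive homog :: "nat \<Rightarrow> 'b \<Rightarrow> bool" where
  homog_pi: "f \<in> vec A \<Longrightarrow> homog 0 (\<pi> f)"
| homog_t1: "F \<in> vec X \<Longrightarrow> homog (Suc 0) (t F)"
| homog_zero: "homog k (vzero B)"
| homog_add: "homog k p \<Longrightarrow> homog k q \<Longrightarrow> homog k (vadd B p q)"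
| homog_scale: "homog k p \<Longrightarrow> homog k (vscale B c p)"
| homog_t: "F \<in> vec X \<Longrightarrow> homog k q \<Longrightarrow> homog (Suc k) (amult B (t F) q)"

lemma edge_support: "F \<in> vec X \<Longrightarrow> F (i, x) \<noteq> 0 \<Longrightarrow> i \<in> {1..n}"
  using edge_function_zero[of F n \<Omega> i x] by (auto simp: dynamical_correspondence_simps(1))

lemma homog_TA: "homog k q \<Longrightarrow> q \<in> vec TA"
  by (induction rule: homog.induct) (auto intro: TA_mem)

lemmas homog_CB = TA_CB'[OF homog_TA] and homog_B = TA_B[OF homog_TA]

lemma homog_cf: "homog k q \<Longrightarrow> w \<notin> lists {1..n} \<or> length w \<noteq> k \<Longrightarrow> cf v w q = 0"
proof (induction arbitrary: w rule: homog.induct)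
  case (homog_t F k q)
  show ?case
  proof (cases w)
    case (Cons i u)
    show ?thesis
    proof (cases "i \<in> {1..n}")
      case True
      then show ?thesis using homog_t.prems homog_t.IH[of u] homog_t.hyps homog_CB
        by (simp add: cf_t_mult Cons)
    next
      case False
      then have "F (i, x) = 0" for x using homog_t.hyps(1) edge_support by blast
      then show ?thesis using homog_t.hyps homog_CB by (simp add: cf_t_mult Cons)
    qed
  qed (use homog_t.hyps homog_CB in \<open>simp add: cf_t_mult\<close>)
next
  case (homog_t1 F)
  then show ?case using edge_support[of F] by (auto simp: cf_t split: list.split)
qed (auto simp: cf_pi cf_zero cf_add cf_scale homog_CB)

lemma homog_pi_left: "homog k q \<Longrightarrow> f \<in> vec A \<Longrightarrow> homog k (amult B (\<pi> f) q)"
proof (induction rule: homog.induct)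
  case (homog_pi g)
  then show ?case using homog.homog_pi[OF corr.A.mult_mem[of f g]] by (simp add: pi_mult)
next
  case (homog_t1 F)
  then show ?case using homog.homog_t1[OF corr.lact_mem] by (simp add: pi_t)
next
  case (homog_t F k q)
  have "amult B (\<pi> f) (amult B (t F) q) = amult B (t (lact X f F)) q"
    using homog_t by (simp add: B.mult_assoc[symmetric] pi_mem t_mem homog_B pi_t)
  then show ?case using homog_t homog.homog_t[OF corr.lact_mem] by simp
qed (auto simp: B.mult_zero_right B.mult_add_right B.mult_scale_right pi_mem homog_B intro: homog.intros)

lemma homog_pi_right: "homog k q \<Longrightarrow> f \<in> vec A \<Longrightarrow> homog k (amult B q (\<pi> f))"
proof (induction rule: homog.induct)
  case (homog_pi g)
  then show ?case using homog.homog_pi[OF corr.A.mult_mem[of g f]] by (simp add: pi_mult)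
next
  case (homog_t1 F)
  then show ?case using homog.homog_t[OF _ homog.homog_pi] by simp
next
  case (homog_t F k q)
  then show ?case using homog.homog_t by (simp add: B.mult_assoc pi_mem t_mem homog_B)
qed (auto simp: B.mult_zero_left B.mult_add_left B.mult_scale_left pi_mem homog_B intro: homog.intros)

lemma homog_mult: "homog j p \<Longrightarrow> homog k q \<Longrightarrow> homog (j + k) (amult B p q)"
proof (induction rule: homog.induct)
  case (homog_pi g)
  then show ?case using homog_pi_left by simp
next
  case (homog_t1 F)
  then show ?case using homog.homog_t by simp
next
  case (homog_t F j p)
  then show ?case using homog.homog_t by (simp add: B.mult_assoc t_mem homog_B)
qed (auto simp: B.mult_zero_left B.mult_add_left B.mult_scale_left homog_B intro: homog.intros)

lemma homog_0: "homog k q \<Longrightarrow> k = 0 \<Longrightarrow> \<exists>g\<in>vec A. q = \<pi> g"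
proof (induction rule: homog.induct)
  case (homog_zero k)
  have "\<pi> (vzero A) = vzero B"
    by (rule bounded_linear_map_zero[OF star_homD(1)[OF pi_hom]]) unfold_locales
  then show ?case using corr.A.zero_mem by metis
next
  case (homog_add k p q)
  then show ?case using pi_add corr.A.add_mem by metis
next
  case (homog_scale k p c)
  then show ?case using pi_scale corr.A.scale_mem by metis
qed auto

lemma homog_t_star: "homog m q \<Longrightarrow> m = Suc k \<Longrightarrow> F \<in> vec X \<Longrightarrow> homog k (amult B (astar B (t F)) q)"
proof (induction rule: homog.induct)
  case (homog_t1 G)
  then show ?case using homog.homog_pi corr.inner_mem by (simp add: t_star_t)
next
  case (homog_t G k' q)
  have "amult B (astar B (t F)) (amult B (t G) q) = amult B (\<pi> (ainner X F G)) q"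
    using homog_t by (simp add: B.mult_assoc[symmetric] t_mem B.star_mem homog_B t_star_t)
  then show ?case using homog_t homog_pi_left corr.inner_mem by simp
qed (auto simp: B.mult_zero_right B.mult_add_right B.mult_scale_right t_mem B.star_mem homog_B intro: homog.intros)

text \<open>The inner product relation removes one creation factor of p together with one of q;
  equal degrees leave an element of A. Norms in one degree thereby become sup norms on
  \<Omega>.\<close>

lemma homog_star_mult: "homog k p \<Longrightarrow> homog k q \<Longrightarrow> \<exists>h\<in>vec A. amult B (astar B p) q = \<pi> h"
proof (induction arbitrary: q rule: homog.induct)
  case (homog_pi f)
  then obtain g where g: "g \<in> vec A" "q = \<pi> g" using homog_0 by blast
  have "amult B (astar B (\<pi> f)) q = \<pi> (amult A (astar A f) g)"
    using homog_pi g corr.A.star_mem by (simp add: pi_star pi_mult)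
  then show ?case using homog_pi g corr.A.star_mem corr.A.mult_mem by blast
next
  case (homog_t1 F)
  have "homog 0 (amult B (astar B (t F)) q)" using homog_t_star homog_t1 by blast
  then show ?case using homog_0[OF _ refl] by blast
next
  case (homog_zero k)
  have "amult B (astar B (vzero B)) q = vzero B"
    using homog_zero homog_B by (simp add: B.star_zero B.mult_zero_left)
  then show ?case using homog_0[OF homog.homog_zero refl] by simp
next
  case (homog_add k p p')
  obtain h h' where "h \<in> vec A" "amult B (astar B p) q = \<pi> h" "h' \<in> vec A" "amult B (astar B p') q = \<pi> h'"
    using homog_add by metis
  then show ?case using homog_add corr.A.add_mem[of h h'] pi_add[of h h']
    by (intro bexI[of _ "vadd A h h'"]) (simp_all add: B.star_add B.mult_add_left B.star_mem homog_B)
next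
  case (homog_scale k p c)
  obtain h where "h \<in> vec A" "amult B (astar B p) q = \<pi> h" using homog_scale by metis
  then show ?case using homog_scale corr.A.scale_mem[of h "cnj c"] pi_scale[of h "cnj c"]
    by (intro bexI[of _ "vscale A (cnj c) h"]) (simp_all add: B.star_scale B.mult_scale_left B.star_mem homog_B)
next
  case (homog_t F k p)
  have "homog k (amult B (astar B (t F)) q)" using homog_t_star homog_t by blast
  then obtain h where "h \<in> vec A" "amult B (astar B p) (amult B (astar B (t F)) q) = \<pi> h"
    using homog_t.IH by blast
  then show ?case using homog_t
    by (intro bexI[of _ h]) (simp_all add: B.star_mult B.mult_assoc B.star_mem t_mem homog_B)
qed

text \<open>By the C*-identity the square of the norm is that of \<open>\<pi> h\<close>, where
  \<open>h z\<close> is the sum of the squared moduli of the coefficients at z. At most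
  \<open>n ^ k\<close> words contribute, hence the factor.\<close>

lemma homog_norm_le:
  assumes q: "homog k q" and C: "\<And>z w. z \<in> topspace \<Omega> \<Longrightarrow> w \<in> lists {1..n} \<Longrightarrow> length w = k \<Longrightarrow> cmod (cf z w q) \<le> C"
    and C0: "C \<ge> 0"
  shows "vnorm B q \<le> sqrt (real n ^ k) * C"
proof -
  obtain h where h: "h \<in> vec A" "amult B (astar B q) q = \<pi> h" using homog_star_mult[OF q q] by blast
  let ?K = "sqrt (real n ^ k) * C"
  have "cmod (h z) \<le> ?K\<^sup>2" for z
  proof (cases "z \<in> topspace \<Omega>")
    case True
    define x where "x = blinfun_apply (rho z q) (unit_vec [])"
    have x: "coord x w = cf z w q" for w by (simp add: x_def cf_def)
    have "norm x \<le> ?K" unfolding norm_ell2_le_iff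
    proof (intro conjI allI impI)
      fix F :: "nat list set" assume F: "finite F"
      let ?W = "{w. set w \<subseteq> {1..n} \<and> length w = k}"
      have W: "finite ?W" "card ?W = n ^ k"
        using finite_lists_length_eq[of "{1..n}" k] card_lists_length_eq[of "{1..n}" k] by auto
      have "(\<Sum>w\<in>F. (cmod (coord x w))\<^sup>2) = (\<Sum>w\<in>F \<inter> ?W. (cmod (cf z w q))\<^sup>2)"
        using F by (intro sum.mono_neutral_cong_right) (auto simp: x intro!: homog_cf[OF q])
      also have "\<dots> \<le> (\<Sum>w\<in>?W. (cmod (cf z w q))\<^sup>2)"
        using W by (intro sum_mono2) auto
      also have "\<dots> \<le> (\<Sum>w\<in>?W. C\<^sup>2)"
        using C[OF True] by (intro sum_mono power_mono) auto
      also have "\<dots> = ?K\<^sup>2" using W by (simp add: power_mult_distrib)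
      finally show "l2norm (coord x) F \<le> ?K" unfolding L2_set_def using C0 by (simp add: real_le_lsqrt)
    qed (use C0 in simp)
    moreover have "h z = complex_of_real ((norm x)\<^sup>2)"
    proof -
      have "h z = cf z [] (amult B (astar B q) q)" using h by (simp add: cf_pi)
      also have "\<dots> = cinner (unit_vec []) (blinfun_apply (star_op (rho z q)) x)"
        unfolding cf_def using homog_CB[OF q] by (simp add: rho_simps CB_star x_def cinner_unit_vec)
      also have "\<dots> = cinner x x"
        using adjoint_ofD[OF adjointable_star[OF rho_simps(1)[OF homog_CB[OF q]]]] by (simp add: x_def)
      finally show ?thesis by (simp add: cinner_self)
    qed
    ultimately show ?thesis by (simp add: norm_power power_mono)
  next
    case False
    then have "h z = 0" using h(1) by (simp add: C0_simps(1) C0_functions_def)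
    then show ?thesis by simp
  qed
  then have "vnorm A h \<le> ?K\<^sup>2" by (rule C0_norm_le)
  moreover have "vnorm B (\<pi> h) \<le> vnorm A h"
    by (rule star_hom_contractive[OF corr.A.cstar_algebra_axioms B.cstar_algebra_axioms pi_hom h(1)])
  moreover have "(vnorm B q)\<^sup>2 = vnorm B (\<pi> h)" using B.cstar_identity[OF homog_B[OF q]] h(2) by simp
  ultimately have "(vnorm B q)\<^sup>2 \<le> ?K\<^sup>2" by linarith
  then show ?thesis by (rule power2_le_imp_le) (use C0 in simp)
qed

section \<open>Density of finite sums of homogeneous elements\<close>

inductive poly :: "'b \<Rightarrow> bool" where
  poly_homog: "homog k q \<Longrightarrow> poly q"
| poly_add: "poly p \<Longrightarrow> poly q \<Longrightarrow> poly (vadd B p q)"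

lemma poly_TA: "poly p \<Longrightarrow> p \<in> vec TA"
  by (induction rule: poly.induct) (auto intro: homog_TA TA_mem)

lemmas poly_CB = TA_CB'[OF poly_TA] and poly_B = TA_B[OF poly_TA]

lemma poly_scale: "poly p \<Longrightarrow> poly (vscale B c p)"
  by (induction rule: poly.induct) (auto simp: B.scale_add_right poly_B intro: poly.intros homog_scale)

lemma homog_mult_poly: "poly q \<Longrightarrow> homog k p \<Longrightarrow> poly (amult B p q)"
  by (induction rule: poly.induct) (auto simp: B.mult_add_right poly_B homog_B intro: poly.intros homog_mult)

lemma poly_mult: "poly p \<Longrightarrow> poly q \<Longrightarrow> poly (amult B p q)"
  by (induction rule: poly.induct) (auto simp: B.mult_add_left poly_B intro: poly.intros homog_mult_poly)

lemma TA_dense: "vec TA \<subseteq> vclosure B {p. poly p}"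
proof (rule TA_least)
  have P: "{p. poly p} \<subseteq> vec B" using poly_B by blast
  show "closed_subalgebra B (vclosure B {p. poly p})"
    using P by (intro B.closed_subalgebra_vclosure)
      (auto intro: poly_homog homog_zero poly_add poly_mult poly_scale)
  have "poly (\<pi> f)" if "f \<in> vec A" for f using that homog_pi poly_homog by blast
  moreover have "poly (t F)" if "F \<in> vec X" for F using that homog_t1 poly_homog by blast
  ultimately show "\<pi> ` vec A \<union> t ` vec X \<subseteq> vclosure B {p. poly p}"
    using B.vclosure_superset[OF P] by blast
qed

end

lemma continuous_map_complex_mult:
  fixes f g :: "'a \<Rightarrow> complex"
  assumes "continuous_map T euclidean f" "continuous_map T euclidean g"
  shows "continuous_map T euclidean (\<lambda>v. f v * g v)"
  using assms by (simp add: continuous_map_atin tendsto_mult)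

context tensor_setup
begin

lemma cf_tendsto:
  assumes "range s \<subseteq> vec CB" "a \<in> vec CB" "vconverges B s a"
  shows "(\<lambda>k. cf v w (s k)) \<longlonglongrightarrow> cf v w a"
proof (rule Lim_null_comparison[THEN LIM_zero_cancel])
  have s: "s k \<in> vec CB" for k using assms(1) by auto
  have "cmod (cf v w (s k) - cf v w a) \<le> vnorm B (vminus B (s k) a)" for k
    using cf_le[OF CB_mem(5)[OF s assms(2)], of v w k] by (simp add: cf_minus s assms(2))
  then show "eventually (\<lambda>k. cmod (cf v w (s k) - cf v w a) \<le> vnorm B (vminus B (s k) a)) sequentially"
    by (intro always_eventually allI)
  show "(\<lambda>k. vnorm B (vminus B (s k) a)) \<longlonglongrightarrow> 0" using assms(3) by (simp add: vconverges_def)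
qed

lemma poly_dense:
  assumes "a \<in> vec TA" "e > 0"
  obtains p where "poly p" "vnorm B (vminus B p a) < e"
proof -
  have "a \<in> vclosure B {p. poly p}" using TA_dense assms(1) by (rule subsetD)
  from vclosureD[OF this assms(2)] show ?thesis using that by auto
qed

lemma poly_sequence:
  assumes "a \<in> vec TA"
  obtains s where "\<And>k. poly (s k)" "vconverges B s a"
proof -
  have a: "a \<in> vclosure B {p. poly p}" using TA_dense assms(1) by (rule subsetD)
  obtain s where "range s \<subseteq> {p. poly p}" "vconverges B s a"
    by (rule B.vclosure_sequence[OF a]) (auto intro: poly_B)
  then show ?thesis using that[of s] by auto
qed

text \<open>The coefficient of a product, as a twisted convolution. The suffix of w is applied
  first: b is read at v along the suffix, and a at the point reached by it along the remaining
  prefix.\<close>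

definition conv :: "'v \<Rightarrow> nat list \<Rightarrow> 'b \<Rightarrow> 'b \<Rightarrow> complex" where
  "conv v w a b = (\<Sum>k\<le>length w. cf (word_map \<sigma> (drop k w) v) (take k w) a * cf v (drop k w) b)"

lemma conv_Nil: "conv v [] a b = cf v [] a * cf v [] b"
  by (simp add: conv_def)

lemma conv_Cons: "conv v (i # u) a b = cf (word_map \<sigma> (i # u) v) [] a * cf v (i # u) b
    + (\<Sum>k\<le>length u. cf (word_map \<sigma> (drop k u) v) (i # take k u) a * cf v (drop k u) b)"
  unfolding conv_def length_Cons by (subst sum.atMost_Suc_shift) simp

lemma sum_take_Nil: "(\<Sum>k\<le>length u. (if take k u = [] then f k else 0)) = f 0"
  for f :: "nat \<Rightarrow> complex"
proof -
  have "(\<Sum>k\<le>length u. (if take k u = [] then f k else 0)) = (\<Sum>k\<le>length u. (if k = 0 then f k else 0))"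
    by (intro sum.cong) auto
  then show ?thesis by simp
qed

lemma cf_homog_mult: "homog j a \<Longrightarrow> b \<in> vec CB \<Longrightarrow> cf v w (amult B a b) = conv v w a b"
proof (induction arbitrary: v w rule: homog.induct)
  case (homog_pi f)
  then show ?case
    by (cases w) (simp_all add: cf_pi_mult conv_Nil conv_Cons cf_pi)
next
  case (homog_t1 F)
  show ?case
  proof (cases w)
    case (Cons i u)
    have "(\<Sum>k\<le>length u. cf (word_map \<sigma> (drop k u) v) (i # take k u) (t F) * cf v (drop k u) b)
      = (\<Sum>k\<le>length u. (if take k u = [] then F (i, word_map \<sigma> (drop k u) v) * cf v (drop k u) b else 0))"
      using homog_t1 by (intro sum.cong) (auto simp: cf_t split: list.split)
    then show ?thesis using homog_t1
      by (simp only: Cons conv_Cons sum_take_Nil) (simp add: cf_t_mult cf_t)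
  qed (use homog_t1 in \<open>simp add: cf_t_mult conv_Nil cf_t\<close>)
next
  case (homog_zero k)
  then show ?case using CB_B by (simp add: conv_def B.mult_zero_left cf_zero)
next
  case (homog_add k p q)
  then show ?case
    by (simp add: B.mult_add_left homog_B CB_B cf_add CB_mem homog_CB conv_def distrib_right sum.distrib)
next
  case (homog_scale k p c)
  then show ?case
    by (simp add: B.mult_scale_left homog_B CB_B cf_scale CB_mem homog_CB conv_def mult.assoc sum_distrib_left)
next
  case (homog_t F k q)
  have "amult B (amult B (t F) q) b = amult B (t F) (amult B q b)"
    using homog_t by (simp add: B.mult_assoc t_mem homog_B CB_B)
  moreover have "amult B q b \<in> vec CB" using homog_t homog_CB CB_mem by blast
  ultimately show ?case using homog_t
    by (cases w) (simp_all add: cf_t_mult conv_Nil conv_Cons homog_CB conv_def[of v] sum_distrib_left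
        mult.assoc word_map_append[symmetric])
qed

lemma cf_poly_mult: "poly a \<Longrightarrow> b \<in> vec CB \<Longrightarrow> cf v w (amult B a b) = conv v w a b"
proof (induction rule: poly.induct)
  case (poly_add p q)
  then show ?case
    by (simp add: B.mult_add_left poly_B CB_B cf_add CB_mem poly_CB conv_def distrib_right sum.distrib)
qed (rule cf_homog_mult)

text \<open>For fixed w the convolution is a finite sum of coefficients of a, each of them Lipschitz
  in a by \<open>cf_le\<close>; so the formula passes from polynomials to norm limits in the left
  factor.\<close>

lemma cf_mult:
  assumes a: "a \<in> vec TA" and b: "b \<in> vec CB"
  shows "cf v w (amult B a b) = conv v w a b"
proof -
  obtain s where s: "\<And>k. poly (s k)" "vconverges B s a" using poly_sequence[OF a] by blast
  have s': "range s \<subseteq> vec CB" "range s \<subseteq> vec B" using s(1) poly_CB poly_B by blast+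
  have "(\<lambda>k. cf v w (amult B (s k) b)) \<longlonglongrightarrow> cf v w (amult B a b)"
  proof (rule cf_tendsto)
    show "vconverges B (\<lambda>k. amult B (s k) b) (amult B a b)"
      using s' s(2) a b TA_B CB_B by (intro B.vconverges_mult_right) auto
    show "amult B a b \<in> vec CB" using CB_mem(4)[OF TA_CB'[OF a] b] .
    show "range (\<lambda>k. amult B (s k) b) \<subseteq> vec CB" using s' CB_mem(4)[OF _ b] by blast
  qed
  moreover have "(\<lambda>k. conv v w (s k) b) \<longlonglongrightarrow> conv v w a b"
    unfolding conv_def by (intro tendsto_sum tendsto_mult_right cf_tendsto s' s(2) TA_CB'[OF a])
  ultimately show ?thesis using cf_poly_mult[OF s(1) b] by (simp add: LIMSEQ_unique)
qed

lemma cf_mult_pi: "\<lbrakk>a \<in> vec TA; g \<in> vec A\<rbrakk> \<Longrightarrow> cf v w (amult B a (\<pi> g)) = cf v w a * g v"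
proof -
  assume a: "a \<in> vec TA" and g: "g \<in> vec A"
  have "conv v w a (\<pi> g) = (\<Sum>k\<le>length w. (if k = length w then cf v w a * g v else 0))"
    unfolding conv_def using g by (intro sum.cong) (auto simp: cf_pi)
  then show ?thesis using cf_mult[OF a TA_CB'[OF pi_TA[OF g]]] by simp
qed

text \<open>Zero is homogeneous of every degree, so two decompositions can be padded to a common
  length and added degree by degree.\<close>

lemma poly_decompose: "poly a \<Longrightarrow> \<exists>p m. (\<forall>k. homog k (p k)) \<and> (\<forall>k\<ge>m. p k = vzero B) \<and> a = B.vsum p m"
proof (induction rule: poly.induct)
  case (poly_homog k q)
  define p where "p j = (if j = k then q else vzero B)" for j
  have e: "B.vsum p m = (if m > k then q else vzero B)" for m
    using poly_homog homog_B by (induction m) (auto simp: p_def B.add_zero B.zero_add B.zero_mem)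
  have "q = B.vsum p (Suc k)" by (subst e) simp
  moreover have "\<forall>j. homog j (p j)" using poly_homog homog_zero by (simp add: p_def)
  moreover have "\<forall>j\<ge>Suc k. p j = vzero B" by (simp add: p_def)
  ultimately show ?case by blast
next
  case (poly_add a b)
  have ext: "B.vsum p (m + d) = B.vsum p m" if "\<forall>k\<ge>m. p k = vzero B" "\<forall>k. homog k (p k)" for p m d
  proof -
    have "B.vsum p m \<in> vec B" using that(2) by (intro B.vsum_mem homog_B) blast
    then show ?thesis using that(1) by (induction d) (auto simp: B.add_zero)
  qed
  obtain p m q m' where p: "\<forall>k. homog k (p k)" "\<forall>k\<ge>m. p k = vzero B" "a = B.vsum p m"
    and q: "\<forall>k. homog k (q k)" "\<forall>k\<ge>m'. q k = vzero B" "b = B.vsum q m'" using poly_add by metis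
  define r where "r k = vadd B (p k) (q k)" for k
  have "vadd B a b = B.vsum r (m + m')"
    unfolding r_def using ext[OF p(2,1), of m'] ext[OF q(2,1), of m] p(1) q(1)
    by (subst B.vsum_add) (auto simp: p(3) q(3) add.commute intro: homog_B)
  moreover have "\<forall>k. homog k (r k)" using p q homog_add by (simp add: r_def)
  moreover have "\<forall>k\<ge>m + m'. r k = vzero B" using p q B.zero_mem by (simp add: r_def B.add_zero)
  ultimately show ?case by blast
qed

lemma cf_vsum: "(\<And>k. p k \<in> vec CB) \<Longrightarrow> cf v w (B.vsum p m) = (\<Sum>k<m. cf v w (p k)) \<and> B.vsum p m \<in> vec CB"
  by (induction m) (auto simp: cf_zero cf_add CB_mem)

lemma cf_vsum_homog:
  assumes "\<And>k. homog k (p k)"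
  shows "cf v w (B.vsum p m) = (if length w < m then cf v w (p (length w)) else 0)"
proof -
  have "cf v w (p k) = (if k = length w then cf v w (p (length w)) else 0)" for k
    using homog_cf[OF assms, of w k v] by auto
  then have "cf v w (B.vsum p m) = (\<Sum>k<m. if k = length w then cf v w (p (length w)) else 0)"
    using cf_vsum[of p v w m] homog_CB[OF assms] by simp
  then show ?thesis by simp
qed

lemma sigma_continuous: "i \<in> {1..n} \<Longrightarrow> continuous_map \<Omega> \<Omega> (\<sigma> i)"
  using mds unfolding multivariable_dynamical_system_def by blast

lemma word_map_continuous: "w \<in> lists {1..n} \<Longrightarrow> continuous_map \<Omega> \<Omega> (word_map \<sigma> w)"
proof (induction w)
  case Nil
  then show ?case by (simp add: word_map_def)
next
  case (Cons i w)
  then have "continuous_map \<Omega> \<Omega> (\<sigma> i \<circ> word_map \<sigma> w)"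
    using sigma_continuous by (intro continuous_map_compose) auto
  moreover have "word_map \<sigma> (i # w) = \<sigma> i \<circ> word_map \<sigma> w" by (intro ext) simp
  ultimately show ?case by (simp only:)
qed

lemma word_map_topspace: "w \<in> lists {1..n} \<Longrightarrow> v \<in> topspace \<Omega> \<Longrightarrow> word_map \<sigma> w v \<in> topspace \<Omega>"
  using continuous_map_image_subset_topspace[OF word_map_continuous] by blast

lemma A_continuous: "f \<in> vec A \<Longrightarrow> continuous_map \<Omega> euclidean f"
  by (simp add: C0_simps(1) C0_functions_def)

lemma edge_continuous:
  assumes "F \<in> vec X" "i \<in> {1..n}" "continuous_map \<Omega> \<Omega> g"
  shows "continuous_map \<Omega> euclidean (\<lambda>v. F (i, g v))"
proof -
  have "continuous_map (prod_topology (discrete_topology {1..n}) \<Omega>) euclidean F"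
    using assms(1) by (simp add: dynamical_correspondence_simps(1) C0_functions_def)
  moreover have "continuous_map \<Omega> (prod_topology (discrete_topology {1..n}) \<Omega>) (\<lambda>v. (i, g v))"
    using assms(2,3) by (simp add: continuous_map_pairwise o_def)
  ultimately have "continuous_map \<Omega> euclidean (F \<circ> (\<lambda>v. (i, g v)))" by (rule continuous_map_compose[rotated])
  then show ?thesis by (simp add: o_def)
qed

lemma homog_continuous: "homog k q \<Longrightarrow> w \<in> lists {1..n} \<Longrightarrow> continuous_map \<Omega> euclidean (\<lambda>v. cf v w q)"
proof (induction arbitrary: w rule: homog.induct)
  case (homog_pi f)
  then show ?case using A_continuous by (cases "w = []") (simp_all add: cf_pi)
next
  case (homog_t1 F)
  show ?case
  proof (cases "\<exists>i. w = [i]")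
    case True
    then obtain i where "w = [i]" by blast
    then show ?thesis using homog_t1 edge_continuous[of F i "\<lambda>x. x"] by (simp add: cf_t)
  next
    case False
    then have "cf v w (t F) = 0" for v using homog_t1 by (auto simp: cf_t split: list.split)
    then show ?thesis by simp
  qed
next
  case (homog_zero k)
  then show ?case by (simp add: cf_zero)
next
  case (homog_add k p q)
  then show ?case by (simp add: cf_add homog_CB continuous_map_add)
next
  case (homog_scale k p c)
  then show ?case
    using continuous_map_compose[of \<Omega> euclidean "\<lambda>v. cf v w p" euclidean "\<lambda>x. c * x"]
    by (simp add: cf_scale homog_CB o_def continuous_intros)
next
  case (homog_t F k q)
  show ?case
  proof (cases w)
    case Nil
    then show ?thesis using homog_t by (simp add: cf_t_mult homog_CB)
  next
    case (Cons i u)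
    have "continuous_map \<Omega> euclidean (\<lambda>v. F (i, word_map \<sigma> u v))"
      using homog_t Cons by (intro edge_continuous word_map_continuous) auto
    moreover have "continuous_map \<Omega> euclidean (\<lambda>v. cf v u q)" using homog_t Cons by auto
    ultimately have "continuous_map \<Omega> euclidean (\<lambda>v. F (i, word_map \<sigma> u v) * cf v u q)"
      by (rule continuous_map_complex_mult)
    then show ?thesis using homog_t by (simp add: Cons cf_t_mult homog_CB)
  qed
qed

text \<open>Continuity in v is recorded for polynomials; other elements are treated later by norm
  approximation, which is uniform in v by \<open>cf_le\<close>.\<close>

lemma poly_continuous: "poly q \<Longrightarrow> w \<in> lists {1..n} \<Longrightarrow> continuous_map \<Omega> euclidean (\<lambda>v. cf v w q)"
  by (induction rule: poly.induct) (auto simp: cf_add poly_CB continuous_map_add intro: homog_continuous)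

end

section \<open>Gauge automorphisms\<close>

lemma sum_roots_of_unity:
  assumes "N > 0" "\<bar>x\<bar> < int N"
  shows "(\<Sum>j<N. cis (2 * pi * x / N) ^ j) = (if x = 0 then of_nat N else 0)"
proof (cases "x = 0")
  case False
  let ?e = "cis (2 * pi * x / N)"
  have "?e \<noteq> 1"
  proof
    assume "?e = 1"
    then have "cos (2 * pi * x / N) = 1" by (simp add: complex_eq_iff)
    then obtain k :: int where "2 * pi * x / N = real_of_int k * 2 * pi" using cos_one_2pi_int by blast
    then have "real_of_int x = real_of_int (k * int N)" using assms(1) by (simp add: field_simps)
    then have x: "x = k * int N" by linarith
    then have "k \<noteq> 0" using False by auto
    then have "\<bar>k\<bar> \<ge> 1" by simp
    then have "int N \<le> \<bar>k\<bar> * int N" using mult_right_mono[of 1 "\<bar>k\<bar>" "int N"] by simp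
    then show False using assms(2) x by (simp add: abs_mult)
  qed
  moreover have "?e ^ N = 1"
    using assms(1) by (simp add: Complex.DeMoivre cis_multiple_2pi)
  ultimately show ?thesis using False by (simp add: sum_gp_strict)
qed simp

text \<open>Fejer's kernel, evaluated at roots of unity.\<close>

lemma fejer_weights:
  assumes "M > 0"
  obtains N :: nat and l :: "nat \<Rightarrow> real" and z :: "nat \<Rightarrow> complex"
  where "\<And>j. cmod (z j) = 1" "\<And>j. l j \<ge> 0" "(\<Sum>j<N. l j) = 1"
    "\<And>d. d < m \<Longrightarrow> (\<Sum>j<N. complex_of_real (l j) * z j ^ d) = complex_of_real (real (M - d) / real M)"
proof -
  \<comment> \<open>The frequencies that occur are \<open>k + d - i\<close> with k, i < M and d < m.
    Their modulus stays below \<open>M + m\<close>, so averaging over N-th roots of unity detects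
    exactly the frequency 0.\<close>
  define N where "N = M + m"
  define e where "e x = cis (2 * pi * real_of_int x / real N)" for x :: int
  define z where "z j = e (int j)" for j
  define l where "l j = (cmod (\<Sum>k<M. z j ^ k))\<^sup>2 / (real M * real N)" for j
  have N: "N > 0" using assms by (simp add: N_def)
  have epow: "e x ^ k = e (int k * x)" for x k
    by (simp add: e_def Complex.DeMoivre algebra_simps)
  have emult: "e x * e y = e (x + y)" for x y
    by (simp add: e_def cis_mult add_divide_distrib distrib_left)
  have ecnj: "cnj (e x) = e (- x)" for x by (simp add: e_def cis_cnj)
  have esum: "(\<Sum>j<N. e (int j * x)) = (if x = 0 then of_nat N else 0)" if "\<bar>x\<bar> < int N" for x
    using sum_roots_of_unity[OF N that] by (simp add: epow[symmetric]) (simp add: e_def)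
  \<comment> \<open>The case d = 0 is kept even for m = 0, because it yields total weight 1.\<close>
  have main: "(\<Sum>j<N. complex_of_real (l j) * z j ^ d) = complex_of_real (real (M - d) / real M)"
    if d: "d < m \<or> d = 0" for d
  proof -
    have expand: "complex_of_real (l j) * z j ^ d * (of_nat M * of_nat N)
      = (\<Sum>k<M. \<Sum>i<M. e (int j * (int k + int d - int i)))" for j
    proof -
      have "complex_of_real (l j) * (of_nat M * of_nat N) = complex_of_real ((cmod (\<Sum>k<M. z j ^ k))\<^sup>2)"
        using assms N by (simp add: l_def)
      also have "\<dots> = (\<Sum>k<M. z j ^ k) * cnj (\<Sum>k<M. z j ^ k)" by (rule complex_norm_square)
      also have "\<dots> = (\<Sum>k<M. \<Sum>i<M. e (int j * (int k - int i)))"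
        by (simp add: sum_product z_def epow ecnj emult algebra_simps)
      finally have "complex_of_real (l j) * (of_nat M * of_nat N) * z j ^ d
        = (\<Sum>k<M. \<Sum>i<M. e (int j * (int k - int i)) * z j ^ d)" by (simp add: sum_distrib_right)
      then show ?thesis by (simp add: z_def epow emult algebra_simps)
    qed
    have "(\<Sum>j<N. complex_of_real (l j) * z j ^ d) * (of_nat M * of_nat N)
      = (\<Sum>j<N. \<Sum>k<M. \<Sum>i<M. e (int j * (int k + int d - int i)))"
      by (simp add: sum_distrib_right expand)
    also have "\<dots> = (\<Sum>k<M. \<Sum>j<N. \<Sum>i<M. e (int j * (int k + int d - int i)))" by (rule sum.swap)
    also have "\<dots> = (\<Sum>k<M. \<Sum>i<M. \<Sum>j<N. e (int j * (int k + int d - int i)))"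
      by (intro sum.cong refl sum.swap)
    also have "\<dots> = (\<Sum>k<M. \<Sum>i<M. if i = k + d then of_nat N else 0)"
    proof (intro sum.cong refl)
      fix k i assume "k \<in> {..<M}" "i \<in> {..<M}"
      then have "\<bar>int k + int d - int i\<bar> < int N" using d assms by (auto simp: N_def)
      then show "(\<Sum>j<N. e (int j * (int k + int d - int i))) = (if i = k + d then of_nat N else 0)"
        by (subst esum) auto
    qed
    also have "\<dots> = (\<Sum>k<M. if k + d < M then of_nat N else 0)" by (intro sum.cong) auto
    also have "\<dots> = (\<Sum>k<M - d. of_nat N)"
      by (intro sum.mono_neutral_cong_right) auto
    finally show ?thesis using assms N by (simp add: field_simps)
  qed
  show ?thesis
  proof (rule that)
    show "cmod (z j) = 1" for j by (simp add: z_def e_def)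
    show "l j \<ge> 0" for j by (simp add: l_def)
    show "(\<Sum>j<N. complex_of_real (l j) * z j ^ d) = complex_of_real (real (M - d) / real M)" if "d < m" for d
      using main that by blast
    have "complex_of_real (\<Sum>j<N. l j) = 1" using main[of 0] assms by simp
    then show "(\<Sum>j<N. l j) = 1" by (metis of_real_eq_1_iff)
  qed
qed

context tensor_setup
begin

text \<open>The universal property only provides homomorphisms into algebras with carrier in a fixed type of
  sequences. To obtain the gauge automorphisms, \<open>CB\<close> itself is embedded in that type: \<open>decode k\<close> evaluates
  codes of *-polynomials of depth at most \<open>k\<close>, and \<open>decode_seq\<close> codes of sequences of such polynomials.\<close>

definition label :: "('v \<Rightarrow> complex) + (nat \<times> 'v \<Rightarrow> complex) \<Rightarrow> complex" where
  "label s = (case s of Inl f \<Rightarrow> f undefined | Inr F \<Rightarrow> 0)"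

primrec decode :: "nat \<Rightarrow> (nat \<Rightarrow> ('v \<Rightarrow> complex) + (nat \<times> 'v \<Rightarrow> complex)) \<Rightarrow> 'b" where
  "decode 0 z = (case z 0 of Inl f \<Rightarrow> (if f \<in> vec A then \<pi> f else vzero B)
                           | Inr F \<Rightarrow> (if F \<in> vec X then t F else vzero B))"
| "decode (Suc k) z = (let x = decode k (\<lambda>m. z (2 * m + 2)); y = decode k (\<lambda>m. z (2 * m + 3)) in
     if label (z 0) = 0 then vadd B x y
     else if label (z 0) = 1 then amult B x y
     else if label (z 0) = 2 then vscale B (label (z 1)) x
     else if label (z 0) = 3 then astar B x
     else x)"

text \<open>Builds a code for the recursion of \<open>decode\<close>: cell 0 holds the operation,
  cell 1 a scalar, the remaining even and odd cells the two arguments. Tag 4 only raises the depth,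
  which allows two codes to be brought to equal depth.\<close>

definition node where
  "node tag c z z' = (\<lambda>m. if m = 0 then Inl (\<lambda>_. tag) else if m = 1 then Inl (\<lambda>_. c)
     else if even m then z ((m - 2) div 2) else z' ((m - 3) div 2))"

lemma node_simps: "label (node tag c z z' 0) = tag" "label (node tag c z z' (Suc 0)) = c"
  "(\<lambda>m. node tag c z z' (2 * m + 2)) = z" "(\<lambda>m. node tag c z z' (2 * m + 3)) = z'"
  by (auto simp: node_def label_def)

lemma decode_node:
  "decode (Suc k) (node 0 c z z') = vadd B (decode k z) (decode k z')"
  "decode (Suc k) (node 1 c z z') = amult B (decode k z) (decode k z')"
  "decode (Suc k) (node 2 c z z') = vscale B c (decode k z)"
  "decode (Suc k) (node 3 c z z') = astar B (decode k z)"
  "decode (Suc k) (node 4 c z z') = decode k z"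
  by (simp_all only: decode.simps node_simps One_nat_def Let_def) simp_all

definition decoded :: "'b set" where
  "decoded = (\<Union>k. range (decode k))"

lemma decode_B: "decode k z \<in> vec B"
proof (induction k arbitrary: z)
  case 0
  then show ?case using pi_mem t_mem B.zero_mem by (auto split: sum.split)
qed (auto simp: Let_def B.add_mem B.mult_mem B.scale_mem B.star_mem)

lemma decode_lift: "\<exists>z'. decode (k + d) z' = decode k z"
proof (induction d)
  case (Suc d)
  then show ?case using decode_node(5) by (metis add_Suc_right)
qed auto

lemma decoded_common:
  assumes "x \<in> decoded" "y \<in> decoded"
  obtains k z z' where "x = decode k z" "y = decode k z'"
proof -
  obtain k z j z' where "x = decode k z" "y = decode j z'" using assms unfolding decoded_def by blast
  then show ?thesis using decode_lift[of k j z] decode_lift[of j k z'] that by (metis add.commute)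
qed

lemma decodedI: "decode k z \<in> decoded"
  unfolding decoded_def by blast

lemma CB_decoded: "vec CB \<subseteq> vclosure B decoded"
proof (rule CB_least)
  have sub: "decoded \<subseteq> vec B" unfolding decoded_def using decode_B by blast
  have pi: "\<pi> f \<in> decoded" if "f \<in> vec A" for f
    using that decodedI[of 0 "\<lambda>_. Inl f"] by simp
  have t: "t F \<in> decoded" if "F \<in> vec X" for F
    using that decodedI[of 0 "\<lambda>_. Inr F"] by simp
  have star: "astar B x \<in> decoded" if "x \<in> decoded" for x
    using that decoded_common[OF that that] decode_node(4) decodedI by metis
  have scale: "vscale B c x \<in> decoded" if "x \<in> decoded" for c x
    using that decoded_common[OF that that] decode_node(3) decodedI by metis
  have zero: "vzero B \<in> decoded"
    using decodedI[of "Suc 0" "node 2 0 undefined undefined"] B.scale_zero_left[OF decode_B]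
    by (simp only: decode_node)
  show "closed_subalgebra B (vclosure B decoded)"
  proof (rule B.closed_subalgebra_vclosure[OF sub zero _ _ scale])
    fix x y assume "x \<in> decoded" "y \<in> decoded"
    then obtain k z z' where "x = decode k z" "y = decode k z'" by (rule decoded_common)
    then show "vadd B x y \<in> decoded" "amult B x y \<in> decoded"
      using decode_node(1,2)[of k undefined z z'] decodedI by metis+
  qed
  show "astar B ` vclosure B decoded \<subseteq> vclosure B decoded"
    using B.vclosure_star[OF sub star] by blast
  show "\<pi> ` vec A \<union> t ` vec X \<subseteq> vclosure B decoded"
    using pi t B.vclosure_superset[OF sub] by blast
qed

text \<open>The pairing function arranges a code in rows. Row m stores the depth of the m-th term in
  column 0 and its code, shifted by one, in the other columns; the depth is recovered because
  \<open>of_nat\<close> is injective.\<close>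

definition decode_seq :: "(nat \<Rightarrow> ('v \<Rightarrow> complex) + (nat \<times> 'v \<Rightarrow> complex)) \<Rightarrow> nat \<Rightarrow> 'b" where
  "decode_seq z m = decode (SOME k. complex_of_nat k = label (z (prod_encode (m, 0))))
     (\<lambda>j. z (prod_encode (m, Suc j)))"

text \<open>Each element receives a code of a sequence of *-polynomials in the generators that
  converges to it; uniqueness of limits makes the choice of codes injective.\<close>

lemma CB_embedding: "\<exists>\<iota> :: 'b \<Rightarrow> nat \<Rightarrow> ('v \<Rightarrow> complex) + (nat \<times> 'v \<Rightarrow> complex). inj_on \<iota> (vec CB)"
proof -
  have sub: "decoded \<subseteq> vec B" unfolding decoded_def using decode_B by blast
  have "\<exists>z. vconverges B (decode_seq z) x" if x: "x \<in> vec CB" for x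
  proof -
    have "x \<in> vclosure B decoded" using CB_decoded x by blast
    then obtain s where s: "range s \<subseteq> decoded" "vconverges B s x" using B.vclosure_sequence sub by metis
    have "\<forall>m. \<exists>k z. s m = decode k z" using s(1) unfolding decoded_def by blast
    then obtain k z where kz: "\<And>m. s m = decode (k m) (z m)" by metis
    define c where "c p = (case prod_decode p of (m, j) \<Rightarrow>
      if j = 0 then Inl (\<lambda>_. complex_of_nat (k m)) else z m (j - 1))" for p
    have "decode_seq c m = s m" for m
      unfolding decode_seq_def kz by (simp add: c_def label_def)
    then have "decode_seq c = s" by blast
    then show ?thesis using s(2) by blast
  qed
  then have "\<forall>x\<in>vec CB. \<exists>z. vconverges B (decode_seq z) x" by blast
  then obtain \<iota> where i: "\<And>x. x \<in> vec CB \<Longrightarrow> vconverges B (decode_seq (\<iota> x)) x" by metis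
  have "inj_on \<iota> (vec CB)"
  proof (rule inj_onI)
    fix x y assume "x \<in> vec CB" "y \<in> vec CB" "\<iota> x = \<iota> y"
    then show "x = y" using i[of x] i[of y] CB_B decode_B
      by (intro B.limit_unique[of "decode_seq (\<iota> x)"]) (auto simp: decode_seq_def)
  qed
  then show ?thesis by blast
qed

text \<open>Multiplying t by a scalar of modulus one preserves both Toeplitz relations. With
  \<open>CB\<close> coded by sequences, the universal property then gives a homomorphism of
  \<open>CB\<close> into itself; its contractivity is what the averaging uses.\<close>

lemma gauge:
  assumes z: "cmod z = 1"
  obtains \<phi> where "star_hom CB CB \<phi>" "\<And>k q. homog k q \<Longrightarrow> \<phi> q = vscale B (z ^ k) q"
proof -
  obtain \<iota> :: "'b \<Rightarrow> nat \<Rightarrow> ('v \<Rightarrow> complex) + (nat \<times> 'v \<Rightarrow> complex)" where i: "inj_on \<iota> (vec CB)"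
    using CB_embedding by blast
  have zz: "cnj z * z = 1" using z by (metis complex_norm_square mult.commute of_real_1 one_power2)
  have tCB: "t F \<in> vec CB" if "F \<in> vec X" for F using TA_CB' t_TA that by blast
  have piCB: "\<pi> f \<in> vec CB" if "f \<in> vec A" for f using TA_CB' pi_TA that by blast
  have "toeplitz_representation A X CB \<pi> (\<lambda>F. vscale B z (t F))"
    unfolding toeplitz_representation_def
  proof (intro conjI ballI)
    show "cstar_correspondence A X" "cstar_algebra CB" by unfold_locales
    show "star_hom A CB \<pi>"
      using pi_hom piCB unfolding star_hom_def bounded_linear_map_def by (simp add: image_subset_iff)
    obtain K where "\<forall>F\<in>vec X. vnorm B (t F) \<le> K * vnorm X F" using t_map unfolding bounded_linear_map_def by blast
    then have "\<forall>F\<in>vec X. vnorm B (vscale B z (t F)) \<le> K * vnorm X F" by (simp add: B.norm_scale t_mem z)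
    then show "bounded_linear_map X CB (\<lambda>F. vscale B z (t F))"
      using tCB unfolding bounded_linear_map_def
      by (auto simp: CB_mem t_add t_scale B.scale_add_right B.scale_scale t_mem mult.commute)
    fix F assume F: "F \<in> vec X"
    show "amult CB (\<pi> a) (vscale B z (t F)) = vscale B z (t (lact X a F))" if "a \<in> vec A" for a
      using that F by (simp add: B.mult_scale_right pi_mem t_mem pi_t)
    show "amult CB (astar CB (vscale B z (t F))) (vscale B z (t G)) = \<pi> (ainner X F G)" if "G \<in> vec X" for G
      using that F zz by (simp add: B.mult_scale_right B.mult_scale_left B.star_scale B.scale_scale
          B.scale_mem B.star_mem B.mult_mem t_mem t_star_t B.scale_one pi_mem corr.inner_mem mult.commute)
  qed
  from factor[OF this i] obtain \<phi> where phi: "star_hom CB CB \<phi>" "\<forall>f\<in>vec A. \<phi> (\<pi> f) = \<pi> f"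
    "\<forall>F\<in>vec X. \<phi> (t F) = vscale B z (t F)" by blast
  note p = bounded_linear_mapD(2,3)[OF star_homD(1)[OF phi(1)], unfolded CB_simps] star_homD(2)[OF phi(1), unfolded CB_simps]
  have zero: "\<phi> (vzero B) = vzero B"
    using bounded_linear_map_zero[OF star_homD(1)[OF phi(1)] CB.complex_banach_space_axioms CB.complex_banach_space_axioms]
    by simp
  have "\<phi> q = vscale B (z ^ k) q" if "homog k q" for k q
    using that
  proof (induction rule: homog.induct)
    case (homog_t F k q)
    have "\<phi> (amult B (t F) q) = amult B (vscale B z (t F)) (vscale B (z ^ k) q)"
      using homog_t phi(3) p(3)[OF tCB homog_CB] by simp
    also have "\<dots> = vscale B (z ^ Suc k) (amult B (t F) q)"
      using homog_t homog_B by (simp add: B.mult_scale_left B.mult_scale_right B.scale_scale B.scale_mem B.mult_mem t_mem mult.commute)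
    finally show ?case .
  qed (use phi(2,3) homog_CB homog_B in \<open>simp_all add: p zero B.scale_one pi_mem B.scale_zero_right B.scale_add_right
      B.scale_scale mult.commute\<close>)
  then show ?thesis using that phi(1) by blast
qed

section \<open>Fourier multipliers, Fejer means and separation by coefficients\<close>

definition weighted :: "(nat \<Rightarrow> 'b) \<Rightarrow> nat \<Rightarrow> (nat \<Rightarrow> complex) \<Rightarrow> 'b" where
  "weighted p m \<alpha> = B.vsum (\<lambda>k. vscale B (\<alpha> k) (p k)) m"

lemma weighted_B: "(\<And>k. homog k (p k)) \<Longrightarrow> weighted p m \<alpha> \<in> vec B"
  unfolding weighted_def by (intro B.vsum_mem B.scale_mem homog_B)

lemma weighted_add:
  assumes "\<And>k. homog k (p k)"
  shows "weighted p m (\<lambda>k. \<alpha> k + \<beta> k) = vadd B (weighted p m \<alpha>) (weighted p m \<beta>)"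
  unfolding weighted_def
  by (simp add: B.vsum_add[symmetric] B.scale_add_left B.scale_mem homog_B[OF assms])

lemma weighted_scale:
  assumes "\<And>k. homog k (p k)"
  shows "weighted p m (\<lambda>k. c * \<alpha> k) = vscale B c (weighted p m \<alpha>)"
  unfolding weighted_def
  by (simp add: B.vsum_scale[symmetric] B.scale_scale B.scale_mem homog_B[OF assms])

lemma weighted_one:
  assumes "\<And>k. homog k (p k)"
  shows "weighted p m (\<lambda>k. 1) = B.vsum p m"
  unfolding weighted_def by (simp add: B.scale_one homog_B[OF assms])

lemma norm_weighted_gauge:
  assumes p: "\<And>k. homog k (p k)" and z: "cmod z = 1"
  shows "vnorm B (weighted p m (\<lambda>k. z ^ k)) \<le> vnorm B (B.vsum p m)"
proof -
  obtain \<phi> where phi: "star_hom CB CB \<phi>" "\<And>k q. homog k q \<Longrightarrow> \<phi> q = vscale B (z ^ k) q"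
    using gauge[OF z] by blast
  note h = bounded_linear_mapD(2)[OF star_homD(1)[OF phi(1)], unfolded CB_simps]
  have "\<phi> (B.vsum p m) = weighted p m (\<lambda>k. z ^ k) \<and> B.vsum p m \<in> vec CB"
  proof (induction m)
    case 0
    then show ?case using phi(2)[OF homog_zero[of 0]] B.scale_one[OF B.zero_mem]
      by (simp add: weighted_def CB_mem)
  next
    case (Suc m)
    then show ?case using h[of "B.vsum p m" "p m"] phi(2)[OF p] homog_CB[OF p]
      by (simp add: weighted_def CB_mem)
  qed
  then show ?thesis using star_hom_contractive[OF CB_cstar CB_cstar phi(1), of "B.vsum p m"] by simp
qed

lemma norm_weighted_average:
  fixes N :: nat and z :: "nat \<Rightarrow> complex"
  assumes p: "\<And>k. homog k (p k)" and z: "\<And>j. cmod (z j) = 1" and l: "\<And>j. l j \<ge> 0"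
  shows "vnorm B (weighted p m (\<lambda>k. \<Sum>j<N. complex_of_real (l j) * z j ^ k))
    \<le> (\<Sum>j<N. l j) * vnorm B (B.vsum p m)"
proof (induction N)
  case 0
  have "weighted p m (\<lambda>k. 0) = vzero B"
    using weighted_scale[OF p, of m 0 "\<lambda>k. 1"] B.scale_zero_left[OF weighted_B[OF p]] by simp
  then show ?case by (simp add: B.norm_zero)
next
  case (Suc N)
  let ?\<alpha> = "\<lambda>k. \<Sum>j<N. complex_of_real (l j) * z j ^ k"
  have "weighted p m (\<lambda>k. \<Sum>j<Suc N. complex_of_real (l j) * z j ^ k)
    = vadd B (weighted p m ?\<alpha>) (vscale B (l N) (weighted p m (\<lambda>k. z N ^ k)))"
    using weighted_add[OF p, of m ?\<alpha>] weighted_scale[OF p] by simp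
  then have "vnorm B (weighted p m (\<lambda>k. \<Sum>j<Suc N. complex_of_real (l j) * z j ^ k))
    \<le> vnorm B (weighted p m ?\<alpha>) + vnorm B (vscale B (l N) (weighted p m (\<lambda>k. z N ^ k)))"
    by (simp only:) (intro B.norm_triangle B.scale_mem weighted_B p)
  then have "vnorm B (weighted p m (\<lambda>k. \<Sum>j<Suc N. complex_of_real (l j) * z j ^ k))
    \<le> vnorm B (weighted p m ?\<alpha>) + l N * vnorm B (weighted p m (\<lambda>k. z N ^ k))"
    using B.norm_scale[OF weighted_B[OF p], of "l N"] l[of N] by simp
  also have "\<dots> \<le> (\<Sum>j<N. l j) * vnorm B (B.vsum p m) + l N * vnorm B (B.vsum p m)"
    using Suc norm_weighted_gauge[OF p z] l by (intro add_mono mult_left_mono) auto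
  finally show ?case by (simp add: distrib_right)
qed

text \<open>A Fejer mean is a convex combination of gauge rotations, none of which increases the
  norm. Subtraction of naturals makes the weight vanish from degree M on, so a norm-bounded
  operation removes all high degrees.\<close>

lemma norm_fejer:
  assumes "\<And>k. homog k (p k)" "M > 0"
  shows "vnorm B (weighted p m (\<lambda>k. complex_of_real (real (M - k) / real M))) \<le> vnorm B (B.vsum p m)"
proof -
  obtain N :: nat and l z where *: "\<And>j. cmod (z j) = 1" "\<And>j. l j \<ge> 0" "(\<Sum>j<N. l j) = 1"
    "\<And>d. d < m \<Longrightarrow> (\<Sum>j<N. complex_of_real (l j) * z j ^ d) = complex_of_real (real (M - d) / real M)"
    using fejer_weights[OF assms(2), of m] by metis
  have cong: "B.vsum f j = B.vsum g j" if "\<And>k. k < j \<Longrightarrow> f k = g k" for f g j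
    using that by (induction j) auto
  have "weighted p m (\<lambda>k. complex_of_real (real (M - k) / real M))
    = weighted p m (\<lambda>k. \<Sum>j<N. complex_of_real (l j) * z j ^ k)"
    unfolding weighted_def by (rule cong) (simp only: *(4))
  then show ?thesis using norm_weighted_average[where z=z and l=l and p=p and m=m and N=N, OF assms(1) *(1,2)] *(3) by simp
qed

lemma norm_weighted_le:
  assumes "\<And>k. homog k (p k)"
  shows "vnorm B (weighted p m \<alpha>) \<le> (\<Sum>k<m. cmod (\<alpha> k) * vnorm B (p k))"
  unfolding weighted_def
  using B.norm_vsum[of "\<lambda>k. vscale B (\<alpha> k) (p k)" m] B.scale_mem[OF homog_B[OF assms]] B.norm_scale[OF homog_B[OF assms]]
  by simp

lemma poly_decompose_many:
  assumes "poly a"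
  obtains p m where "\<And>k. homog k (p k)" "\<And>k. k \<ge> m \<Longrightarrow> p k = vzero B" "\<And>j. j \<ge> m \<Longrightarrow> a = B.vsum p j"
proof -
  obtain p m where p: "\<forall>k. homog k (p k)" "\<forall>k\<ge>m. p k = vzero B" "a = B.vsum p m"
    using poly_decompose[OF assms] by blast
  have "a = B.vsum p (m + d)" for d
    using p(2,3) B.add_zero[OF poly_B[OF assms]] by (induction d) auto
  then have "a = B.vsum p j" if "j \<ge> m" for j using that by (metis le_add_diff_inverse)
  then show ?thesis using that p by blast
qed

text \<open>The order of choices matters. A polynomial p0 near a is fixed, then M so large that the
  Fejer mean hardly changes p0, then a polynomial q0 that approximates a with an accuracy depending
  on M. The components of q0 below degree M have small coefficients, so its Fejer mean is small, and
  contractivity transfers this to p0.\<close>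

lemma cf_faithful:
  assumes a: "a \<in> vec TA" and zero: "\<And>v w. v \<in> topspace \<Omega> \<Longrightarrow> w \<in> lists {1..n} \<Longrightarrow> cf v w a = 0"
  shows "a = vzero B"
proof -
  have aB: "a \<in> vec B" by (rule TA_B[OF a])
  have small: "vnorm B a \<le> 5 * e" if e: "e > 0" for e :: real
  proof -
    obtain p0 where p0: "poly p0" "vnorm B (vminus B p0 a) < e" using poly_dense[OF a e] by blast
    obtain p m where p: "\<And>k. homog k (p k)" "\<And>k. k \<ge> m \<Longrightarrow> p k = vzero B" "\<And>j. j \<ge> m \<Longrightarrow> p0 = B.vsum p j"
      using poly_decompose_many[OF p0(1)] by blast
    define S where "S = (\<Sum>k<m. vnorm B (p k))"
    have S0: "S \<ge> 0" unfolding S_def by (intro sum_nonneg B.norm_nonneg homog_B[OF p(1)])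
    \<comment> \<open>For k < m the multiplier differs from 1 by at most \<open>m / M\<close>, so
      this M keeps the change of p0 below e.\<close>
    obtain M where M: "real m * S / e < real M" using reals_Archimedean2 by blast
    have Mpos: "M > 0"
    proof (rule ccontr)
      assume "\<not> M > 0"
      then show False using M S0 e by (simp add: not_less divide_less_0_iff mult_less_0_iff)
    qed
    \<comment> \<open>Total loss of \<open>homog_norm_le\<close> over the degrees that survive the
      Fejer mean. The summand 1 makes W at least 1, so that \<open>e / W\<close> is defined and no
      larger than e.\<close>
    define W where "W = 1 + (\<Sum>k<M. sqrt (real n ^ k))"
    have W: "W \<ge> 1" unfolding W_def by (simp add: sum_nonneg)
    then have eW: "e / W > 0" using e by simp
    obtain q0 where q0: "poly q0" "vnorm B (vminus B q0 a) < e / W" using poly_dense[OF a eW] by blast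
    obtain q m' where q: "\<And>k. homog k (q k)" "\<And>k. k \<ge> m' \<Longrightarrow> q k = vzero B" "\<And>j. j \<ge> m' \<Longrightarrow> q0 = B.vsum q j"
      using poly_decompose_many[OF q0(1)] by blast
    define J where "J = m + m' + M"
    define \<alpha> where "\<alpha> k = complex_of_real (real (M - k) / real M)" for k
    have \<alpha>1: "cmod (\<alpha> k) \<le> 1" "k \<ge> M \<Longrightarrow> \<alpha> k = 0" for k
      unfolding \<alpha>_def norm_of_real using Mpos by auto
    define r where "r k = vminus B (p k) (q k)" for k
    have r: "homog k (r k)" for k
      unfolding r_def vminus_def by (intro homog_add homog_scale p q)
    have "B.vsum p J = vadd B (B.vsum r J) (B.vsum q J)"
      by (subst B.vsum_add[symmetric]) (auto simp: r_def B.minus_add_cancel homog_B[OF p(1)] homog_B[OF q(1)]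
          intro: homog_B[OF r[unfolded r_def]] homog_B[OF q(1)])
    then have r0: "B.vsum r J = vminus B p0 q0"
      using p(3)[of J] q(3)[of J] B.add_minus_cancel[OF B.vsum_mem[OF homog_B[OF r]] B.vsum_mem[OF homog_B[OF q(1)]]]
      by (simp add: J_def)
    have \<alpha>: "\<alpha> = (\<lambda>k. complex_of_real (real (M - k) / real M))" by (rule ext) (rule \<alpha>_def)
    have FJ: "vnorm B (weighted r J \<alpha>) \<le> vnorm B (vminus B p0 q0)"
      unfolding \<alpha> r0[symmetric] by (rule norm_fejer[OF r Mpos])
    have "weighted p J \<alpha> = vadd B (weighted r J \<alpha>) (weighted q J \<alpha>)"
      unfolding weighted_def
      by (subst B.vsum_add[symmetric]) (auto simp: r_def B.scale_add_right[symmetric] B.minus_add_cancel homog_B[OF p(1)]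
          homog_B[OF q(1)] homog_B[OF r[unfolded r_def]] intro: B.scale_mem)
    then have F1: "vnorm B (weighted p J \<alpha>) \<le> vnorm B (vminus B p0 q0) + vnorm B (weighted q J \<alpha>)"
      using B.norm_triangle[OF weighted_B[OF r] weighted_B[OF q(1)], of J \<alpha> J \<alpha>] FJ by simp
    have eW': "e / W \<le> e" using W e by (simp add: divide_le_eq)
    have F2: "vnorm B (vminus B p0 q0) \<le> 2 * e"
      using B.norm_minus_triangle[OF poly_B[OF p0(1)] aB poly_B[OF q0(1)]] p0(2) q0(2) eW'
        B.norm_minus_commute[OF aB poly_B[OF q0(1)]] by linarith
    have qk: "vnorm B (q k) \<le> sqrt (real n ^ k) * (e / W)" for k
    proof (rule homog_norm_le[OF q(1)])
      fix v w assume v: "v \<in> topspace \<Omega>" "w \<in> lists {1..n}" "length w = k"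
      show "cmod (cf v w (q k)) \<le> e / W"
      proof (cases "k < J")
        case True
        have "cf v w (q k) = cf v w q0" using cf_vsum_homog[OF q(1), of v w J] q(3)[of J] True v(3) by (simp add: J_def)
        also have "\<dots> = cf v w (vminus B q0 a)"
          using zero[OF v(1,2)] by (simp add: cf_minus poly_CB[OF q0(1)] TA_CB'[OF a])
        finally show ?thesis
          using cf_le[OF CB_mem(5)[OF poly_CB[OF q0(1)] TA_CB'[OF a]], of v w] q0(2) by simp
      next
        case False
        then show ?thesis using q(2)[of k] eW by (simp add: J_def cf_zero)
      qed
    qed (use eW in simp)
    have "vnorm B (weighted q J \<alpha>) \<le> (\<Sum>k<J. cmod (\<alpha> k) * vnorm B (q k))" by (rule norm_weighted_le[OF q(1)])
    also have "\<dots> = (\<Sum>k<M. cmod (\<alpha> k) * vnorm B (q k))"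
      using \<alpha>1(2) by (intro sum.mono_neutral_right) (auto simp: J_def)
    also have "\<dots> \<le> (\<Sum>k<M. 1 * (sqrt (real n ^ k) * (e / W)))"
      using \<alpha>1(1) qk B.norm_nonneg[OF homog_B[OF q(1)]] by (intro sum_mono mult_mono) auto
    also have "\<dots> = (\<Sum>k<M. sqrt (real n ^ k)) * (e / W)" by (simp only: sum_distrib_right mult_1)
    also have "\<dots> = (W - 1) * (e / W)" by (simp add: W_def)
    also have "\<dots> \<le> e" using W e by (simp add: field_simps)
    finally have F3: "vnorm B (weighted q J \<alpha>) \<le> e" .
    have "p0 = weighted p J (\<lambda>k. (1 - \<alpha> k) + \<alpha> k)" using p(3)[of J] weighted_one[OF p(1), of J] by (simp add: J_def)
    then have "vnorm B p0 \<le> vnorm B (weighted p J (\<lambda>k. 1 - \<alpha> k)) + vnorm B (weighted p J \<alpha>)"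
      using weighted_add[OF p(1), of J "\<lambda>k. 1 - \<alpha> k" \<alpha>] B.norm_triangle[OF weighted_B[OF p(1)] weighted_B[OF p(1)]] by simp
    moreover have "vnorm B (weighted p J (\<lambda>k. 1 - \<alpha> k)) \<le> e"
    proof -
      have le: "cmod (1 - \<alpha> k) \<le> real m / real M" if "k < m" for k
      proof -
        have "1 - \<alpha> k = complex_of_real (1 - real (M - k) / real M)" by (simp add: \<alpha>_def)
        then have "cmod (1 - \<alpha> k) = \<bar>1 - real (M - k) / real M\<bar>" by (simp only: norm_of_real)
        also have "1 - real (M - k) / real M = (real M - real (M - k)) / real M"
          using Mpos by (simp add: diff_divide_distrib)
        also have "\<bar>(real M - real (M - k)) / real M\<bar> = (real M - real (M - k)) / real M" by simp
        also have "\<dots> \<le> real m / real M" using that by (intro divide_right_mono) auto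
        finally show ?thesis .
      qed
      have "vnorm B (weighted p J (\<lambda>k. 1 - \<alpha> k)) \<le> (\<Sum>k<J. cmod (1 - \<alpha> k) * vnorm B (p k))"
        by (rule norm_weighted_le[OF p(1)])
      also have "\<dots> = (\<Sum>k<m. cmod (1 - \<alpha> k) * vnorm B (p k))"
        using p(2) by (intro sum.mono_neutral_right) (auto simp: J_def B.norm_zero)
      also have "\<dots> \<le> (\<Sum>k<m. real m / real M * vnorm B (p k))"
        using le B.norm_nonneg[OF homog_B[OF p(1)]] by (intro sum_mono mult_right_mono) auto
      also have "\<dots> = real m / real M * S" by (simp only: S_def sum_distrib_left)
      also have "\<dots> \<le> e" using M Mpos e by (simp add: field_simps)
      finally show ?thesis .
    qed
    moreover have "vnorm B a \<le> vnorm B (vminus B p0 a) + vnorm B p0"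
      using B.norm_le_norm_minus[OF aB poly_B[OF p0(1)]] B.norm_minus_commute[OF aB poly_B[OF p0(1)]] by simp
    ultimately show ?thesis using F1 F2 F3 p0(2) by linarith
  qed
  have "vnorm B a \<le> 0"
  proof (rule field_le_epsilon)
    fix e :: real assume "e > 0"
    then show "vnorm B a \<le> 0 + e" using small[of "e/5"] by simp
  qed
  then show ?thesis using B.norm_eq_zero[OF aB] B.norm_nonneg[OF aB] by simp
qed

end

section \<open>Derivations and coefficient kernels\<close>

lemma derivationD:
  assumes "derivation T D"
  shows "bounded_linear_map T T D"
    and "\<lbrakk>x \<in> vec T; y \<in> vec T\<rbrakk> \<Longrightarrow> D (amult T x y) = vadd T (amult T (D x) y) (amult T x (D y))"
  using assms unfolding derivation_def by blast+

context tensor_setup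
begin

section \<open>Bump functions, coefficient kernels and cut-downs\<close>

lemma hausdorff: "Hausdorff_space \<Omega>" and loc_compact: "locally_compact_space \<Omega>"
  using mds unfolding multivariable_dynamical_system_def by blast+

text \<open>Locally compact Hausdorff spaces are completely regular. Cutting U down to its
  intersection with a neighbourhood inside a compact set makes the function vanish at
  infinity.\<close>

lemma bump:
  assumes U: "openin \<Omega> U" and x: "x \<in> U"
  obtains f where "f \<in> vec A" "f x = 1" "\<And>z. cmod (f z) \<le> 1" "\<And>z. z \<notin> U \<Longrightarrow> f z = 0"
proof -
  have xT: "x \<in> topspace \<Omega>" using openin_subset[OF U] x by blast
  obtain W K where WK: "openin \<Omega> W" "compactin \<Omega> K" "x \<in> W" "W \<subseteq> K"
    using loc_compact xT unfolding locally_compact_space_def by blast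
  define S where "S = topspace \<Omega> - (U \<inter> W)"
  have "closedin \<Omega> S" unfolding S_def using U WK(1) by blast
  moreover have "x \<in> topspace \<Omega> - S" using xT x WK(3) by (simp add: S_def)
  moreover have "completely_regular_space \<Omega>"
    using locally_compact_regular_imp_completely_regular_space loc_compact hausdorff by blast
  ultimately obtain g where g: "continuous_map \<Omega> (top_of_set {0..1}) g" "g x = 0" "g ` S \<subseteq> {1::real}"
    unfolding completely_regular_space_def by meson
  have gr: "continuous_map \<Omega> euclideanreal g" "\<And>z. z \<in> topspace \<Omega> \<Longrightarrow> 0 \<le> g z \<and> g z \<le> 1"
    using g(1) unfolding continuous_map_in_subtopology by auto
  define f where "f z = (if z \<in> topspace \<Omega> then complex_of_real (1 - g z) else 0)" for z
  have cont: "continuous_map \<Omega> euclidean f"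
  proof -
    have "continuous_map \<Omega> euclideanreal (\<lambda>z. 1 - g z)"
      using gr(1) by (intro continuous_map_diff) simp_all
    then have "continuous_map \<Omega> euclidean (complex_of_real \<circ> (\<lambda>z. 1 - g z))"
      by (rule continuous_map_compose) (simp add: continuous_on_of_real)
    then show ?thesis by (rule continuous_map_eq) (simp add: f_def)
  qed
  have off: "f z = 0" if "z \<notin> U \<inter> W" for z
    using that g(3) by (auto simp: f_def S_def image_subset_iff)
  have "compactin \<Omega> {z \<in> topspace \<Omega>. e \<le> cmod (f z)}" if e: "e > 0" for e
  proof (rule closed_compactin[OF WK(2)])
    show "{z \<in> topspace \<Omega>. e \<le> cmod (f z)} \<subseteq> K"
    proof
      fix z assume "z \<in> {z \<in> topspace \<Omega>. e \<le> cmod (f z)}"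
      then have "f z \<noteq> 0" using e by auto
      then show "z \<in> K" using off[of z] WK(4) by blast
    qed
    have "closedin \<Omega> {z \<in> topspace \<Omega>. f z \<in> {c. e \<le> cmod c}}"
      by (rule closedin_continuous_map_preimage[OF cont]) (simp add: closed_Collect_le continuous_intros)
    then show "closedin \<Omega> {z \<in> topspace \<Omega>. e \<le> cmod (f z)}" by simp
  qed
  then have "f \<in> vec A" unfolding C0_simps C0_functions_def using cont by (simp add: f_def)
  moreover have "f x = 1" using xT g(2) by (simp add: f_def)
  moreover have "cmod (f z) \<le> 1" for z
    using gr(2)[of z] by (simp add: f_def norm_of_real del: of_real_diff)
  moreover have "f z = 0" if "z \<notin> U" for z using that off by blast
  ultimately show ?thesis using that by blast
qed

lemma bump_finite:
  assumes "finite S" "x \<in> topspace \<Omega>"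
  obtains f where "f \<in> vec A" "f x = 1" "\<And>z. cmod (f z) \<le> 1" "\<And>z. z \<in> S \<Longrightarrow> z \<noteq> x \<Longrightarrow> f z = 0"
proof -
  have "closedin \<Omega> ((S - {x}) \<inter> topspace \<Omega>)"
    using assms(1) hausdorff Hausdorff_imp_t1_space t1_space_closedin_finite
    by (metis finite_Diff finite_Int inf_le2)
  then have "openin \<Omega> (topspace \<Omega> - ((S - {x}) \<inter> topspace \<Omega>))" by blast
  moreover have "x \<in> topspace \<Omega> - ((S - {x}) \<inter> topspace \<Omega>)" using assms(2) by blast
  ultimately obtain f where f: "f \<in> vec A" "f x = 1" "\<And>z. cmod (f z) \<le> 1"
    "\<And>z. z \<notin> topspace \<Omega> - ((S - {x}) \<inter> topspace \<Omega>) \<Longrightarrow> f z = 0"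
    using bump by metis
  show ?thesis
  proof (rule that[OF f(1-3)])
    fix z assume "z \<in> S" "z \<noteq> x"
    then show "f z = 0" by (intro f(4)) blast
  qed
qed

lemma pi_norm_le_1:
  assumes "f \<in> vec A" "\<And>z. cmod (f z) \<le> 1"
  shows "vnorm B (\<pi> f) \<le> 1"
  using star_hom_contractive[OF corr.A.cstar_algebra_axioms B.cstar_algebra_axioms pi_hom assms(1)]
    C0_norm_le[of f 1 \<Omega>, OF assms(2)] by linarith

text \<open>The bound is on the length of \<open>w @ u\<close>. Splitting w in \<open>conv\<close>
  moves letters from the word read to the word leading to the base point, so both factors of each
  term stay within the same bound; this makes the set an ideal.\<close>

definition coeff_kernel :: "'v \<Rightarrow> nat \<Rightarrow> 'b set" where
  "coeff_kernel v N = {a \<in> vec TA. \<forall>u\<in>lists {1..n}. \<forall>w\<in>lists {1..n}.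
     length u + length w \<le> N \<longrightarrow> cf (word_map \<sigma> u v) w a = 0}"

lemma lists_take_drop: "w \<in> lists S \<Longrightarrow> take k w \<in> lists S \<and> drop k w \<in> lists S"
  using set_take_subset[of k w] set_drop_subset[of k w] by auto

definition cut :: "('v \<Rightarrow> complex) \<Rightarrow> ('v \<Rightarrow> complex) \<Rightarrow> 'b \<Rightarrow> 'b" where
  "cut f g a = amult B (amult B (\<pi> f) a) (\<pi> g)"

lemma cut_TA: "\<lbrakk>f \<in> vec A; g \<in> vec A; a \<in> vec TA\<rbrakk> \<Longrightarrow> cut f g a \<in> vec TA"
  by (simp add: cut_def TA_mem)

lemma cut_homog: "\<lbrakk>f \<in> vec A; g \<in> vec A; homog k a\<rbrakk> \<Longrightarrow> homog k (cut f g a)"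
  unfolding cut_def by (intro homog_pi_left homog_pi_right)

lemma cut_add: "\<lbrakk>f \<in> vec A; g \<in> vec A; a \<in> vec TA; b \<in> vec TA\<rbrakk>
    \<Longrightarrow> cut f g (vadd B a b) = vadd B (cut f g a) (cut f g b)"
  by (simp add: cut_def B.mult_add_left B.mult_add_right TA_B pi_mem B.mult_mem)

lemma cut_zero: "\<lbrakk>f \<in> vec A; g \<in> vec A\<rbrakk> \<Longrightarrow> cut f g (vzero B) = vzero B"
  by (simp add: cut_def B.mult_zero_left B.mult_zero_right pi_mem)

lemma cf_cut: "\<lbrakk>f \<in> vec A; g \<in> vec A; a \<in> vec TA\<rbrakk>
    \<Longrightarrow> cf v w (cut f g a) = f (word_map \<sigma> w v) * cf v w a * g v"
  by (simp add: cut_def cf_mult_pi TA_mem cf_pi_mult TA_CB')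

lemma norm_cut:
  assumes "f \<in> vec A" "g \<in> vec A" "a \<in> vec TA" "\<And>z. cmod (f z) \<le> 1" "\<And>z. cmod (g z) \<le> 1"
  shows "vnorm B (cut f g a) \<le> vnorm B a"
proof -
  have "vnorm B (cut f g a) \<le> vnorm B (amult B (\<pi> f) a) * vnorm B (\<pi> g)"
    unfolding cut_def using assms by (intro B.norm_mult) (auto simp: pi_mem TA_B B.mult_mem)
  also have "\<dots> \<le> (vnorm B (\<pi> f) * vnorm B a) * 1"
    using assms by (intro mult_mono B.norm_mult pi_norm_le_1)
      (auto simp: pi_mem TA_B B.mult_mem B.norm_nonneg intro!: mult_nonneg_nonneg)
  also have "\<dots> \<le> 1 * vnorm B a"
    using mult_right_mono[OF pi_norm_le_1[OF assms(1,4)] B.norm_nonneg[OF TA_B[OF assms(3)]]] by simp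
  finally show ?thesis by simp
qed

section \<open>Invariance of the coefficient kernels under derivations\<close>

context
  fixes D :: "'b \<Rightarrow> 'b"
  assumes D: "derivation TA D"
begin

lemma D_mem: "x \<in> vec TA \<Longrightarrow> D x \<in> vec TA"
  and D_add: "\<lbrakk>x \<in> vec TA; y \<in> vec TA\<rbrakk> \<Longrightarrow> D (vadd B x y) = vadd B (D x) (D y)"
  and D_scale: "x \<in> vec TA \<Longrightarrow> D (vscale B c x) = vscale B c (D x)"
  and D_mult: "\<lbrakk>x \<in> vec TA; y \<in> vec TA\<rbrakk> \<Longrightarrow> D (amult B x y) = vadd B (amult B (D x) y) (amult B x (D y))"
  using bounded_linear_mapD[OF derivationD(1)[OF D]] derivationD(2)[OF D] by simp_all

lemma D_zero: "D (vzero B) = vzero B"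
  using bounded_linear_map_zero[OF derivationD(1)[OF D] TA.complex_banach_space_axioms TA.complex_banach_space_axioms]
  by simp

lemma cf_D_mult: "\<lbrakk>x \<in> vec TA; y \<in> vec TA\<rbrakk> \<Longrightarrow> cf v w (D (amult B x y)) = conv v w (D x) y + conv v w x (D y)"
  by (simp add: D_mult cf_add cf_mult D_mem TA_CB' TA_mem)

text \<open>The Leibniz rule differentiates one of k creation factors and leaves the other k - 1 in
  each term, so no word shorter than k - 1 appears in \<open>D q\<close>.\<close>

lemma cf_D_homog: "homog k q \<Longrightarrow> length w + 2 \<le> k \<Longrightarrow> cf v w (D q) = 0"
proof (induction arbitrary: v w rule: homog.induct)
  case (homog_zero k)
  then show ?case by (simp add: D_zero cf_zero)
next
  case (homog_add k p q)
  then show ?case using homog_TA by (simp add: D_add cf_add D_mem TA_CB')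
next
  case (homog_scale k p c)
  then show ?case using homog_TA by (simp add: D_scale cf_scale D_mem TA_CB')
next
  case (homog_t F k q)
  have q: "q \<in> vec TA" using homog_t homog_TA by blast
  have "conv v w (D (t F)) q = 0"
    unfolding conv_def
  proof (intro sum.neutral ballI)
    fix i assume "i \<in> {..length w}"
    have "cf v (drop i w) q = 0" using homog_t by (intro homog_cf) auto
    then show "cf (word_map \<sigma> (drop i w) v) (take i w) (D (t F)) * cf v (drop i w) q = 0" by simp
  qed
  moreover have "conv v w (t F) (D q) = cf v w (amult B (t F) (D q))"
    using homog_t q by (simp add: cf_mult TA_mem D_mem TA_CB')
  moreover have "cf v w (amult B (t F) (D q)) = 0"
    using homog_t q by (cases w) (simp_all add: cf_t_mult D_mem TA_CB')
  ultimately show ?case using homog_t q by (simp add: cf_D_mult TA_mem)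
qed simp_all

text \<open>The coefficient of \<open>D a\<close> at \<open>(x, u)\<close> only depends on \<open>f a g\<close>, where \<open>f = 1\<close> at \<open>y = \<sigma>\<^sub>u x\<close> and \<open>g = 1\<close> at \<open>x\<close>.
  As \<open>\<sigma>\<^sub>w x \<noteq> y\<close> for \<open>\<bar>w\<bar> \<noteq> \<bar>u\<bar>\<close>, small supports make the components of \<open>f a g\<close> of degree at most \<open>\<bar>u\<bar> + 1\<close> small;
  those of higher degree do not contribute by the Leibniz rule.\<close>

lemma derivation_coeff_kernel:
  assumes v: "v \<in> topspace \<Omega>" "v \<notin> Omega0 \<Omega> n \<sigma>" and a: "a \<in> coeff_kernel v N"
  shows "D a \<in> coeff_kernel v N"
proof -
  have aT: "a \<in> vec TA" using a by (simp add: coeff_kernel_def)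
  obtain K0 where K0: "\<And>x. x \<in> vec TA \<Longrightarrow> vnorm B (D x) \<le> K0 * vnorm B x"
    using derivationD(1)[OF D] unfolding bounded_linear_map_def TA_simps by meson
  \<comment> \<open>The constant in the definition of boundedness may be negative; a nonnegative one
    is needed to multiply estimates.\<close>
  define K where "K = max K0 0"
  have K: "K \<ge> 0" "\<And>x. x \<in> vec TA \<Longrightarrow> vnorm B (D x) \<le> K * vnorm B x"
    using K0 B.norm_nonneg[OF TA_B] unfolding K_def
    by (auto intro: order_trans[OF K0 mult_right_mono])
  have "cf (word_map \<sigma> u0 v) u (D a) = 0"
    if u0: "u0 \<in> lists {1..n}" and u: "u \<in> lists {1..n}" and len: "length u0 + length u \<le> N" for u0 u
  proof -
    define x where "x = word_map \<sigma> u0 v"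
    define y where "y = word_map \<sigma> u x"
    have xT: "x \<in> topspace \<Omega>" unfolding x_def using word_map_topspace u0 v by blast
    have yT: "y \<in> topspace \<Omega>" unfolding y_def using word_map_topspace u xT by blast
    have a0: "cf (word_map \<sigma> w' x) w a = 0"
      if "w \<in> lists {1..n}" "w' \<in> lists {1..n}" "length w + length w' \<le> length u" for w w'
    proof -
      have "word_map \<sigma> w' x = word_map \<sigma> (w' @ u0) v" by (simp add: x_def word_map_append)
      then show ?thesis using a that u0 len unfolding coeff_kernel_def by auto
    qed
    have a0': "cf x w a = 0" if "w \<in> lists {1..n}" "length w \<le> length u" for w
      using a0[of w "[]"] that by simp
    \<comment> \<open>Degrees from \<open>length u + 2\<close> on cannot reach the coefficient at u
      by \<open>cf_D_homog\<close>, so only these finitely many words have to be controlled.\<close>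
    define W where "W = {w. w \<in> lists {1..n} \<and> length w \<le> Suc (length u)}"
    have W: "finite W" unfolding W_def using finite_lists_length_le[of "{1..n}" "Suc (length u)"]
      by (simp add: lists_eq_set)
    \<comment> \<open>Here v outside \<open>Omega0\<close> enters: words of another length miss y,
      so a single f can be 1 at y and 0 at all endpoints of such words in W.\<close>
    have sep: "word_map \<sigma> w x \<noteq> y" if "w \<in> lists {1..n}" "length w \<noteq> length u" for w
    proof
      assume "word_map \<sigma> w x = y"
      then have "word_map \<sigma> (w @ u0) v = word_map \<sigma> (u @ u0) v" by (simp add: x_def y_def word_map_append)
      moreover have "w @ u0 \<in> lists {1..n}" "u @ u0 \<in> lists {1..n}" "length (w @ u0) \<noteq> length (u @ u0)"
        using that u u0 by auto
      ultimately have "v \<in> Omega0 \<Omega> n \<sigma>" using v(1) unfolding Omega0_def by blast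
      then show False using v(2) by blast
    qed
    obtain f where f: "f \<in> vec A" "f y = 1" "\<And>z. cmod (f z) \<le> 1"
      "\<And>z. z \<in> (\<lambda>w. word_map \<sigma> w x) ` W \<Longrightarrow> z \<noteq> y \<Longrightarrow> f z = 0"
      using bump_finite[of "(\<lambda>w. word_map \<sigma> w x) ` W" y] W yT by (metis finite_imageI)
    \<comment> \<open>The first summand pays for a - p, the others for the degrees up to
      \<open>length u + 1\<close> of p with coefficients at most \<open>2 * e\<close>. C is
      independent of e, although p and g are not.\<close>
    define C where "C = K + (\<Sum>k<length u + 2. K * (sqrt (real n ^ k) * 2))"
    have bound: "cmod (cf x u (D a)) \<le> C * e" if e: "e > 0" for e :: real
    proof -
      obtain p where p: "poly p" "vnorm B (vminus B p a) < e" using poly_dense[OF aT e] by blast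
      obtain q m where q: "\<And>k. homog k (q k)" "\<And>j. j \<ge> m \<Longrightarrow> p = B.vsum q j"
        using poly_decompose_many[OF p(1)] by metis
      define J where "J = m + length u + 2"
      have pJ: "p = B.vsum q J" using q(2)[of J] by (simp add: J_def)
      have pT: "p \<in> vec TA" by (rule poly_TA[OF p(1)])
      \<comment> \<open>A neighbourhood of x on which all relevant coefficients of p, weighted by f
        at the endpoint, are small. It is open because polynomials have continuous coefficients; g
        is supported in it.\<close>
      define G where "G = (\<Inter>w\<in>W. {z \<in> topspace \<Omega>. f (word_map \<sigma> w z) * cf z w p \<in> ball 0 (2 * e)}) \<inter> topspace \<Omega>"
      have "openin \<Omega> G" unfolding G_def
      proof (rule openin_INT[OF W])
        fix w assume "w \<in> W"
        then have w: "w \<in> lists {1..n}" by (simp add: W_def)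
        have "continuous_map \<Omega> euclidean (f \<circ> word_map \<sigma> w)"
          by (rule continuous_map_compose[OF word_map_continuous[OF w] A_continuous[OF f(1)]])
        then have "continuous_map \<Omega> euclidean (\<lambda>z. f (word_map \<sigma> w z) * cf z w p)"
          using poly_continuous[OF p(1) w] by (intro continuous_map_complex_mult) (simp_all add: o_def)
        then show "openin \<Omega> {z \<in> topspace \<Omega>. f (word_map \<sigma> w z) * cf z w p \<in> ball 0 (2 * e)}"
          by (rule openin_continuous_map_preimage) simp
      qed
      \<comment> \<open>For words as long as u the coefficient of a at x vanishes, so that of p is
        at most e; for the other words f vanishes at the endpoint.\<close>
      moreover have "x \<in> G"
      proof -
        have "cmod (f (word_map \<sigma> w x) * cf x w p) < 2 * e" if w: "w \<in> W" for w
        proof (cases "length w = length u")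
          case True
          then have "cf x w p = cf x w (vminus B p a)"
            using w a0'[of w] by (simp add: W_def cf_minus TA_CB' pT aT)
          then have "cmod (cf x w p) \<le> e"
            using cf_le[OF CB_mem(5)[OF TA_CB'[OF pT] TA_CB'[OF aT]], of x w] p(2) by simp
          then have "cmod (f (word_map \<sigma> w x)) * cmod (cf x w p) \<le> 1 * e"
            using f(3) by (intro mult_mono) auto
          then show ?thesis using e by (simp add: norm_mult)
        next
          case False
          then have "f (word_map \<sigma> w x) = 0" using w sep by (intro f(4)) (auto simp: W_def)
          then show ?thesis using e by simp
        qed
        then show ?thesis using xT by (simp add: G_def)
      qed
      ultimately obtain g where g: "g \<in> vec A" "g x = 1" "\<And>z. cmod (g z) \<le> 1" "\<And>z. z \<notin> G \<Longrightarrow> g z = 0"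
        using bump by metis
      note fg = f(1) g(1)
      \<comment> \<open>Both Leibniz terms that differentiate f or g still contain a. Their
        convolutions only read coefficients of a that vanish by membership in the kernel, and f y =
        g x = 1 in the term that remains.\<close>
      have D_cut: "cf x u (D (cut f g a)) = cf x u (D a)"
      proof -
        have 1: "conv x u (amult B (\<pi> f) a) (D (\<pi> g)) = 0"
          unfolding conv_def
        proof (intro sum.neutral ballI)
          fix i assume "i \<in> {..length u}"
          then have "cf (word_map \<sigma> (drop i u) x) (take i u) a = 0"
            using lists_take_drop[OF u] by (intro a0) auto
          then show "cf (word_map \<sigma> (drop i u) x) (take i u) (amult B (\<pi> f) a) * cf x (drop i u) (D (\<pi> g)) = 0"
            by (simp add: cf_pi_mult fg TA_CB' aT)
        qed
        have 2: "conv x u (D (\<pi> f)) a = 0"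
          unfolding conv_def
        proof (intro sum.neutral ballI)
          fix i assume "i \<in> {..length u}"
          have "cf x (drop i u) a = 0" using lists_take_drop[OF u] by (intro a0') auto
          then show "cf (word_map \<sigma> (drop i u) x) (take i u) (D (\<pi> f)) * cf x (drop i u) a = 0" by simp
        qed
        have "cf x u (D (cut f g a)) = conv x u (D (amult B (\<pi> f) a)) (\<pi> g)"
          unfolding cut_def using 1 by (simp add: cf_D_mult TA_mem fg aT)
        also have "\<dots> = cf x u (amult B (D (amult B (\<pi> f) a)) (\<pi> g))"
          by (simp add: cf_mult TA_mem D_mem TA_CB' fg aT)
        also have "\<dots> = cf x u (D (amult B (\<pi> f) a)) * g x"
          by (simp add: cf_mult_pi TA_mem D_mem fg aT)
        also have "\<dots> = conv x u (\<pi> f) (D a)"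
          using 2 g(2) by (simp add: cf_D_mult TA_mem fg aT)
        also have "\<dots> = cf x u (amult B (\<pi> f) (D a))"
          by (simp add: cf_mult TA_mem D_mem TA_CB' fg aT)
        also have "\<dots> = cf x u (D a)"
          using f(2) by (simp add: cf_pi_mult D_mem TA_CB' fg aT y_def)
        finally show ?thesis .
      qed
      have small: "cmod (cf x u (D b)) \<le> K * vnorm B b" if "b \<in> vec TA" for b
        using cf_le[OF TA_CB'[OF D_mem[OF that]], of x u] K(2)[OF that] by linarith
      have 1: "cmod (cf x u (D (cut f g (vminus B a p)))) \<le> K * e"
      proof -
        have ap: "vminus B a p \<in> vec TA" using aT pT by (simp add: TA_mem)
        have "vnorm B (cut f g (vminus B a p)) \<le> vnorm B (vminus B a p)"
          by (rule norm_cut[OF fg ap f(3) g(3)])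
        also have "\<dots> \<le> e" using p(2) B.norm_minus_commute[OF TA_B[OF aT] TA_B[OF pT]] by simp
        finally show ?thesis
          using small[OF cut_TA[OF fg ap]] mult_left_mono[OF _ K(1)] by (meson order_trans)
      qed
      have qT: "q k \<in> vec TA" for k by (rule homog_TA[OF q(1)])
      have sum: "cut f g (B.vsum q j) \<in> vec TA \<and> B.vsum q j \<in> vec TA
          \<and> cf x u (D (cut f g (B.vsum q j))) = (\<Sum>k<j. cf x u (D (cut f g (q k))))" for j
      proof (induction j)
        case 0
        then show ?case by (simp add: cut_zero fg D_zero cf_zero TA_mem)
      next
        case (Suc j)
        then show ?case using cut_TA[OF fg qT[of j]]
          by (simp add: cut_add fg qT D_add cf_add D_mem TA_CB' TA_mem)
      qed
      have piece: "cmod (cf x u (D (cut f g (q k)))) \<le> K * (sqrt (real n ^ k) * (2 * e))" if k: "k < length u + 2" for k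
      proof -
        have "vnorm B (cut f g (q k)) \<le> sqrt (real n ^ k) * (2 * e)"
        proof (rule homog_norm_le[OF cut_homog[OF fg q(1)]])
          fix z w assume z: "z \<in> topspace \<Omega>" and w: "w \<in> lists {1..n}" "length w = k"
          have wW: "w \<in> W" using w k by (simp add: W_def)
          have cfq: "cf z w (q k) = cf z w p" using cf_vsum_homog[OF q(1), of z w J] pJ w(2) k by (simp add: J_def)
          show "cmod (cf z w (cut f g (q k))) \<le> 2 * e"
          proof (cases "z \<in> G")
            case True
            then have "cmod (f (word_map \<sigma> w z) * cf z w p) \<le> 2 * e" using wW by (auto simp: G_def less_imp_le)
            then have "cmod (f (word_map \<sigma> w z) * cf z w p) * cmod (g z) \<le> 2 * e * 1"
              using g(3) e by (intro mult_mono) auto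
            then show ?thesis by (simp add: cf_cut fg qT cfq norm_mult)
          next
            case False
            then show ?thesis using g(4) e by (simp add: cf_cut fg qT)
          qed
        qed (use e in simp)
        then show ?thesis using small[OF cut_TA[OF fg qT]] mult_left_mono[OF _ K(1)] by (meson order_trans)
      qed
      have 2: "cmod (cf x u (D (cut f g p))) \<le> (\<Sum>k<length u + 2. K * (sqrt (real n ^ k) * (2 * e)))"
      proof -
        have "cf x u (D (cut f g p)) = (\<Sum>k<J. cf x u (D (cut f g (q k))))" using sum[of J] pJ by simp
        \<comment> \<open>The number of homogeneous parts of p depends on e; dropping the high ones
          leaves a fixed number of terms.\<close>
        also have "\<dots> = (\<Sum>k<length u + 2. cf x u (D (cut f g (q k))))"
          using cf_D_homog[OF cut_homog[OF fg q(1)]] by (intro sum.mono_neutral_right) (auto simp: J_def)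
        finally have eq: "cf x u (D (cut f g p)) = (\<Sum>k<length u + 2. cf x u (D (cut f g (q k))))" .
        show ?thesis unfolding eq by (rule sum_norm_le) (simp only: lessThan_iff piece)
      qed
      have "cut f g a = vadd B (cut f g (vminus B a p)) (cut f g p)"
        using cut_add[OF fg, of "vminus B a p" p] B.minus_add_cancel[OF TA_B[OF aT] TA_B[OF pT]] aT pT
        by (simp add: TA_mem)
      then have "cf x u (D a) = cf x u (D (cut f g (vminus B a p))) + cf x u (D (cut f g p))"
        using D_cut cut_TA[OF fg] aT pT by (simp add: D_add cf_add D_mem TA_CB' TA_mem)
      then have "cmod (cf x u (D a)) \<le> K * e + (\<Sum>k<length u + 2. K * (sqrt (real n ^ k) * (2 * e)))"
        using 1 2 norm_triangle_mono by metis
      also have "\<dots> = C * e" by (simp add: C_def distrib_right sum_distrib_right mult.assoc del: sum.lessThan_Suc)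
      finally show ?thesis .
    qed
    have "cmod (cf x u (D a)) \<le> 0"
    proof (rule field_le_epsilon)
      fix e :: real assume e: "e > 0"
      have C: "C \<ge> 0" unfolding C_def using K(1) by (intro add_nonneg_nonneg sum_nonneg mult_nonneg_nonneg) auto
      then have "cmod (cf x u (D a)) \<le> C * (e / (C + 1))" using e by (intro bound) (simp add: add_nonneg_pos)
      also have "\<dots> \<le> e" using C e by (simp add: field_simps)
      finally show "cmod (cf x u (D a)) \<le> 0 + e" by simp
    qed
    then show ?thesis by (simp add: x_def)
  qed
  then show ?thesis unfolding coeff_kernel_def using D_mem[OF aT] by simp
qed

end

end

section \<open>Finite-dimensional quotients\<close>

text \<open>Additive bookkeeping for the next lemma. P, Q, R, U stand for d(e b f), d(e b), d(b f),
  d b, and a name such as \<open>eqf\<close> for the product e Q f.\<close>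

lemma four_corners:
  fixes P :: "'m :: ab_group_add"
  assumes "P + epf = pf + ep" "er + epf = ep + erf" "qf + epf = pf + eqf" "euf + epf = eqf + erf"
  shows "P + euf = qf + er"
proof -
  have "P = pf + ep - epf" "ep = er + epf - erf" "pf = qf + epf - eqf" "euf = eqf + erf - epf"
    using assms by (simp_all add: eq_diff_eq)
  then show ?thesis by (simp only:) (simp add: algebra_simps)
qed

text \<open>Since \<open>e, 1 - e\<close> and \<open>f, 1 - f\<close> annihilate each other, locality applied to the four corners of \<open>b\<close> gives
  \<open>d (e b f) = d (e b) f + e d (b f) - e d b f\<close> for idempotents \<open>e, f\<close>; both sides are bilinear in \<open>(e, f)\<close>.\<close>

lemma local_map_leibniz:
  fixes S :: "'m :: ring set" and d :: "'m \<Rightarrow> 'm" and sc :: "complex \<Rightarrow> 'm \<Rightarrow> 'm" and one :: 'm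
  assumes closed: "\<And>x y. x \<in> S \<Longrightarrow> y \<in> S \<Longrightarrow> x + y \<in> S" "\<And>x y. x \<in> S \<Longrightarrow> y \<in> S \<Longrightarrow> x - y \<in> S"
      "\<And>x y. x \<in> S \<Longrightarrow> y \<in> S \<Longrightarrow> x * y \<in> S" "\<And>x c. x \<in> S \<Longrightarrow> sc c x \<in> S"
    and sc: "\<And>c x y. sc c (x + y) = sc c x + sc c y" "\<And>c x y. sc c x * y = sc c (x * y)"
      "\<And>c x y. x * sc c y = sc c (x * y)"
    and one: "one \<in> S" "\<And>x. x \<in> S \<Longrightarrow> one * x = x" "\<And>x. x \<in> S \<Longrightarrow> x * one = x"
    and d: "\<And>x. x \<in> S \<Longrightarrow> d x \<in> S" "\<And>x y. x \<in> S \<Longrightarrow> y \<in> S \<Longrightarrow> d (x + y) = d x + d y"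
      "\<And>x y. x \<in> S \<Longrightarrow> y \<in> S \<Longrightarrow> d (x - y) = d x - d y" "\<And>x c. x \<in> S \<Longrightarrow> d (sc c x) = sc c (d x)" "d one = 0"
    and loc: "\<And>p a q. p \<in> S \<Longrightarrow> a \<in> S \<Longrightarrow> q \<in> S \<Longrightarrow> p * a = 0 \<Longrightarrow> a * q = 0 \<Longrightarrow> p * d a * q = 0"
    and span: "\<And>P x. x \<in> S \<Longrightarrow> (\<And>e. e \<in> S \<Longrightarrow> e * e = e \<Longrightarrow> P e)
      \<Longrightarrow> (\<And>x y. x \<in> S \<Longrightarrow> y \<in> S \<Longrightarrow> P x \<Longrightarrow> P y \<Longrightarrow> P (x + y))
      \<Longrightarrow> (\<And>c x. x \<in> S \<Longrightarrow> P x \<Longrightarrow> P (sc c x)) \<Longrightarrow> P x"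
    and x: "x \<in> S" and y: "y \<in> S"
  shows "d (x * y) = d x * y + x * d y"
proof -
  define L where "L e b f \<longleftrightarrow> d (e * b * f) + e * d b * f = d (e * b) * f + e * d (b * f)" for e b f
  have idem: "L e b f" if e: "e \<in> S" "e * e = e" and f: "f \<in> S" "f * f = f" and b: "b \<in> S" for e b f
  proof -
    let ?e = "one - e" and ?f = "one - f"
    have e': "?e \<in> S" "?e * e = 0" "e * ?e = 0" and f': "?f \<in> S" "?f * f = 0" "f * ?f = 0"
      using e f one closed(2) by (auto simp: algebra_simps)
    have m: "e * b * f \<in> S" "?e * b * f \<in> S" "e * b * ?f \<in> S" "?e * b * ?f \<in> S" "e * b \<in> S" "b * f \<in> S"
      using closed(3) e e' f f' b by blast+
    have z: "p * (e * b * g) = 0" if "p * e = 0" for p g by (simp add: that mult.assoc[symmetric])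
    have z': "p * (?e * b * g) = 0" if "p * ?e = 0" for p g using that by (simp only: mult.assoc[symmetric] mult_zero_left)
    have zr: "g * b * f * p = 0" if "f * p = 0" for g p by (simp add: that mult.assoc)
    have zr': "g * b * ?f * p = 0" if "?f * p = 0" for g p using that by (simp only: mult.assoc mult_zero_right)
    have 1: "?e * d (e * b * f) * ?f = 0" by (intro loc m e' f' z zr)
    have 2: "e * d (?e * b * f) * ?f = 0" by (intro loc m e e' f' z' zr)
    have 3: "?e * d (e * b * ?f) * f = 0" by (intro loc m e' f f' z zr')
    have 4: "e * d (?e * b * ?f) * f = 0" by (intro loc m e e' f f' z' zr')
    have D2: "d (?e * b * f) = d (b * f) - d (e * b * f)"
      using d(3)[OF m(6,1)] one b by (simp add: left_diff_distrib mult.assoc)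
    have D3: "d (e * b * ?f) = d (e * b) - d (e * b * f)"
      using d(3)[OF m(5,1)] one(3)[OF m(5)] by (simp add: right_diff_distrib)
    have D4: "d (?e * b * ?f) = d b - d (e * b) - (d (b * f) - d (e * b * f))"
    proof -
      have "?e * b * ?f = (b - e * b) - (b * f - e * b * f)"
        using one b one(3)[OF m(5)] by (simp add: algebra_simps)
      then show ?thesis using d(3) closed(2) b m by simp
    qed
    have u: "one * d w = d w" "d w * one = d w" if "w \<in> S" for w using one d(1) that by auto
    have uu: "one * (d w * g) = d w * g" if "w \<in> S" for w g using u(1)[OF that] by (simp add: mult.assoc[symmetric])
    define P Q R U where "P = d (e * b * f)" and "Q = d (e * b)" and "R = d (b * f)" and "U = d b"
    note defs = P_def[symmetric] Q_def[symmetric] R_def[symmetric] U_def[symmetric]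
    note us = u[OF m(1)] u[OF m(5)] u[OF m(6)] u[OF b] uu[OF m(1)] uu[OF m(5)] uu[OF m(6)] uu[OF b]
    note eqs = 1 2[unfolded D2] 3[unfolded D3] 4[unfolded D4]
    have "P + e * (P * f) = P * f + e * P" "e * R + e * (P * f) = e * P + e * (R * f)"
      "Q * f + e * (P * f) = P * f + e * (Q * f)" "e * (U * f) + e * (P * f) = e * (Q * f) + e * (R * f)"
      using eqs[unfolded defs] f(2)
      by (simp_all add: left_diff_distrib right_diff_distrib us[unfolded defs] mult.assoc) (simp_all add: algebra_simps)
    from four_corners[OF this] have "P + e * U * f = Q * f + e * R" by (simp add: mult.assoc)
    then show ?thesis unfolding L_def defs .
  qed
  \<comment> \<open>The spanning rule is used for f while e is still idempotent, and afterwards for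
    e with f arbitrary.\<close>
  have right: "L e b f" if e: "e \<in> S" "e * e = e" and f: "f \<in> S" and b: "b \<in> S" for e b f
    using f
  proof (rule span)
    show "L e b g" if "g \<in> S" "g * g = g" for g by (rule idem[OF e that b])
    fix g g' c assume g: "g \<in> S"
    have m: "e * b \<in> S" "e * b * g \<in> S" "b * g \<in> S" using closed(3) e g b by blast+
    show "L e b (sc c g)" if "L e b g"
      using that d(4) m unfolding L_def by (simp add: sc(2,3) sc(1)[symmetric])
    assume g': "g' \<in> S"
    have m': "e * b * g' \<in> S" "b * g' \<in> S" using closed(3) e g' b by blast+
    show "L e b (g + g')" if "L e b g" "L e b g'"
      using that m m' d(2) unfolding L_def by (simp add: distrib_left) (simp add: algebra_simps)
  qed
  have left: "L e b f" if e: "e \<in> S" and f: "f \<in> S" and b: "b \<in> S" for e b f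
    using e
  proof (rule span)
    show "L g b f" if "g \<in> S" "g * g = g" for g by (rule right[OF that f b])
    fix g g' c assume g: "g \<in> S"
    have m: "g * b \<in> S" "g * b * f \<in> S" "b * f \<in> S" using closed(3) f g b by blast+
    show "L (sc c g) b f" if "L g b f"
      using that d(4) m unfolding L_def by (simp add: sc(2,3) sc(1)[symmetric])
    assume g': "g' \<in> S"
    have m': "g' * b \<in> S" "g' * b * f \<in> S" using closed(3) f g' b by blast+
    show "L (g + g') b f" if "L g b f" "L g' b f"
      using that m m' d(2) unfolding L_def by (simp add: distrib_right) (simp add: algebra_simps)
  qed
  \<comment> \<open>With \<open>one\<close> as the middle element the extra term contains
    \<open>d one\<close>, which is 0, and the corner identity becomes the Leibniz rule.\<close>
  show ?thesis using left[OF x y one(1)] one d(5) x y unfolding L_def by simp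
qed

text \<open>A single type of class \<open>ring\<close> that holds all the quotients at once, so that
  ring automation applies to them. Their finiteness lies in the cut-off of \<open>tau\<close>, not
  in the type.\<close>

typedef lin_endo = "{T :: (nat list \<Rightarrow> complex) \<Rightarrow> nat list \<Rightarrow> complex.
    (\<forall>f g. T (\<lambda>i. f i + g i) = (\<lambda>i. T f i + T g i)) \<and> (\<forall>c f. T (\<lambda>i. c * f i) = (\<lambda>i. c * T f i))}"
  morphisms endo Abs_endo
  by (intro exI[of _ "\<lambda>f. f"]) simp

setup_lifting type_definition_lin_endo

instantiation lin_endo :: ring
begin

lift_definition zero_lin_endo :: lin_endo is "\<lambda>f i. 0" by simp
lift_definition plus_lin_endo :: "lin_endo \<Rightarrow> lin_endo \<Rightarrow> lin_endo" is "\<lambda>S T f i. S f i + T f i"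
  by (simp add: algebra_simps)
lift_definition uminus_lin_endo :: "lin_endo \<Rightarrow> lin_endo" is "\<lambda>S f i. - S f i" by simp
lift_definition minus_lin_endo :: "lin_endo \<Rightarrow> lin_endo \<Rightarrow> lin_endo" is "\<lambda>S T f i. S f i - T f i"
  by (simp add: algebra_simps)
lift_definition times_lin_endo :: "lin_endo \<Rightarrow> lin_endo \<Rightarrow> lin_endo" is "\<lambda>S T f. S (T f)" by simp

instance
proof
  fix a b c :: lin_endo
  show "a + b + c = a + (b + c)" by transfer (simp add: add.assoc)
  show "a + b = b + a" by transfer (simp add: add.commute)
  show "0 + a = a" by transfer simp
  show "- a + a = 0" by transfer simp
  show "a - b = a + - b" by transfer simp
  show "a * b * c = a * (b * c)" by transfer simp
  show "(a + b) * c = a * c + b * c" by transfer simp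
  show "a * (b + c) = a * b + a * c" by transfer simp
qed

end

lift_definition endo_scale :: "complex \<Rightarrow> lin_endo \<Rightarrow> lin_endo" is "\<lambda>c S f i. c * S f i"
  by (simp add: algebra_simps)

lemma endo_scale_simps:
  "endo_scale c (S + T) = endo_scale c S + endo_scale c T"
  "endo_scale c S * T = endo_scale c (S * T)"
  "S * endo_scale c T = endo_scale c (S * T)"
  by (transfer; simp add: algebra_simps)+

lemma endo_scale_minus_one: "endo_scale (-1) S = - S"
  by transfer simp

lemma endo_sum: "endo (\<Sum>i\<in>I. f i) g w = (\<Sum>i\<in>I. endo (f i) g w)"
  by (induction I rule: infinite_finite_induct) (auto simp: zero_lin_endo.rep_eq plus_lin_endo.rep_eq)

lemma endo_eqI: "(\<And>g w. endo S g w = endo T g w) \<Longrightarrow> S = T"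
  by (metis endo_inject ext)

context tensor_setup
begin

text \<open>A concrete model of the quotient by \<open>coeff_kernel v N\<close>: the convolution of
  \<open>conv\<close>, with an arbitrary function g on words in place of the coefficients of b, cut
  off at length N. The cut-off respects products because suffixes of w are no longer than w.\<close>

definition tau :: "'v \<Rightarrow> nat \<Rightarrow> 'b \<Rightarrow> lin_endo" where
  "tau v N a = Abs_endo (\<lambda>g w. if w \<in> lists {1..n} \<and> length w \<le> N
     then \<Sum>k\<le>length w. cf (word_map \<sigma> (drop k w) v) (take k w) a * g (drop k w) else 0)"

lemma endo_tau: "endo (tau v N a) g w = (if w \<in> lists {1..n} \<and> length w \<le> N
     then \<Sum>k\<le>length w. cf (word_map \<sigma> (drop k w) v) (take k w) a * g (drop k w) else 0)"
  unfolding tau_def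
  by (subst Abs_endo_inverse) (auto intro!: ext simp: algebra_simps sum.distrib sum_distrib_left)

lemma tau_eqI:
  assumes "\<And>u w. u \<in> lists {1..n} \<Longrightarrow> w \<in> lists {1..n} \<Longrightarrow> length u + length w \<le> N
    \<Longrightarrow> cf (word_map \<sigma> u v) w a = cf (word_map \<sigma> u v) w b"
  shows "tau v N a = tau v N b"
proof (rule endo_eqI)
  fix g w
  show "endo (tau v N a) g w = endo (tau v N b) g w"
  proof (cases "w \<in> lists {1..n} \<and> length w \<le> N")
    case True
    have "cf (word_map \<sigma> (drop k w) v) (take k w) a = cf (word_map \<sigma> (drop k w) v) (take k w) b"
      if "k \<le> length w" for k
      using True that lists_take_drop[of w "{1..n}" k] by (intro assms) simp_all
    then show ?thesis using True by (simp add: endo_tau)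
  next
    case False
    then show ?thesis unfolding endo_tau by (simp only: if_False)
  qed
qed

text \<open>The matrix entry from u to \<open>w @ u\<close>; among the suffixes of
  \<open>w @ u\<close> only the one after \<open>length w\<close> letters equals u.\<close>

lemma tau_coeff:
  assumes "u \<in> lists {1..n}" "w \<in> lists {1..n}" "length u + length w \<le> N"
  shows "endo (tau v N a) (\<lambda>s. if s = u then 1 else 0) (w @ u) = cf (word_map \<sigma> u v) w a"
proof -
  have "drop k (w @ u) = u \<longleftrightarrow> k = length w" if "k \<le> length (w @ u)" for k
  proof
    assume "drop k (w @ u) = u"
    then have "length (drop k (w @ u)) = length u" by simp
    then show "k = length w" using that by simp
  qed simp
  note summand = this
  have summand: "cf (word_map \<sigma> (drop k (w @ u)) v) (take k (w @ u)) a * (if drop k (w @ u) = u then 1 else 0)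
    = (if k = length w then cf (word_map \<sigma> u v) w a else 0)" if "k \<in> {..length (w @ u)}" for k
  proof -
    show ?thesis
    proof (cases "k = length w")
      case True
      then show ?thesis by simp
    next
      case False
      then have "drop k (w @ u) \<noteq> u" using summand[of k] that by (simp del: drop_append)
      then show ?thesis using False by (simp only: if_False mult_zero_right)
    qed
  qed
  have "endo (tau v N a) (\<lambda>s. if s = u then 1 else 0) (w @ u)
    = (\<Sum>k\<le>length (w @ u). cf (word_map \<sigma> (drop k (w @ u)) v) (take k (w @ u)) a * (if drop k (w @ u) = u then 1 else 0))"
    unfolding endo_tau using assms by (subst if_P) simp_all
  also have "\<dots> = (\<Sum>k\<le>length (w @ u). if k = length w then cf (word_map \<sigma> u v) w a else 0)"
    by (rule sum.cong[OF refl summand])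
  also have "\<dots> = cf (word_map \<sigma> u v) w a" by simp
  finally show ?thesis .
qed

lemma tau_zero_iff: "a \<in> vec TA \<Longrightarrow> tau v N a = 0 \<longleftrightarrow> a \<in> coeff_kernel v N"
proof
  assume "a \<in> vec TA" "tau v N a = 0"
  then show "a \<in> coeff_kernel v N"
    unfolding coeff_kernel_def using tau_coeff[of _ _ N v a] by (auto simp: zero_lin_endo.rep_eq)
next
  assume "a \<in> vec TA" "a \<in> coeff_kernel v N"
  then have "tau v N a = tau v N (vzero B)"
    by (intro tau_eqI) (simp add: coeff_kernel_def cf_zero)
  also have "\<dots> = 0" by (rule endo_eqI) (simp add: endo_tau cf_zero zero_lin_endo.rep_eq)
  finally show "tau v N a = 0" .
qed

lemma tau_add: "\<lbrakk>a \<in> vec TA; b \<in> vec TA\<rbrakk> \<Longrightarrow> tau v N (vadd B a b) = tau v N a + tau v N b"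
  by (rule endo_eqI) (simp add: endo_tau plus_lin_endo.rep_eq cf_add TA_CB' distrib_right sum.distrib)

lemma tau_minus: "\<lbrakk>a \<in> vec TA; b \<in> vec TA\<rbrakk> \<Longrightarrow> tau v N (vminus B a b) = tau v N a - tau v N b"
  by (rule endo_eqI) (simp add: endo_tau minus_lin_endo.rep_eq cf_minus TA_CB' left_diff_distrib sum_subtractf)

lemma tau_scale: "a \<in> vec TA \<Longrightarrow> tau v N (vscale B c a) = endo_scale c (tau v N a)"
  by (rule endo_eqI) (simp add: endo_tau endo_scale.rep_eq cf_scale TA_CB' mult.assoc sum_distrib_left)

text \<open>Associativity of convolution: w is split into three consecutive pieces, either by the
  end k of the first and the length l of the second, or by their common end m and then k.\<close>

lemma tau_mult:
  assumes "a \<in> vec TA" "b \<in> vec TA"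
  shows "tau v N (amult B a b) = tau v N a * tau v N b"
proof (rule endo_eqI)
  fix g w
  show "endo (tau v N (amult B a b)) g w = endo (tau v N a * tau v N b) g w"
  proof (cases "w \<in> lists {1..n} \<and> length w \<le> N")
    case True
    let ?h = "\<lambda>k l. cf (word_map \<sigma> (drop k w) v) (take k w) a
      * (cf (word_map \<sigma> (drop (k + l) w) v) (take l (drop k w)) b * g (drop (k + l) w))"
    have "endo (tau v N a * tau v N b) g w
      = (\<Sum>k\<le>length w. cf (word_map \<sigma> (drop k w) v) (take k w) a * endo (tau v N b) g (drop k w))"
      using True by (simp add: times_lin_endo.rep_eq endo_tau[of v N a])
    also have "\<dots> = (\<Sum>k\<le>length w. \<Sum>l\<le>length w - k. ?h k l)"
    proof (rule sum.cong[OF refl])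
      fix k assume "k \<in> {..length w}"
      have "drop k w \<in> lists {1..n} \<and> length (drop k w) \<le> N"
        using True lists_take_drop[of w "{1..n}" k] by auto
      then show "cf (word_map \<sigma> (drop k w) v) (take k w) a * endo (tau v N b) g (drop k w) = (\<Sum>l\<le>length w - k. ?h k l)"
        unfolding endo_tau by (subst if_P) (simp_all add: sum_distrib_left add.commute)
    qed
    also have "\<dots> = (\<Sum>(k, l)\<in>(SIGMA k:{..length w}. {..length w - k}). ?h k l)" by (simp add: sum.Sigma)
    also have "(SIGMA k:{..length w}. {..length w - k}) = {(i, j). i + j \<le> length w}" by auto
    also have "(\<Sum>(k, l)\<in>{(i, j). i + j \<le> length w}. ?h k l) = (\<Sum>m\<le>length w. \<Sum>k\<le>m. ?h k (m - k))"
      by (rule sum.triangle_reindex_eq)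
    also have "\<dots> = endo (tau v N (amult B a b)) g w"
    proof -
      have "(\<Sum>k\<le>m. ?h k (m - k)) = cf (word_map \<sigma> (drop m w) v) (take m w) (amult B a b) * g (drop m w)"
        if m: "m \<le> length w" for m
      proof -
        have "drop k (take m w) @ drop m w = drop k w" if "k \<le> m" for k
        proof -
          have "drop k w = drop k (take m w @ drop m w)" by simp
          also have "\<dots> = drop k (take m w) @ drop m w" using that m by (simp del: append_take_drop_id)
          finally show ?thesis by simp
        qed
        then have "word_map \<sigma> (drop k (take m w)) (word_map \<sigma> (drop m w) v) = word_map \<sigma> (drop k w) v"
          if "k \<le> m" for k using that by (simp add: word_map_append[symmetric])
        then show ?thesis
          using m by (simp add: cf_mult assms TA_CB' conv_def sum_distrib_right min_def drop_take mult.assoc)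
      qed
      then show ?thesis using True by (simp add: endo_tau)
    qed
    finally show ?thesis by simp
  qed (auto simp: endo_tau times_lin_endo.rep_eq)
qed

lemma coeff_kernel_closed:
  assumes "\<And>k. s k \<in> coeff_kernel v N" "l \<in> vec TA" "vconverges B s l"
  shows "l \<in> coeff_kernel v N"
  unfolding coeff_kernel_def
proof (intro CollectI conjI assms(2) ballI impI)
  fix u w assume uw: "u \<in> lists {1..n}" "w \<in> lists {1..n}" "length u + length w \<le> N"
  have "range s \<subseteq> vec CB" using assms(1) TA_CB' by (auto simp: coeff_kernel_def)
  then have "(\<lambda>k. cf (word_map \<sigma> u v) w (s k)) \<longlonglongrightarrow> cf (word_map \<sigma> u v) w l"
    using assms(2,3) TA_CB' by (intro cf_tendsto)
  moreover have "cf (word_map \<sigma> u v) w (s k) = 0" for k using assms(1)[of k] uw by (simp add: coeff_kernel_def)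
  ultimately show "cf (word_map \<sigma> u v) w l = 0" by (simp add: LIMSEQ_const_iff)
qed

text \<open>Interpolation point by point: a bump at the new point corrects the value there and
  leaves the earlier ones alone.\<close>

lemma unit_function:
  assumes "finite V" "V \<subseteq> topspace \<Omega>"
  shows "\<exists>h\<in>vec A. \<forall>x\<in>V. h x = 1"
  using assms
proof (induction V rule: finite_induct)
  case empty
  then show ?case using corr.A.zero_mem by blast
next
  case (insert x V)
  then obtain h where h: "h \<in> vec A" "\<forall>y\<in>V. h y = 1" by auto
  obtain f where f: "f \<in> vec A" "f x = 1" "\<And>z. z \<in> V \<Longrightarrow> z \<noteq> x \<Longrightarrow> f z = 0"
    using bump_finite[OF insert(1), of x] insert(4) by (metis insert_subset)
  have "vadd A h (vscale A (1 - h x) f) \<in> vec A" by (intro corr.A.add_mem corr.A.scale_mem h f)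
  moreover have "\<forall>y\<in>insert x V. vadd A h (vscale A (1 - h x) f) y = 1"
    using h f insert(2) by (auto simp: C0_simps)
  ultimately show ?case by blast
qed

lemma edge_function:
  assumes "f \<in> vec A" "i \<in> {1..n}"
  shows "(\<lambda>(j, z). if j = i then f z else 0) \<in> vec X"
  unfolding dynamical_correspondence_simps C0_functions_def
proof (intro CollectI conjI allI impI)
  let ?P = "prod_topology (discrete_topology {1..n}) \<Omega>" and ?F = "\<lambda>(j, z). if j = i then f z else 0"
  have f: "continuous_map \<Omega> euclidean f" "\<And>e. e > 0 \<Longrightarrow> compactin \<Omega> {x \<in> topspace \<Omega>. e \<le> cmod (f x)}"
    "\<And>x. x \<notin> topspace \<Omega> \<Longrightarrow> f x = 0"
    using assms(1) unfolding C0_simps C0_functions_def by simp_all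
  have "continuous_map ?P euclidean (\<lambda>p. (if fst p = i then 1 else 0) * f (snd p))"
  proof (rule continuous_map_complex_mult)
    have "continuous_map (discrete_topology {1..n}) euclidean (\<lambda>j. if j = i then 1 else 0 :: complex)"
      by simp
    from continuous_map_compose[OF continuous_map_fst this]
    show "continuous_map ?P euclidean (\<lambda>p. if fst p = i then 1 else 0 :: complex)" by (simp add: o_def)
    from continuous_map_compose[OF continuous_map_snd f(1)]
    show "continuous_map ?P euclidean (\<lambda>p. f (snd p))" by (simp add: o_def)
  qed
  then show "continuous_map ?P euclidean ?F"
    by (rule continuous_map_eq) (simp add: case_prod_beta)
  show "compactin ?P {x \<in> topspace ?P. e \<le> cmod (?F x)}" if "e > 0" for e
  proof -
    have "{x \<in> topspace ?P. e \<le> cmod (?F x)} = {i} \<times> {x \<in> topspace \<Omega>. e \<le> cmod (f x)}"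
      using that assms(2) by (auto split: if_splits)
    then show ?thesis using f(2)[OF that] assms(2) by (simp add: compactin_Times)
  qed
  show "?F x = 0" if "x \<notin> topspace ?P" for x using that assms(2) f(3) by (auto split: prod.split)
qed

text \<open>Lifts the paths of the finite graph to the tensor algebra: a bump at x for the empty
  path, then one edge function for each letter.\<close>

lemma path_element:
  assumes V: "finite V" and x: "x \<in> topspace \<Omega>" and u: "u \<in> lists {1..n}"
  shows "\<exists>p\<in>vec TA. \<forall>y\<in>V. \<forall>w. cf y w p = (if y = x \<and> w = u then 1 else 0)"
  using u
proof (induction u)
  case Nil
  obtain f where f: "f \<in> vec A" "f x = 1" "\<And>z. z \<in> V \<Longrightarrow> z \<noteq> x \<Longrightarrow> f z = 0"
    using bump_finite[OF V x] by metis
  have "\<forall>y\<in>V. \<forall>w. cf y w (\<pi> f) = (if y = x \<and> w = [] then 1 else 0)" using f by (auto simp: cf_pi)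
  then show ?case using pi_TA[OF f(1)] by blast
next
  case (Cons i u)
  then obtain p where p: "p \<in> vec TA" "\<forall>y\<in>V. \<forall>w. cf y w p = (if y = x \<and> w = u then 1 else 0)" by auto
  have "word_map \<sigma> u x \<in> topspace \<Omega>" by (rule word_map_topspace[OF Cons.hyps(2) x])
  \<comment> \<open>No vanishing of f elsewhere is required, because p already has no other
    coefficients over V.\<close>
  then obtain f where f: "f \<in> vec A" "f (word_map \<sigma> u x) = 1" using bump_finite[of "{}"] by (metis finite.emptyI)
  define F where "F = (\<lambda>(j, z). if j = i then f z else 0)"
  have F: "F \<in> vec X" unfolding F_def using f Cons.hyps(1) by (intro edge_function)
  have "\<forall>y\<in>V. \<forall>w. cf y w (amult B (t F) p) = (if y = x \<and> w = i # u then 1 else 0)"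
    using p f(2) F by (auto simp: cf_t_mult TA_CB' F_def split: list.split)
  then show ?case using p(1) F by (intro bexI[of _ "amult B (t F) p"]) (simp_all add: TA_mem)
qed

text \<open>Continuity is available for a polynomial p near c only. With e a third of the supposed
  value, p exceeds e in modulus on an open set around v; this set contains a point outside
  \<open>Omega0\<close>, where c vanishes and p is smaller than e.\<close>

lemma coeff_zero_of_dense:
  assumes int: "\<Omega> interior_of (Omega0 \<Omega> n \<sigma>) = {}" and c: "c \<in> vec TA" and w: "w \<in> lists {1..n}"
    and zero: "\<And>v. v \<in> topspace \<Omega> \<Longrightarrow> v \<notin> Omega0 \<Omega> n \<sigma> \<Longrightarrow> cf v w c = 0"
    and v: "v \<in> topspace \<Omega>"
  shows "cf v w c = 0"
proof (rule ccontr)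
  assume nz: "cf v w c \<noteq> 0"
  define e where "e = cmod (cf v w c) / 3"
  have e: "e > 0" using nz by (simp add: e_def)
  obtain p where p: "poly p" "vnorm B (vminus B p c) < e" using poly_dense[OF c e] by blast
  have close: "cmod (cf z w p - cf z w c) < e" for z
    using cf_le[OF CB_mem(5)[OF poly_CB[OF p(1)] TA_CB'[OF c]], of z w] p(2)
    by (simp add: cf_minus poly_CB[OF p(1)] TA_CB'[OF c])
  define G where "G = {z \<in> topspace \<Omega>. cf z w p \<in> - cball 0 e}"
  have "openin \<Omega> G" unfolding G_def
    by (rule openin_continuous_map_preimage[OF poly_continuous[OF p(1) w]]) (simp add: open_Compl)
  moreover have "v \<in> G"
  proof -
    have "cmod (cf v w c) \<le> cmod (cf v w p) + cmod (cf v w p - cf v w c)"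
      by (metis norm_triangle_sub norm_minus_commute)
    moreover have "cmod (cf v w c) = 3 * e" by (simp add: e_def)
    ultimately have "e < cmod (cf v w p)" using close[of v] e by linarith
    then show ?thesis using v by (simp add: G_def)
  qed
  moreover have "\<not> G \<subseteq> Omega0 \<Omega> n \<sigma>"
    using int calculation unfolding interior_of_def by blast
  ultimately obtain z where "z \<in> G" "z \<notin> Omega0 \<Omega> n \<sigma>" by blast
  then show False using zero[of z] close[of z] by (simp add: G_def)
qed

section \<open>Approximately local derivations modulo a coefficient kernel\<close>

context
  fixes \<delta> :: "'b \<Rightarrow> 'b"
  assumes ald: "approximately_local_derivation TA \<delta>"
begin

lemma ald_map: "bounded_linear_map TA TA \<delta>"
  using ald unfolding approximately_local_derivation_def by blast

lemma ald_mem: "x \<in> vec TA \<Longrightarrow> \<delta> x \<in> vec TA"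
  and ald_add: "\<lbrakk>x \<in> vec TA; y \<in> vec TA\<rbrakk> \<Longrightarrow> \<delta> (vadd B x y) = vadd B (\<delta> x) (\<delta> y)"
  and ald_scale: "x \<in> vec TA \<Longrightarrow> \<delta> (vscale B c x) = vscale B c (\<delta> x)"
  using bounded_linear_mapD[OF ald_map] by simp_all

lemma ald_minus: "\<lbrakk>x \<in> vec TA; y \<in> vec TA\<rbrakk> \<Longrightarrow> \<delta> (vminus B x y) = vminus B (\<delta> x) (\<delta> y)"
  using bounded_linear_map_minus[OF ald_map TA.complex_banach_space_axioms, of x y] by simp

lemma ald_approx:
  assumes "x \<in> vec TA"
  obtains D where "\<And>k. derivation TA (D k)" "vconverges B (\<lambda>k. D k x) (\<delta> x)"
  using ald assms unfolding approximately_local_derivation_def TA_simps by blast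

context
  fixes v :: 'v and N :: nat
  assumes v: "v \<in> topspace \<Omega>" and v0: "v \<notin> Omega0 \<Omega> n \<sigma>"
begin

abbreviation "\<tau> \<equiv> tau v N"

lemma tau_derivation_zero:
  assumes "derivation TA D" "a \<in> vec TA" "\<tau> a = 0"
  shows "\<tau> (D a) = 0"
  using derivation_coeff_kernel[OF assms(1) v v0, of a N] D_mem[OF assms(1,2)] assms(2,3)
  by (simp add: tau_zero_iff)

lemma tau_limit_zero:
  assumes "\<And>k. s k \<in> vec TA" "\<And>k. \<tau> (s k) = 0" "l \<in> vec TA" "vconverges B s l"
  shows "\<tau> l = 0"
  using coeff_kernel_closed[of s v N l] assms by (simp add: tau_zero_iff)

lemma tau_ald_zero:
  assumes a: "a \<in> vec TA" "\<tau> a = 0"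
  shows "\<tau> (\<delta> a) = 0"
proof -
  obtain D where D: "\<And>k. derivation TA (D k)" "vconverges B (\<lambda>k. D k a) (\<delta> a)" using ald_approx[OF a(1)] by blast
  show ?thesis
    by (rule tau_limit_zero[OF _ _ _ D(2)]) (simp_all add: D_mem[OF D(1)] tau_derivation_zero[OF D(1)] a ald_mem)
qed

text \<open>For a derivation D the element D(p a) vanishes in the quotient, and multiplying its
  Leibniz expansion by q on the right removes the term with D p. What remains involves D only
  through D a, so it survives the limit.\<close>

lemma tau_ald_local:
  assumes p: "p \<in> vec TA" and a: "a \<in> vec TA" and q: "q \<in> vec TA"
    and pa: "\<tau> p * \<tau> a = 0" and aq: "\<tau> a * \<tau> q = 0"
  shows "\<tau> p * \<tau> (\<delta> a) * \<tau> q = 0"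
proof -
  obtain D where D: "\<And>k. derivation TA (D k)" "vconverges B (\<lambda>k. D k a) (\<delta> a)" using ald_approx[OF a] by blast
  note Dm = D_mem[OF D(1)]
  have pamem: "amult B p a \<in> vec TA" using p a by (simp add: TA_mem)
  have zero: "\<tau> (amult B (amult B p (D k a)) q) = 0" for k
  proof -
    have "\<tau> (D k (amult B p a)) = 0"
      using tau_derivation_zero[OF D(1) pamem] pa by (simp add: tau_mult p a)
    then have "\<tau> (D k p) * \<tau> a + \<tau> p * \<tau> (D k a) = 0"
      by (simp add: D_mult[OF D(1)] p a tau_add tau_mult Dm TA_mem)
    then have "(\<tau> (D k p) * \<tau> a + \<tau> p * \<tau> (D k a)) * \<tau> q = 0" by simp
    then have "\<tau> p * \<tau> (D k a) * \<tau> q = 0"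
      using aq by (simp only: distrib_right mult.assoc) (simp add: mult.assoc)
    then show ?thesis by (simp add: tau_mult p a q Dm TA_mem)
  qed
  have "vconverges B (\<lambda>k. amult B (amult B p (D k a)) q) (amult B (amult B p (\<delta> a)) q)"
    using Dm[OF a] p q ald_mem[OF a] D(2) TA_B B.mult_mem
    by (intro B.vconverges_mult_right B.vconverges_mult_left) auto
  from tau_limit_zero[OF _ zero _ this] have "\<tau> (amult B (amult B p (\<delta> a)) q) = 0"
    using Dm[OF a] p q ald_mem[OF a] by (simp add: TA_mem)
  then show ?thesis using p q ald_mem[OF a] by (simp add: tau_mult TA_mem)
qed

text \<open>The vertices are points, not words: different words of equal length may meet and then
  share a vertex.\<close>

definition vertices :: "'v set" where
  "vertices = (\<lambda>u. word_map \<sigma> u v) ` {u \<in> lists {1..n}. length u \<le> N}"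

lemma short_words_finite: "finite {u \<in> lists {1..n}. length u \<le> N}"
  using finite_lists_length_le[of "{1..n}" N] by (simp add: lists_eq_set)

lemma vertices_finite: "finite vertices"
  unfolding vertices_def using short_words_finite by simp

lemma verticesI: "u \<in> lists {1..n} \<Longrightarrow> length u \<le> N \<Longrightarrow> word_map \<sigma> u v \<in> vertices"
  unfolding vertices_def by blast

lemma vertices_topspace: "vertices \<subseteq> topspace \<Omega>"
  unfolding vertices_def using word_map_topspace v by blast

lemma no_cycle:
  assumes "x \<in> vertices" "u \<in> lists {1..n}" "u \<noteq> []"
  shows "word_map \<sigma> u x \<noteq> x"
proof
  assume eq: "word_map \<sigma> u x = x"
  obtain s where s: "s \<in> lists {1..n}" "x = word_map \<sigma> s v" using assms(1) unfolding vertices_def by blast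
  have "word_map \<sigma> (u @ s) v = word_map \<sigma> s v" using eq s(2) by (simp add: word_map_append)
  moreover have "u @ s \<in> lists {1..n}" "length (u @ s) \<noteq> length s" using assms s by auto
  ultimately show False using v v0 s(1) unfolding Omega0_def by blast
qed

text \<open>A function equal to 1 at the finitely many vertices acts as identity on both sides,
  since base points and endpoints of all words within the cut-off are vertices.\<close>

lemma tau_unit: "\<exists>h\<in>vec TA. \<forall>a\<in>vec TA. \<tau> h * \<tau> a = \<tau> a \<and> \<tau> a * \<tau> h = \<tau> a"
proof -
  obtain f where f: "f \<in> vec A" "\<forall>x\<in>vertices. f x = 1"
    using unit_function[OF vertices_finite vertices_topspace] by blast
  have "\<tau> (\<pi> f) * \<tau> a = \<tau> a \<and> \<tau> a * \<tau> (\<pi> f) = \<tau> a" if a: "a \<in> vec TA" for a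
  proof
    have "\<tau> (amult B (\<pi> f) a) = \<tau> a"
    proof (rule tau_eqI)
      fix u w assume uw: "u \<in> lists {1..n}" "w \<in> lists {1..n}" "length u + length w \<le> N"
      have "word_map \<sigma> w (word_map \<sigma> u v) \<in> vertices"
        using verticesI[of "w @ u"] uw by (simp add: word_map_append)
      then show "cf (word_map \<sigma> u v) w (amult B (\<pi> f) a) = cf (word_map \<sigma> u v) w a"
        using f by (simp add: cf_pi_mult TA_CB' a)
    qed
    then show "\<tau> (\<pi> f) * \<tau> a = \<tau> a" by (simp add: tau_mult a f TA_mem)
    have "\<tau> (amult B a (\<pi> f)) = \<tau> a"
    proof (rule tau_eqI)
      fix u w assume uw: "u \<in> lists {1..n}" "w \<in> lists {1..n}" "length u + length w \<le> N"
      then have "word_map \<sigma> u v \<in> vertices" using verticesI by simp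
      then show "cf (word_map \<sigma> u v) w (amult B a (\<pi> f)) = cf (word_map \<sigma> u v) w a"
        using f by (simp add: cf_mult_pi a)
    qed
    then show "\<tau> a * \<tau> (\<pi> f) = \<tau> a" by (simp add: tau_mult a f TA_mem)
  qed
  then show ?thesis using pi_TA[OF f(1)] by blast
qed

text \<open>h h - h lies in the kernel, so a derivation takes h h and h to the same class, whereas
  the Leibniz rule gives twice the class of D h.\<close>

lemma tau_ald_unit:
  assumes h: "h \<in> vec TA" "\<And>a. a \<in> vec TA \<Longrightarrow> \<tau> h * \<tau> a = \<tau> a \<and> \<tau> a * \<tau> h = \<tau> a"
  shows "\<tau> (\<delta> h) = 0"
proof -
  obtain D where D: "\<And>k. derivation TA (D k)" "vconverges B (\<lambda>k. D k h) (\<delta> h)" using ald_approx[OF h(1)] by blast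
  note Dm = D_mem[OF D(1)]
  have "\<tau> (D k h) = 0" for k
  proof -
    have hh: "amult B h h \<in> vec TA" using h by (simp add: TA_mem)
    have "\<tau> (vminus B (amult B h h) h) = 0" using h by (simp add: tau_minus hh tau_mult)
    then have "\<tau> (D k (vminus B (amult B h h) h)) = 0"
      using tau_derivation_zero[OF D(1)] hh h(1) by (simp add: TA_mem)
    moreover have "D k (vminus B (amult B h h) h) = vminus B (D k (amult B h h)) (D k h)"
      using bounded_linear_map_minus[OF derivationD(1)[OF D(1)] TA.complex_banach_space_axioms, of "amult B h h" h] hh h(1)
      by simp
    ultimately have "\<tau> (D k (amult B h h)) = \<tau> (D k h)" using Dm hh h(1) by (simp add: tau_minus)
    then have "\<tau> (D k h) + \<tau> (D k h) = \<tau> (D k h)"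
      using h(2)[OF Dm[OF h(1)]] Dm h(1) by (simp add: D_mult[OF D(1)] tau_add tau_mult TA_mem)
    then show ?thesis by simp
  qed
  from tau_limit_zero[OF _ this _ D(2)] show ?thesis using Dm h(1) ald_mem by simp
qed

definition path :: "'v \<Rightarrow> nat list \<Rightarrow> 'b" where
  "path x u = (SOME p. p \<in> vec TA \<and> (\<forall>y\<in>vertices. \<forall>w. cf y w p = (if y = x \<and> w = u then 1 else 0)))"

lemma path:
  assumes "x \<in> vertices" "u \<in> lists {1..n}"
  shows "path x u \<in> vec TA" and "y \<in> vertices \<Longrightarrow> cf y w (path x u) = (if y = x \<and> w = u then 1 else 0)"
proof -
  have "\<exists>p. p \<in> vec TA \<and> (\<forall>y\<in>vertices. \<forall>w. cf y w p = (if y = x \<and> w = u then 1 else 0))"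
    using path_element[OF vertices_finite _ assms(2), of x] vertices_topspace assms(1) by blast
  from someI_ex[OF this] show "path x u \<in> vec TA"
    and "y \<in> vertices \<Longrightarrow> cf y w (path x u) = (if y = x \<and> w = u then 1 else 0)"
    unfolding path_def by blast+
qed

text \<open>Paths multiply by concatenation when the right one ends where the left one starts. In
  the convolution only the split after \<open>length u\<close> letters can contribute.\<close>

lemma tau_path_mult:
  assumes x: "x \<in> vertices" "u \<in> lists {1..n}" and x': "x' \<in> vertices" "u' \<in> lists {1..n}"
  shows "\<tau> (path x u) * \<tau> (path x' u') = (if word_map \<sigma> u' x' = x then \<tau> (path x' (u @ u')) else 0)"
proof -
  have uu: "u @ u' \<in> lists {1..n}" using x x' by simp
  let ?r = "if word_map \<sigma> u' x' = x then path x' (u @ u') else vzero B"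
  have "\<tau> (amult B (path x u) (path x' u')) = \<tau> ?r"
  proof (rule tau_eqI)
    fix s w assume sw: "s \<in> lists {1..n}" "w \<in> lists {1..n}" "length s + length w \<le> N"
    define y where "y = word_map \<sigma> s v"
    have y: "word_map \<sigma> (drop k w) y \<in> vertices" for k
    proof -
      have "drop k w @ s \<in> lists {1..n}" using lists_take_drop[OF sw(2), of k] sw(1) by simp
      then show ?thesis using verticesI[of "drop k w @ s"] sw(3) by (simp add: y_def word_map_append)
    qed
    have yv: "y \<in> vertices" using y[of "length w"] by simp
    have "cf y w (amult B (path x u) (path x' u')) = conv y w (path x u) (path x' u')"
      by (simp add: cf_mult path(1)[OF x] path(1)[OF x'] TA_CB')
    also have "\<dots> = (\<Sum>k\<le>length w. if take k w = u \<and> drop k w = u' \<and> y = x' \<and> word_map \<sigma> u' x' = x then 1 else 0)"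
      unfolding conv_def by (intro sum.cong refl) (auto simp: path(2)[OF x y] path(2)[OF x' yv])
    also have "\<dots> = (\<Sum>k\<le>length w. if k = length u then (if w = u @ u' \<and> y = x' \<and> word_map \<sigma> u' x' = x then 1 else 0) else 0)"
    proof (intro sum.cong refl)
      fix k assume k: "k \<in> {..length w}"
      have "take k w = u \<and> drop k w = u' \<longleftrightarrow> k = length u \<and> w = u @ u'"
        using k by (metis append_eq_conv_conj append_take_drop_id atMost_iff length_take min.absorb2)
      then have eq: "(take k w = u \<and> drop k w = u' \<and> y = x' \<and> word_map \<sigma> u' x' = x)
        = (k = length u \<and> w = u @ u' \<and> y = x' \<and> word_map \<sigma> u' x' = x)" by blast
      show "(if take k w = u \<and> drop k w = u' \<and> y = x' \<and> word_map \<sigma> u' x' = x then 1 else 0)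
        = (if k = length u then (if w = u @ u' \<and> y = x' \<and> word_map \<sigma> u' x' = x then 1 else 0) else 0 :: complex)"
        unfolding eq by simp
    qed
    also have "\<dots> = (if w = u @ u' \<and> y = x' \<and> word_map \<sigma> u' x' = x then 1 else 0)" by auto
    also have "\<dots> = (if word_map \<sigma> u' x' = x then cf y w (path x' (u @ u')) else 0)"
      unfolding path(2)[OF x'(1) uu yv] by auto
    also have "\<dots> = cf y w ?r" by (simp add: cf_zero)
    finally show "cf (word_map \<sigma> s v) w (amult B (path x u) (path x' u')) = cf (word_map \<sigma> s v) w ?r"
      by (simp add: y_def)
  qed
  moreover have "\<tau> (vzero B) = 0" using tau_zero_iff[of "vzero B" v N] TA_mem(1) by (simp add: coeff_kernel_def cf_zero)
  ultimately show ?thesis using path(1)[OF x] path(1)[OF x'] by (simp add: tau_mult split: if_splits)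
qed

text \<open>The index set also contains pairs whose path does not fit under the cut-off; their
  images under \<tau> are 0, so no condition linking x and u is imposed.\<close>

lemma tau_expand:
  assumes a: "a \<in> vec TA"
  shows "\<tau> a = (\<Sum>(x, u)\<in>vertices \<times> {u \<in> lists {1..n}. length u \<le> N}. endo_scale (cf x u a) (\<tau> (path x u)))"
proof (rule endo_eqI)
  fix g w
  let ?I = "vertices \<times> {u \<in> lists {1..n}. length u \<le> N}"
  have fin: "finite ?I" using vertices_finite short_words_finite by simp
  show "endo (\<tau> a) g w = endo (\<Sum>(x, u)\<in>?I. endo_scale (cf x u a) (\<tau> (path x u))) g w"
  proof (cases "w \<in> lists {1..n} \<and> length w \<le> N")
    case True
    let ?y = "\<lambda>k. word_map \<sigma> (drop k w) v"
    have mem: "?y k \<in> vertices \<and> take k w \<in> lists {1..n} \<and> length (take k w) \<le> N" for k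
      using True lists_take_drop[of w "{1..n}" k] by (auto intro!: verticesI)
    have "endo (\<Sum>(x, u)\<in>?I. endo_scale (cf x u a) (\<tau> (path x u))) g w
      = (\<Sum>(x, u)\<in>?I. \<Sum>k\<le>length w. cf x u a * (cf (?y k) (take k w) (path x u) * g (drop k w)))"
      using True by (simp add: endo_sum case_prod_beta endo_scale.rep_eq endo_tau sum_distrib_left)
    also have "\<dots> = (\<Sum>(x, u)\<in>?I. \<Sum>k\<le>length w. if (x, u) = (?y k, take k w) then cf x u a * g (drop k w) else 0)"
    proof (rule sum.cong[OF refl])
      fix i assume "i \<in> ?I"
      then obtain x u where i: "i = (x, u)" "x \<in> vertices" "u \<in> lists {1..n}" by blast
      have "cf x u a * (cf (?y k) (take k w) (path x u) * g (drop k w))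
        = (if (x, u) = (?y k, take k w) then cf x u a * g (drop k w) else 0)" for k
        using path(2)[OF i(2,3), of "?y k" "take k w"] mem[of k, THEN conjunct1] by auto
      then show "(case i of (x, u) \<Rightarrow> \<Sum>k\<le>length w. cf x u a * (cf (?y k) (take k w) (path x u) * g (drop k w)))
        = (case i of (x, u) \<Rightarrow> \<Sum>k\<le>length w. if (x, u) = (?y k, take k w) then cf x u a * g (drop k w) else 0)"
        unfolding i(1) prod.case by (rule sum.cong[OF refl])
    qed
    also have "\<dots> = (\<Sum>k\<le>length w. \<Sum>i\<in>?I. if i = (?y k, take k w) then cf (?y k) (take k w) a * g (drop k w) else 0)"
      by (subst sum.swap) (auto intro!: sum.cong simp: case_prod_beta)
    also have "\<dots> = (\<Sum>k\<le>length w. cf (?y k) (take k w) a * g (drop k w))"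
    proof (rule sum.cong[OF refl])
      fix k
      have "(?y k, take k w) \<in> ?I" using mem[of k] by blast
      then show "(\<Sum>i\<in>?I. if i = (?y k, take k w) then cf (?y k) (take k w) a * g (drop k w) else 0)
        = cf (?y k) (take k w) a * g (drop k w)"
        by (subst sum.delta[OF fin]) (rule if_P)
    qed
    also have "\<dots> = endo (\<tau> a) g w" using True by (simp add: endo_tau)
    finally show ?thesis by simp
  next
    case False
    then show ?thesis by (simp only: endo_sum endo_tau case_prod_beta endo_scale.rep_eq if_False mult_zero_right sum.neutral_const)
  qed
qed

text \<open>For \<open>u \<noteq> []\<close> both \<open>e = path x []\<close> and \<open>e + path x u\<close> are idempotent, because the path \<open>u\<close> does not return
  to \<open>x\<close>.\<close>

lemma tau_span:
  assumes a: "a \<in> vec TA"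
    and idem: "\<And>e. e \<in> \<tau> ` vec TA \<Longrightarrow> e * e = e \<Longrightarrow> P e"
    and add: "\<And>x y. x \<in> \<tau> ` vec TA \<Longrightarrow> y \<in> \<tau> ` vec TA \<Longrightarrow> P x \<Longrightarrow> P y \<Longrightarrow> P (x + y)"
    and scale: "\<And>c x. x \<in> \<tau> ` vec TA \<Longrightarrow> P x \<Longrightarrow> P (endo_scale c x)"
  shows "P (\<tau> a)"
proof -
  have addm: "x + y \<in> \<tau> ` vec TA" if "x \<in> \<tau> ` vec TA" "y \<in> \<tau> ` vec TA" for x y
    using that tau_add[symmetric, where v = v and N = N] by (auto simp: TA_mem)
  have scalem: "endo_scale c x \<in> \<tau> ` vec TA" if "x \<in> \<tau> ` vec TA" for c x
    using that tau_scale[symmetric, where v = v and N = N and c = c] by (auto simp: TA_mem)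
  have p: "P (\<tau> (path x u))" if x: "x \<in> vertices" and u: "u \<in> lists {1..n}" for x u
  proof -
    have nil: "[] \<in> lists {1..n}" by simp
    let ?e = "\<tau> (path x [])" and ?p = "\<tau> (path x u)"
    have mem: "?e \<in> \<tau> ` vec TA" "?p \<in> \<tau> ` vec TA" using path(1)[OF x nil] path(1)[OF x u] by blast+
    have ee: "?e * ?e = ?e" using tau_path_mult[OF x nil x nil] by simp
    show ?thesis
    proof (cases "u = []")
      case True
      then show ?thesis using idem[OF mem(1) ee] by simp
    next
      case False
      have "?p * ?e = ?p" using tau_path_mult[OF x u x nil] by simp
      moreover have "?e * ?p = 0" "?p * ?p = 0"
        using tau_path_mult[OF x nil x u] tau_path_mult[OF x u x u] no_cycle[OF x u False] by simp_all
      ultimately have "(?e + ?p) * (?e + ?p) = ?e + ?p" by (simp add: distrib_left distrib_right ee)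
      then have "P (?e + ?p)" by (rule idem[OF addm[OF mem]])
      moreover have "P (endo_scale (-1) ?e)" by (rule scale[OF mem(1) idem[OF mem(1) ee]])
      ultimately have "P (?e + ?p + endo_scale (-1) ?e)" by (rule add[OF addm[OF mem] scalem[OF mem(1)]])
      moreover have "?e + ?p + endo_scale (-1) ?e = ?p" by (simp only: endo_scale_minus_one) simp
      ultimately show ?thesis by simp
    qed
  qed
  have zero: "(0 :: lin_endo) \<in> \<tau> ` vec TA"
    using tau_zero_iff[of "vzero B" v N] TA_mem(1) by (force simp: coeff_kernel_def cf_zero)
  have "(\<Sum>(x, u)\<in>I. endo_scale (cf x u a) (\<tau> (path x u))) \<in> \<tau> ` vec TA
    \<and> P (\<Sum>(x, u)\<in>I. endo_scale (cf x u a) (\<tau> (path x u)))"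
    if "finite I" "I \<subseteq> vertices \<times> {u \<in> lists {1..n}. length u \<le> N}" for I
    using that
  proof (induction I rule: finite_induct)
    case empty
    then show ?case using zero idem[OF zero] by simp
  next
    case (insert i I)
    obtain x u where i: "i = (x, u)" by force
    have xu: "x \<in> vertices" "u \<in> lists {1..n}" using insert i by auto
    have m: "\<tau> (path x u) \<in> \<tau> ` vec TA" using path(1)[OF xu] by blast
    have "P (endo_scale (cf x u a) (\<tau> (path x u)))" by (rule scale[OF m p[OF xu]])
    then show ?case using insert i scalem[OF m] addm add by simp
  qed
  from this[OF finite_cartesian_product[OF vertices_finite short_words_finite] order_refl]
  show ?thesis unfolding tau_expand[OF a] by (rule conjunct2)
qed

lemma tau_ald_leibniz:
  assumes a: "a \<in> vec TA" and b: "b \<in> vec TA"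
  shows "\<tau> (\<delta> (amult B a b)) = \<tau> (\<delta> a) * \<tau> b + \<tau> a * \<tau> (\<delta> b)"
proof -
  obtain h where h: "h \<in> vec TA" "\<And>a. a \<in> vec TA \<Longrightarrow> \<tau> h * \<tau> a = \<tau> a \<and> \<tau> a * \<tau> h = \<tau> a"
    using tau_unit by blast
  \<comment> \<open>The map induced by \<delta> on the quotient, through an arbitrary choice of
    lifts; \<open>tau_ald_zero\<close> shows that the choice does not matter.\<close>
  define d where "d m = \<tau> (\<delta> (SOME a. a \<in> vec TA \<and> \<tau> a = m))" for m
  have d: "d (\<tau> a) = \<tau> (\<delta> a)" if a: "a \<in> vec TA" for a
  proof -
    define c where "c = (SOME c. c \<in> vec TA \<and> \<tau> c = \<tau> a)"
    have c: "c \<in> vec TA \<and> \<tau> c = \<tau> a" unfolding c_def by (rule someI[of _ a]) (simp add: a)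
    then have "\<tau> (vminus B c a) = 0" using a by (simp add: tau_minus)
    then have "\<tau> (\<delta> (vminus B c a)) = 0" using c a by (intro tau_ald_zero) (simp_all add: TA_mem)
    then show ?thesis using c a by (simp add: ald_minus tau_minus ald_mem d_def c_def[symmetric])
  qed
  have "d (\<tau> a * \<tau> b) = d (\<tau> a) * \<tau> b + \<tau> a * d (\<tau> b)"
  proof (rule local_map_leibniz[where S = "\<tau> ` vec TA" and sc = endo_scale and one = "\<tau> h"])
    show "x + y \<in> \<tau> ` vec TA" "x - y \<in> \<tau> ` vec TA" "x * y \<in> \<tau> ` vec TA"
      "d (x + y) = d x + d y" "d (x - y) = d x - d y"
      if xy: "x \<in> \<tau> ` vec TA" "y \<in> \<tau> ` vec TA" for x y
    proof -
      obtain a b where ab: "a \<in> vec TA" "x = \<tau> a" "b \<in> vec TA" "y = \<tau> b" using xy by blast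
      have eqs: "x + y = \<tau> (vadd B a b)" "x - y = \<tau> (vminus B a b)" "x * y = \<tau> (amult B a b)"
        using ab by (simp_all add: tau_add tau_minus tau_mult)
      show "x + y \<in> \<tau> ` vec TA" "x - y \<in> \<tau> ` vec TA" "x * y \<in> \<tau> ` vec TA"
        unfolding eqs using ab by (auto simp: TA_mem)
      show "d (x + y) = d x + d y"
        unfolding eqs(1) d[OF TA_mem(2)[OF ab(1,3)]] using ab by (simp add: d ald_add tau_add ald_mem)
      show "d (x - y) = d x - d y"
        unfolding eqs(2) d[OF TA_mem(5)[OF ab(1,3)]] using ab by (simp add: d ald_minus tau_minus ald_mem)
    qed
    show "endo_scale c x \<in> \<tau> ` vec TA" "d (endo_scale c x) = endo_scale c (d x)" if x: "x \<in> \<tau> ` vec TA" for x c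
    proof -
      obtain a where a: "a \<in> vec TA" "x = \<tau> a" using x by blast
      have eq: "endo_scale c x = \<tau> (vscale B c a)" using a by (simp add: tau_scale)
      show "endo_scale c x \<in> \<tau> ` vec TA" unfolding eq using a by (auto simp: TA_mem)
      show "d (endo_scale c x) = endo_scale c (d x)"
        unfolding eq d[OF TA_mem(3)[OF a(1)]] using a by (simp add: d ald_scale tau_scale ald_mem)
    qed
    show "p * d a * q = 0" if "p \<in> \<tau> ` vec TA" "a \<in> \<tau> ` vec TA" "q \<in> \<tau> ` vec TA" "p * a = 0" "a * q = 0" for p a q
      using that tau_ald_local by (auto simp: d)
    show "P x" if P: "x \<in> \<tau> ` vec TA" "\<And>e. e \<in> \<tau> ` vec TA \<Longrightarrow> e * e = e \<Longrightarrow> P e"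
      "\<And>x y. x \<in> \<tau> ` vec TA \<Longrightarrow> y \<in> \<tau> ` vec TA \<Longrightarrow> P x \<Longrightarrow> P y \<Longrightarrow> P (x + y)"
      "\<And>c x. x \<in> \<tau> ` vec TA \<Longrightarrow> P x \<Longrightarrow> P (endo_scale c x)" for P x
    proof -
      obtain a where a: "a \<in> vec TA" "x = \<tau> a" using P(1) by blast
      show ?thesis unfolding a(2) by (rule tau_span[OF a(1) P(2-4)])
    qed
    show "d (\<tau> h) = 0" using d[OF h(1)] tau_ald_unit[OF h] by simp
    show "\<tau> h * x = x" "x * \<tau> h = x" if "x \<in> \<tau> ` vec TA" for x using that h(2) by auto
    show "d x \<in> \<tau> ` vec TA" if "x \<in> \<tau> ` vec TA" for x using that ald_mem by (auto simp: d)
  qed (use a b h in \<open>auto simp: endo_scale_simps\<close>)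
  then show ?thesis using a b d[OF TA_mem(4)[OF a b]] by (simp add: d tau_mult)
qed

end

theorem approximately_local_derivation_is_derivation:
  assumes int: "\<Omega> interior_of (Omega0 \<Omega> n \<sigma>) = {}"
  shows "derivation TA \<delta>"
proof -
  note mem = ald_mem
  have "\<delta> (amult B a b) = vadd B (amult B (\<delta> a) b) (amult B a (\<delta> b))" if a: "a \<in> vec TA" and b: "b \<in> vec TA" for a b
  proof -
    let ?l = "\<delta> (amult B a b)" and ?r = "vadd B (amult B (\<delta> a) b) (amult B a (\<delta> b))"
    have lr: "?l \<in> vec TA" "?r \<in> vec TA" using a b mem by (simp_all add: TA_mem)
    have "vminus B ?l ?r = vzero B"
    proof (rule cf_faithful[OF TA_mem(5)[OF lr]])
      fix v w assume v: "v \<in> topspace \<Omega>" and w: "w \<in> lists {1..n}"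
      show "cf v w (vminus B ?l ?r) = 0"
      proof (rule coeff_zero_of_dense[OF int TA_mem(5)[OF lr] w _ v])
        fix v assume v: "v \<in> topspace \<Omega>" "v \<notin> Omega0 \<Omega> n \<sigma>"
        \<comment> \<open>The cut-off at \<open>length w\<close> is just large enough to show the
          coefficient at w over v itself, the entry with \<open>u = []\<close>.\<close>
        have "tau v (length w) ?l = tau v (length w) ?r"
          using tau_ald_leibniz[OF v a b] a b mem by (simp add: tau_add tau_mult TA_mem)
        then have "cf v w ?l = cf v w ?r"
          using tau_coeff[of "[]" w "length w" v ?l] tau_coeff[of "[]" w "length w" v ?r] w by simp
        then show "cf v w (vminus B ?l ?r) = 0" by (simp add: cf_minus TA_CB' lr)
      qed
    qed
    then show ?thesis by (rule B.minus_eq_zero[OF TA_B[OF lr(1)] TA_B[OF lr(2)]])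
  qed
  then show ?thesis unfolding derivation_def using ald_map by simp
qed

end

end

theorem corollary4p11:
  fixes \<Omega> :: "'v topology" and n :: nat and \<sigma> :: "nat \<Rightarrow> 'v \<Rightarrow> 'v"
    and B :: "'b staralg" and \<pi> :: "('v \<Rightarrow> complex) \<Rightarrow> 'b" and t :: "(nat \<times> 'v \<Rightarrow> complex) \<Rightarrow> 'b"
    and \<delta> :: "'b \<Rightarrow> 'b"
  assumes "multivariable_dynamical_system \<Omega> n \<sigma>"
    and "\<Omega> interior_of (Omega0 \<Omega> n \<sigma>) = {}"
    and "universal_toeplitz_representation (C0 \<Omega>) (dynamical_correspondence \<Omega> n \<sigma>) B \<pi> t"
    and "approximately_local_derivation
           (tensor_algebra (C0 \<Omega>) (dynamical_correspondence \<Omega> n \<sigma>) B \<pi> t) \<delta>"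
  shows "derivation (tensor_algebra (C0 \<Omega>) (dynamical_correspondence \<Omega> n \<sigma>) B \<pi> t) \<delta>"
proof -
  interpret tensor_setup \<Omega> n \<sigma> B \<pi> t by unfold_locales (fact assms)+
  show ?thesis using approximately_local_derivation_is_derivation[OF _ assms(2), of \<delta>] assms(4) by (simp add: TA_def)
qed

end
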